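(* Let $r,s\in(1,2)$. The maximal operator $K^*$ is of $(r,s)$-sparse type; that is, there exists $C>0$ such that for all compactly (i.e. finitely) supported functions $f$ and $g$ on $\mathbb{Z}$ there exists a sparse collection $\mathcal{S}$ of intervals such that the $\ell^2(\mathbb{Z})$ inner product satisfies $$|(K^*f,g)|\leq C\sum_{I\in\mathcal{S}}|I|\,\langle f\rangle_{2I,r}\,\langle g\rangle_{I,s}.$$
   Context: Let $d(n)=\sum_{k\mid n}1$ be the divisor function and $D(N)=\sum_{n=1}^N d(n)$. For a function $f$ on the integers, define $$K_N f(x)=\frac{1}{D(N)}\sum_{n=1}^{N} d(n)\, f(x+n),\qquad K^*f(x)=\sup_{N\geq 1}|K_Nf(x)|,\qquad x\in\mathbb{Z}.$$ Intervals are finite sets of consecutive integers, and $|I|$ is the number of elements of $I$. For an interval $I\subset\mathbb{Z}$ and $1\le p<\infty$, write $$\langle f\rangle_{I,p}=\Big(\frac{1}{|I|}\sum_{x\in I}|f(x)|^p\Big)^{1/p}.$$ For $I=[a,b]\cap\mathbb{Z}$ (with $a\le b$ integers), the doubled interval is $2I=[2a-b-1,b]\cap\mathbb{Z}$. A collection $\mathcal{S}$ of intervals is called sparse if for every $I\in\mathcal{S}$ there exists a set $E_I\subset I$ with $|E_I|>|I|/2$ such that the sets $E_I$, $I\in\mathcal{S}$, are pairwise disjoint. *)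

theory Defs
  imports "HOL-Analysis.Analysis"
begin

definition divisor_count :: "nat \<Rightarrow> nat" where
  "divisor_count n = card {k. k dvd n}"

definition divisor_sum :: "nat \<Rightarrow> nat" where
  "divisor_sum N = (\<Sum>n=1..N. divisor_count n)"

definition divisor_avg :: "nat \<Rightarrow> (int \<Rightarrow> complex) \<Rightarrow> int \<Rightarrow> complex" where
  "divisor_avg N f x =
     1 / of_nat (divisor_sum N) * (\<Sum>n=1..N. of_nat (divisor_count n) * f (x + int n))"

text \<open>The supremum is taken in the reals. It is the genuine supremum whenever the averages at
  \<open>x\<close> are bounded in \<open>N\<close>, in particular for every bounded (hence every finitely supported)
  function \<open>f\<close>, since each average is a convex combination of values of \<open>f\<close>.\<close>

definition divisor_maximal :: "(int \<Rightarrow> complex) \<Rightarrow> int \<Rightarrow> real" where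
  "divisor_maximal f x = (SUP N\<in>{1..}. norm (divisor_avg N f x))"

text \<open>Intervals are nonempty throughout; the empty set could not belong to a sparse
  collection anyway.\<close>

definition int_interval :: "int set \<Rightarrow> bool" where
  "int_interval I \<longleftrightarrow> (\<exists>a b. a \<le> b \<and> I = {a..b})"

text \<open>For \<open>I = {a..b}\<close> with \<open>a \<le> b\<close> this is \<open>{2 * a - b - 1..b}\<close>: the interval is doubled
  to the left.\<close>

definition doubled :: "int set \<Rightarrow> int set" where
  "doubled I = {2 * Min I - Max I - 1..Max I}"

definition lp_avg :: "(int \<Rightarrow> complex) \<Rightarrow> int set \<Rightarrow> real \<Rightarrow> real" where
  "lp_avg f I p = (1 / real (card I) * (\<Sum>x\<in>I. norm (f x) powr p)) powr (1 / p)"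

definition sparse :: "int set set \<Rightarrow> bool" where
  "sparse S \<longleftrightarrow> (\<forall>I\<in>S. int_interval I) \<and>
     (\<exists>E. (\<forall>I\<in>S. E I \<subseteq> I \<and> real (card (E I)) > real (card I) / 2) \<and>
          disjoint_family_on E S)"

definition finitely_supported :: "(int \<Rightarrow> complex) \<Rightarrow> bool" where
  "finitely_supported f \<longleftrightarrow> finite {x. f x \<noteq> 0}"

definition l2_inner :: "(int \<Rightarrow> complex) \<Rightarrow> (int \<Rightarrow> complex) \<Rightarrow> complex" where
  "l2_inner f g = (\<Sum>\<^sub>\<infinity>x. f x * cnj (g x))"

text \<open>Sparse collections may be infinite, so the sparse form is summed in the extended
  nonnegative reals, where every family is summable.\<close>

definition sparse_type :: "real \<Rightarrow> real \<Rightarrow> ((int \<Rightarrow> complex) \<Rightarrow> int \<Rightarrow> complex) \<Rightarrow> bool" where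
  "sparse_type r s T \<longleftrightarrow>
     (\<exists>C>0. \<forall>f g. finitely_supported f \<longrightarrow> finitely_supported g \<longrightarrow>
        (\<exists>S. sparse S \<and>
           ennreal (norm (l2_inner (T f) g)) \<le>
             ennreal C * (\<Sum>\<^sub>\<infinity>I\<in>S. ennreal (real (card I) * lp_avg f (doubled I) r * lp_avg g I s))))"

end

theory Submission
  imports Defs "HOL-Number_Theory.Totient"
begin

text \<open>The kernel \<open>d(n)\<close> is not bounded by a constant times \<open>log N\<close>, so a single average cannot be compared with an
average of \<open>|f|\<close>; Hoelder's inequality alone loses a power of \<open>log N\<close>. The loss is repaired by
splitting the kernel according to the denominators of its frequencies.

For \<open>0 < n \<le> 2 ^ (j - 2)\<close> the number \<open>d(n)\<close> is at most twice the number of divisors of \<open>n\<close> up to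
\<open>K = 2 ^ (j div 2)\<close>. Divided by \<open>j\<close>, that count is the kernel \<open>divisor_kernel\<close>, and since
\<open>k\<close> times the indicator of \<open>k dvd n\<close> is the sum of the Ramanujan sums of the divisors of \<open>k\<close>, it is a
combination of Ramanujan sums in which the denominator \<open>q\<close> has weight at most \<open>1 / q\<close>. The denominators
below \<open>2 ^ (j div c)\<close> are grouped into dyadic bands \<open>[2 ^ i, 2 ^ (i + 1))\<close>; the others form the tail.

Two estimates hold for each band. Loss: the \<open>p\<close>-th moment of the band over an interval of length \<open>2 ^ j\<close> is
at most a constant times \<open>2 powr (\<epsilon> * i)\<close>, because a Ramanujan sum is dominated by a sum over common
divisors (\<open>band_loss\<close>). Gain: on \<open>\<ell>\<^sup>2\<close> the maximal operator over all scales \<open>j \<ge> 4 (i + 1)\<close> is bounded by a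
constant times \<open>2 powr (- i / 4)\<close> (\<open>band_gain\<close>). At one scale the gain \<open>2 ^ (- i)\<close> comes from the weights and from
the almost orthogonality of the characters with frequencies \<open>b / q\<close>. For the scales below about
the logarithm of \<open>(2 ^ (i + 1))!\<close>, roughly \<open>2 ^ i * i\<close> in number, the supremum is replaced by a
square function. At the larger scales the kernel is periodic with a period shorter than the cells, and Doob's inequality, applied in each residue class,
reduces all scales to the smallest one. The tail obeys the same two estimates with \<open>j\<close> in place of
\<open>i\<close>: the loss is the divisor bound and the gain is the large sieve.

Truncating \<open>f\<close> and \<open>g\<close> at a small power of \<open>2 ^ i\<close> interpolates between the two estimates
(\<open>truncation_interpolation\<close>) and gives a bound that decays geometrically in \<open>i\<close>, at those
points and scales where the mean of the \<open>r\<close>-th power of \<open>f\<close> does not exceed four times its mean over the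
ambient cell (\<open>local_bound\<close>). Selecting the maximal cells on which this fails and recursing into them
gives the sparse family (\<open>sparse_domination_cell\<close>); the failing cells fill at most a quarter of the
ambient cell.

Finally, \<open>x\<close> and \<open>x + n\<close> with \<open>0 < n \<le> 2 ^ (j - 2)\<close> share a cell of length \<open>2 ^ j\<close> in one of two
translated dyadic grids (\<open>two_grids\<close>). Each grid yields a sparse form, and since the sparse family may
depend on \<open>f\<close> and \<open>g\<close>, the larger of the two forms dominates. A mean over a cell is at most twice
the mean over the doubled cell, so the direction of doubling is harmless.\<close>

section \<open>Dyadic cells and Doob's maximal inequality\<close>

text \<open>The dyadic interval of length \<open>2 ^ j\<close> around \<open>x\<close> in the grid translated by \<open>t\<close>. Describing it by a
quotient makes membership an equivalence relation and nesting a property of iterated division.\<close>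

definition cell :: "int \<Rightarrow> nat \<Rightarrow> int \<Rightarrow> int set" where
  "cell t j x = {y. (y - t) div 2 ^ j = (x - t) div 2 ^ j}"

lemma mem_cell: "y \<in> cell t j x \<longleftrightarrow> (y - t) div 2 ^ j = (x - t) div 2 ^ j"
  by (simp add: cell_def)

lemma self_in_cell [simp]: "x \<in> cell t j x"
  by (simp add: cell_def)

lemma cell_eq: "y \<in> cell t j x \<Longrightarrow> cell t j y = cell t j x"
  by (auto simp: cell_def)

lemma cell_interval:
  "cell t j x = {t + 2 ^ j * ((x - t) div 2 ^ j) ..< t + 2 ^ j * ((x - t) div 2 ^ j) + 2 ^ j}"
  (is "_ = {?a..<?a + _}")
proof (intro set_eqI iffI)
  fix y assume "y \<in> cell t j x"
  then have "(y - t) div 2 ^ j = (x - t) div 2 ^ j" by (simp add: cell_def)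
  moreover have "y - t = 2 ^ j * ((y - t) div 2 ^ j) + (y - t) mod 2 ^ j" by simp
  moreover have "0 \<le> (y - t) mod 2 ^ j" "(y - t) mod 2 ^ j < 2 ^ j" by simp_all
  ultimately have "y - t = 2 ^ j * ((x - t) div 2 ^ j) + (y - t) mod 2 ^ j" by metis
  with \<open>0 \<le> (y - t) mod 2 ^ j\<close> \<open>(y - t) mod 2 ^ j < 2 ^ j\<close>
  show "y \<in> {?a..<?a + 2 ^ j}" unfolding atLeastLessThan_iff by linarith
next
  fix y assume y: "y \<in> {?a..<?a + 2 ^ j}"
  have "(y - t) div 2 ^ j = (x - t) div 2 ^ j"
    by (rule int_div_pos_eq[where r = "y - ?a"]) (use y in auto)
  then show "y \<in> cell t j x" by (simp add: cell_def)
qed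

lemma finite_cell [simp]: "finite (cell t j x)"
  by (simp add: cell_interval)

lemma card_cell [simp]: "card (cell t j x) = 2 ^ j"
  by (simp add: cell_interval nat_power_eq)

lemma cell_mono:
  assumes "j \<le> k" shows "cell t j x \<subseteq> cell t k x"
proof
  fix y assume "y \<in> cell t j x"
  then have "(y - t) div 2 ^ j = (x - t) div 2 ^ j" by (simp add: cell_def)
  then have "(y - t) div 2 ^ j div 2 ^ (k - j) = (x - t) div 2 ^ j div 2 ^ (k - j)" by simp
  moreover have "z div 2 ^ j div 2 ^ (k - j) = z div 2 ^ k" for z :: int
    using assms by (simp add: zdiv_zmult2_eq[symmetric] power_add[symmetric])
  ultimately show "y \<in> cell t k x" by (simp add: cell_def)
qed

lemma cell_0 [simp]: "cell t 0 x = {x}"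
  by (auto simp: cell_def)

lemma cell_Suc:
  "\<exists>u v. cell t (Suc m) x = cell t m u \<union> cell t m v \<and> cell t m u \<inter> cell t m v = {}"
proof -
  define a where "a = t + 2 ^ Suc m * ((x - t) div 2 ^ Suc m)"
  have 1: "cell t (Suc m) x = {a..<a + 2 ^ Suc m}" by (simp add: cell_interval a_def)
  have a: "a - t = 2 ^ m * (2 * ((x - t) div 2 ^ Suc m))" by (simp add: a_def)
  have d: "(a - t) div 2 ^ m = 2 * ((x - t) div 2 ^ Suc m)"
    unfolding a by simp
  have 2: "cell t m a = {a..<a + 2 ^ m}"
    unfolding cell_interval[of t m a] d using a by (simp add: algebra_simps)
  have b: "a + 2 ^ m - t = 2 ^ m * (2 * ((x - t) div 2 ^ Suc m) + 1)"
    using a by (simp add: algebra_simps)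
  have d2: "(a + 2 ^ m - t) div 2 ^ m = 2 * ((x - t) div 2 ^ Suc m) + 1"
    unfolding b by simp
  have 3: "cell t m (a + 2 ^ m) = {a + 2 ^ m..<a + 2 ^ m + 2 ^ m}"
    unfolding cell_interval[of t m "a + 2 ^ m"] d2 using b by (simp add: algebra_simps)
  show ?thesis
    by (rule exI[of _ a], rule exI[of _ "a + 2 ^ m"]) (auto simp: 1 2 3)
qed

text \<open>An inequality between sums over all cells of one level passes to every coarser cell, since that cell is a
disjoint union of them. This turns estimates at a single scale into estimates on the ambient cell.\<close>

lemma sum_cells_mono:
  fixes \<phi> \<psi> :: "int \<Rightarrow> real"
  assumes "j \<le> m" and le: "\<And>z. z \<in> cell t m x \<Longrightarrow> sum \<phi> (cell t j z) \<le> sum \<psi> (cell t j z)"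
  shows "sum \<phi> (cell t m x) \<le> sum \<psi> (cell t m x)"
  using assms(1) le
proof (induction m arbitrary: x rule: dec_induct)
  case base
  then show ?case by simp
next
  case (step m)
  obtain u v where uv: "cell t (Suc m) x = cell t m u \<union> cell t m v" "cell t m u \<inter> cell t m v = {}"
    using cell_Suc by blast
  have "sum \<phi> (cell t m u) \<le> sum \<psi> (cell t m u)" "sum \<phi> (cell t m v) \<le> sum \<psi> (cell t m v)"
    by (rule step.IH, rule step.prems, simp add: uv)+
  then show ?case by (simp add: uv sum.union_disjoint)
qed

definition cell_avg :: "int \<Rightarrow> nat \<Rightarrow> (int \<Rightarrow> 'a) \<Rightarrow> int \<Rightarrow> 'a::real_normed_field" where
  "cell_avg t j \<phi> x = sum \<phi> (cell t j x) / 2 ^ j"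

lemma cell_avg_const_on_cell: "y \<in> cell t j x \<Longrightarrow> cell_avg t j \<phi> y = cell_avg t j \<phi> x"
  by (simp add: cell_avg_def cell_eq)

text \<open>The expression \<open>4 A - 4 L F + 2 L\<^sup>2\<close> in the mean \<open>F\<close>, the mean square \<open>A\<close> and the running
maximum \<open>L \<ge> F\<close> is a Bellman function for the dyadic maximal operator. For fixed \<open>L\<close> it is linear in
\<open>(F, A)\<close>, so it is preserved on average when a cell is halved; raising \<open>L\<close> to a larger \<open>F\<close> decreases
it by \<open>2 (F - L)\<^sup>2\<close>; and at a point it equals \<open>L\<^sup>2 + (2 F - L)\<^sup>2\<close>. The supremum over levels is
linearised by an arbitrary selector \<open>k\<close>.\<close>

lemma doob_bellman:
  fixes \<phi> :: "int \<Rightarrow> real"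
  assumes "\<And>y. k y \<le> m" and "cell_avg t m \<phi> x \<le> L" and "0 \<le> L"
  shows "(\<Sum>y\<in>cell t m x. (max L (cell_avg t (k y) \<phi> y))\<^sup>2) \<le>
    4 * (\<Sum>y\<in>cell t m x. (\<phi> y)\<^sup>2) - 4 * L * (\<Sum>y\<in>cell t m x. \<phi> y) + 2 * L\<^sup>2 * 2 ^ m"
  using assms
proof (induction m arbitrary: x L k)
  case 0
  then have "cell_avg t (k x) \<phi> x = \<phi> x" "\<phi> x \<le> L" by (simp_all add: cell_avg_def)
  moreover have "0 \<le> (2 * \<phi> x - L)\<^sup>2" by simp
  ultimately show ?case by (simp add: max_def power2_eq_square algebra_simps)
next
  case (Suc m)
  define k' where "k' y = min (k y) m" for y
  obtain u v where uv: "cell t (Suc m) x = cell t m u \<union> cell t m v" "cell t m u \<inter> cell t m v = {}"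
    using cell_Suc by blast
  have half: "(\<Sum>y\<in>cell t m u. (max L (cell_avg t (k y) \<phi> y))\<^sup>2) \<le>
    4 * (\<Sum>y\<in>cell t m u. (\<phi> y)\<^sup>2) - 4 * L * (\<Sum>y\<in>cell t m u. \<phi> y) + 2 * L\<^sup>2 * 2 ^ m"
    if sub: "cell t m u \<subseteq> cell t (Suc m) x" for u
  proof -
    define F where "F = cell_avg t m \<phi> u"
    define L' where "L' = max L F"
    have F: "sum \<phi> (cell t m u) = F * 2 ^ m" by (simp add: F_def cell_avg_def)
    have mono: "max L (cell_avg t (k y) \<phi> y) \<le> max L' (cell_avg t (k' y) \<phi> y)" if "y \<in> cell t m u" for y
    proof (cases "k y \<le> m")
      case True
      then show ?thesis by (simp add: L'_def k'_def)
    next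
      case False
      then have "k y = Suc m" using Suc.prems(1)[of y] by simp
      moreover have "cell_avg t (Suc m) \<phi> y = cell_avg t (Suc m) \<phi> x"
        using sub that by (blast intro: cell_avg_const_on_cell)
      ultimately have "cell_avg t (k y) \<phi> y \<le> L" using Suc.prems(2) by simp
      then show ?thesis by (simp add: L'_def)
    qed
    have "(\<Sum>y\<in>cell t m u. (max L (cell_avg t (k y) \<phi> y))\<^sup>2) \<le>
        (\<Sum>y\<in>cell t m u. (max L' (cell_avg t (k' y) \<phi> y))\<^sup>2)"
      using Suc.prems(3) by (intro sum_mono power_mono mono) auto
    also have "\<dots> \<le> 4 * (\<Sum>y\<in>cell t m u. (\<phi> y)\<^sup>2) - 4 * L' * (\<Sum>y\<in>cell t m u. \<phi> y) + 2 * L'\<^sup>2 * 2 ^ m"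
      by (rule Suc.IH) (use Suc.prems(3) in \<open>auto simp: k'_def L'_def F_def\<close>)
    also have "\<dots> \<le> 4 * (\<Sum>y\<in>cell t m u. (\<phi> y)\<^sup>2) - 4 * L * (\<Sum>y\<in>cell t m u. \<phi> y) + 2 * L\<^sup>2 * 2 ^ m"
    proof (cases "F \<le> L")
      case True
      then show ?thesis by (simp add: L'_def max_absorb1)
    next
      case False
      have "0 \<le> (F - L)\<^sup>2 * 2 ^ m" by simp
      then show ?thesis
        using False unfolding F by (simp add: L'_def max_def power2_eq_square algebra_simps)
    qed
    finally show ?thesis .
  qed
  have "cell t m u \<subseteq> cell t (Suc m) x" "cell t m v \<subseteq> cell t (Suc m) x" using uv by auto
  from half[OF this(1)] half[OF this(2)] show ?case
    by (simp add: uv sum.union_disjoint algebra_simps)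
qed

lemma doob_maximal:
  fixes \<phi> :: "int \<Rightarrow> real"
  assumes "\<And>y. k y \<le> m" and pos: "\<And>y. 0 \<le> \<phi> y"
  shows "(\<Sum>y\<in>cell t m x. (cell_avg t (k y) \<phi> y)\<^sup>2) \<le> 4 * (\<Sum>y\<in>cell t m x. (\<phi> y)\<^sup>2)"
proof -
  define L where "L = cell_avg t m \<phi> x"
  have L: "0 \<le> L" "sum \<phi> (cell t m x) = L * 2 ^ m"
    by (simp_all add: L_def cell_avg_def sum_nonneg pos)
  have "(\<Sum>y\<in>cell t m x. (cell_avg t (k y) \<phi> y)\<^sup>2) \<le> (\<Sum>y\<in>cell t m x. (max L (cell_avg t (k y) \<phi> y))\<^sup>2)"
    by (intro sum_mono power_mono) (auto simp: cell_avg_def sum_nonneg pos)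
  also have "\<dots> \<le> 4 * (\<Sum>y\<in>cell t m x. (\<phi> y)\<^sup>2) - 4 * L * (\<Sum>y\<in>cell t m x. \<phi> y) + 2 * L\<^sup>2 * 2 ^ m"
    by (rule doob_bellman) (use L assms in \<open>auto simp: L_def\<close>)
  also have "\<dots> \<le> 4 * (\<Sum>y\<in>cell t m x. (\<phi> y)\<^sup>2)"
    using L by (simp add: power2_eq_square)
  finally show ?thesis .
qed

section \<open>Divisor bounds and moments of truncated divisor counts\<close>

text \<open>Used both to count integers in a residue class and to count multiples; measuring from the smallest element of
the set avoids rounding the endpoints.\<close>

lemma card_dvd_shift_le:
  fixes a u :: int
  assumes "0 < m"
  shows "card {y \<in> {a..<a + int L}. int m dvd y - u} \<le> L div m + 1"
proof (cases "{y \<in> {a..<a + int L}. int m dvd y - u} = {}")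
  case False
  let ?A = "{y \<in> {a..<a + int L}. int m dvd y - u}"
  have fin: "finite ?A" by (rule finite_subset[of _ "{a..<a + int L}"]) auto
  define y0 where "y0 = Min ?A"
  have y0: "y0 \<in> ?A" using Min_in[OF fin False] by (simp add: y0_def)
  have le: "y0 \<le> y" if "y \<in> ?A" for y using Min_le[OF fin that] by (simp add: y0_def)
  have dvd: "int m dvd y - y0" if "y \<in> ?A" for y
    using that y0 dvd_diff[of "int m" "y - u" "y0 - u"] by simp
  have "inj_on (\<lambda>y. nat ((y - y0) div int m)) ?A"
  proof (rule inj_onI)
    fix y z assume yz: "y \<in> ?A" "z \<in> ?A" "nat ((y - y0) div int m) = nat ((z - y0) div int m)"
    have "0 \<le> (y - y0) div int m" "0 \<le> (z - y0) div int m"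
      using le[OF yz(1)] le[OF yz(2)] assms by (auto simp: pos_imp_zdiv_nonneg_iff)
    then have "(y - y0) div int m = (z - y0) div int m" using yz(3) by simp
    then have "y - y0 = z - y0" using dvd[OF yz(1)] dvd[OF yz(2)] by (metis dvd_div_mult_self)
    then show "y = z" by simp
  qed
  moreover have "(\<lambda>y. nat ((y - y0) div int m)) ` ?A \<subseteq> {..L div m}"
  proof
    fix k assume "k \<in> (\<lambda>y. nat ((y - y0) div int m)) ` ?A"
    then obtain y where y: "y \<in> ?A" "k = nat ((y - y0) div int m)" by blast
    have "y - y0 \<le> int L" using y y0 by auto
    then have "(y - y0) div int m \<le> int L div int m" by (rule zdiv_mono1) (use assms in simp)
    then have "(y - y0) div int m \<le> int (L div m)" by (simp add: zdiv_int)
    then show "k \<in> {..L div m}" using y(2) by simp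
  qed
  ultimately have "card ?A \<le> card {..L div m}" by (intro card_inj_on_le) auto
  then show ?thesis by simp
next
  case True
  then show ?thesis by (simp only: card.empty)
qed

lemma card_dvd_cell_le:
  assumes "0 < m"
  shows "real (card {y \<in> cell t j x. int m dvd y - u}) \<le> 2 ^ j / real m + 1"
proof -
  have "card {y \<in> cell t j x. int m dvd y - u} \<le> 2 ^ j div m + 1"
    using card_dvd_shift_le[OF assms, of "t + 2 ^ j * ((x - t) div 2 ^ j)" "2 ^ j" u]
    by (simp add: cell_interval)
  then have "real (card {y \<in> cell t j x. int m dvd y - u}) \<le> real (2 ^ j div m + 1)"
    by (rule of_nat_mono)
  also have "\<dots> \<le> 2 ^ j / real m + 1" using of_nat_div_le_of_nat[of "2 ^ j" m, where 'a=real] by simp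
  finally show ?thesis .
qed

lemma harm_pow2_le: "harm (2 ^ l) \<le> (real l + 1 :: real)"
proof (induction l)
  case 0 then show ?case by (simp add: harm_expand)
next
  case (Suc l)
  have "harm (2 ^ Suc l) = (harm (2 ^ l) :: real) + (\<Sum>k\<in>{2 ^ l<..2 ^ Suc l}. inverse (real k))"
    unfolding harm_def by (subst sum.union_disjoint[symmetric]) (auto intro!: sum.cong)
  also have "(\<Sum>k\<in>{2 ^ l<..2 ^ Suc l}. inverse (real k)) \<le> (\<Sum>k\<in>{2 ^ l<..(2 ^ Suc l :: nat)}. inverse (2 ^ l))"
    by (intro sum_mono le_imp_inverse_le) (auto simp: less_imp_le)
  also have "\<dots> = 1" by simp
  finally show ?case using Suc by simp
qed

lemma harm_pow2_ge: "real l / 2 + 1 \<le> (harm (2 ^ l) :: real)"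
proof (induction l)
  case 0 then show ?case by (simp add: harm_expand)
next
  case (Suc l)
  define S :: real where "S = (\<Sum>k\<in>{2 ^ l<..2 ^ Suc l}. inverse (real k))"
  have "(1/2 :: real) = (\<Sum>k\<in>{2 ^ l<..(2 ^ Suc l :: nat)}. inverse (2 ^ Suc l))" by simp
  also have "\<dots> \<le> S" unfolding S_def
  proof (intro sum_mono le_imp_inverse_le)
    fix k :: nat assume "k \<in> {2 ^ l<..2 ^ Suc l}"
    then show "real k \<le> 2 ^ Suc l" "0 < real k"
      using of_nat_mono[of k "2 ^ Suc l", where 'a=real] by auto
  qed
  finally have "1/2 \<le> S" .
  moreover have "harm (2 ^ Suc l) = harm (2 ^ l) + S"
    unfolding harm_def S_def by (subst sum.union_disjoint[symmetric]) (auto intro!: sum.cong)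
  moreover have "real (Suc l) / 2 = real l / 2 + 1 / 2" by simp
  ultimately show ?case using Suc by linarith
qed

text \<open>Polynomial factors in the scale are absorbed into an arbitrarily small exponential.\<close>

lemma nat_le_powr:
  assumes "0 < \<delta>"
  shows "real n \<le> 1 / (\<delta> * ln 2) * 2 powr (\<delta> * real n)"
proof -
  have "\<delta> * ln 2 * real n \<le> 1 + \<delta> * real n * ln 2" by simp
  also have "\<dots> \<le> exp (\<delta> * real n * ln 2)" by (rule exp_ge_add_one_self)
  also have "\<dots> = 2 powr (\<delta> * real n)" by (simp add: powr_def)
  finally show ?thesis using assms by (simp add: field_simps)
qed

lemma divisor_count_prime_power_mult_le:
  assumes p: "prime p" and m: "0 < m"
  shows "divisor_count (p ^ a * m) \<le> (a + 1) * divisor_count m"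
proof -
  have "{k. k dvd p ^ a * m} \<subseteq> (\<lambda>(i, v). p ^ i * v) ` ({..a} \<times> {k. k dvd m})"
  proof
    fix k assume "k \<in> {k. k dvd p ^ a * m}"
    then obtain u v where uv: "k = u * v" "u dvd p ^ a" "v dvd m"
      using division_decomp by blast
    obtain i where "i \<le> a" "u = p ^ i" using uv(2) p by (auto simp: divides_primepow_nat)
    then show "k \<in> (\<lambda>(i, v). p ^ i * v) ` ({..a} \<times> {k. k dvd m})" using uv by force
  qed
  then have "card {k. k dvd p ^ a * m} \<le> card ({..a} \<times> {k. k dvd m})"
    using m by (intro surj_card_le) auto
  then show ?thesis by (simp add: divisor_count_def card_cartesian_product)
qed

text \<open>Write \<open>n\<close> as a product of prime powers \<open>p ^ a\<close>. If \<open>p powr \<delta> \<ge> 2\<close> then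
\<open>a + 1 \<le> 2 ^ a \<le> (p ^ a) powr \<delta>\<close>; each of the finitely many remaining primes costs a bounded factor \<open>B\<close>.\<close>

lemma divisor_count_le_powr:
  assumes "0 < \<delta>"
  shows "\<exists>C>0. \<forall>n>0. real (divisor_count n) \<le> C * real n powr \<delta>"
proof -
  \<comment> \<open>the primes whose contribution has to be paid for\<close>
  define S where "S = {p::nat. prime p \<and> real p powr \<delta> < 2}"
  define B where "B = 1 / (\<delta> * ln 2) * 2 powr \<delta> + 1"
  have B: "1 \<le> B" using assms by (simp add: B_def)
  have "S \<subseteq> {..nat \<lceil>2 powr (1/\<delta>)\<rceil>}"
  proof
    fix p assume "p \<in> S"
    then have "real p powr \<delta> \<le> 2" "0 < p" by (auto simp: S_def prime_gt_0_nat)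
    then have "(real p powr \<delta>) powr (1/\<delta>) \<le> 2 powr (1/\<delta>)"
      using assms by (intro powr_mono2) auto
    then have "real p \<le> 2 powr (1/\<delta>)" using assms by (simp add: powr_powr)
    then show "p \<in> {..nat \<lceil>2 powr (1/\<delta>)\<rceil>}" by (simp add: le_nat_iff) linarith
  qed
  then have fin: "finite S" by (rule finite_subset) simp
  have main: "real (divisor_count n) \<le> B ^ card (S \<inter> prime_factors n) * real n powr \<delta>" if "0 < n" for n
    using that
  proof (induction n rule: less_induct)
    case (less n)
    show ?case
    proof (cases "n = 1")
      case True
      then show ?thesis by (simp add: divisor_count_def)
    next
      case False
      then obtain p where p: "prime p" "p dvd n" using prime_factor_nat by blast
      define a where "a = multiplicity p n"
      obtain m where m: "n = p ^ a * m" "\<not> p dvd m"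
        using multiplicity_decompose'[of n p] less.prems p(1) a_def
        by (metis gr_implies_not0 not_prime_unit)
      have a: "0 < a" using p less.prems by (simp add: a_def prime_multiplicity_gt_zero_iff)
      have m0: "0 < m" using m less.prems by (cases m) auto
      have p2: "2 \<le> p" using p(1) by (rule prime_ge_2_nat)
      have "1 < p ^ a" using p2 a one_less_power[of p a] by linarith
      then have mn: "m < n" using m m0 by simp
      have pf: "prime_factors n = insert p (prime_factors m)"
      proof (intro set_eqI)
        fix q
        have "q dvd p \<longleftrightarrow> q = p" if "prime q" using p(1) that by (metis dvd_refl primes_dvd_imp_eq)
        moreover have "prime q \<Longrightarrow> q dvd n \<longleftrightarrow> q dvd p \<or> q dvd m"
          unfolding m(1) by (simp add: prime_dvd_mult_iff prime_dvd_power_iff a)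
        ultimately show "q \<in> prime_factors n \<longleftrightarrow> q \<in> insert p (prime_factors m)"
          using m0 p(1) less.prems by (auto simp: in_prime_factors_iff)
      qed
      have pnot: "p \<notin> prime_factors m" using m(2) by auto
      have IH: "real (divisor_count m) \<le> B ^ card (S \<inter> prime_factors m) * real m powr \<delta>"
        by (rule less.IH[OF mn m0])
      have np: "real n powr \<delta> = real (p ^ a) powr \<delta> * real m powr \<delta>"
        using m by (simp add: powr_mult)
      have pa: "real (p ^ a) powr \<delta> = (real p powr \<delta>) ^ a"
        using p2 by (simp add: powr_powr powr_realpow[symmetric] mult.commute)
      have d: "real (divisor_count n) \<le> (real a + 1) * real (divisor_count m)"
        using of_nat_mono[OF divisor_count_prime_power_mult_le[OF p(1) m0, of a], where 'a=real]
        by (simp add: m(1) algebra_simps)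
      have "(real a + 1) * B ^ card (S \<inter> prime_factors m) \<le>
          B ^ card (S \<inter> prime_factors n) * real (p ^ a) powr \<delta>"
      proof (cases "p \<in> S")
        case True
        have "card (S \<inter> prime_factors n) = Suc (card (S \<inter> prime_factors m))"
          using True pnot fin by (simp add: pf)
        moreover have "real a + 1 \<le> B * real (p ^ a) powr \<delta>"
        proof -
          have "real (a + 1) \<le> 1 / (\<delta> * ln 2) * 2 powr (\<delta> * real (a + 1))" by (rule nat_le_powr[OF assms])
          also have "\<dots> = 1 / (\<delta> * ln 2) * 2 powr \<delta> * (2 powr (real a * \<delta>))"
            by (simp add: powr_add[symmetric] algebra_simps)
          also have "\<dots> \<le> B * (2 powr (real a * \<delta>))"
            by (intro mult_right_mono) (simp_all add: B_def)
          also have "2 powr (real a * \<delta>) = (2 ^ a) powr \<delta>" by (simp add: powr_powr powr_realpow[symmetric])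
          also have "(2 ^ a) powr \<delta> \<le> real (p ^ a) powr \<delta>"
            using p2 assms by (intro powr_mono2) (auto intro: power_mono)
          finally show ?thesis using B by simp
        qed
        ultimately show ?thesis using B by (simp add: mult.commute mult.left_commute mult_left_mono)
      next
        case False
        have "card (S \<inter> prime_factors n) = card (S \<inter> prime_factors m)"
          using False by (simp add: pf)
        moreover have "real a + 1 \<le> real (p ^ a) powr \<delta>"
        proof -
          have "a + 1 \<le> 2 ^ a" by (induction a) auto
          then have "real (a + 1) \<le> real (2 ^ a)" by (rule of_nat_mono)
          also have "\<dots> \<le> (real p powr \<delta>) ^ a"
            using False p(1) by (auto simp: S_def intro!: power_mono)
          finally show ?thesis using pa by simp
        qed
        ultimately show ?thesis using B by (simp add: mult.commute mult_right_mono)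
      qed
      note B_le = this
      note d
      also have "(real a + 1) * real (divisor_count m) \<le>
          (real a + 1) * (B ^ card (S \<inter> prime_factors m) * real m powr \<delta>)"
        by (intro mult_left_mono IH) simp
      also have "\<dots> = (real a + 1) * B ^ card (S \<inter> prime_factors m) * real m powr \<delta>"
        by (simp only: mult.assoc)
      also have "\<dots> \<le> B ^ card (S \<inter> prime_factors n) * real (p ^ a) powr \<delta> * real m powr \<delta>"
        by (rule mult_right_mono[OF B_le]) simp
      also have "\<dots> = B ^ card (S \<inter> prime_factors n) * real n powr \<delta>"
        by (simp only: np mult.assoc)
      finally show ?thesis .
    qed
  qed
  have "real (divisor_count n) \<le> B ^ card S * real n powr \<delta>" if "0 < n" for n
  proof -
    have "B ^ card (S \<inter> prime_factors n) \<le> B ^ card S"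
      using B fin by (intro power_increasing card_mono) auto
    then show ?thesis using main[OF that]
      by (meson mult_right_mono order_trans powr_ge_zero)
  qed
  then show ?thesis using B by (intro exI[of _ "B ^ card S"]) auto
qed

text \<open>The number of divisors of \<open>n\<close> below \<open>M\<close>. For \<open>n = 0\<close> it is \<open>M - 1\<close>, which is small compared
with the length of the intervals over which it is averaged.\<close>

definition small_divisor_count :: "nat \<Rightarrow> int \<Rightarrow> nat" where
  "small_divisor_count M n = card {d \<in> {1..<M}. int d dvd n}"

text \<open>A \<open>p\<close>-tuple of divisors of \<open>n\<close> below \<open>M\<close> consists of divisors of its least common multiple, which
divides \<open>n\<close> and is at most \<open>M ^ p\<close>.\<close>

lemma small_divisor_count_power_le:
  "small_divisor_count M n ^ p \<le> (\<Sum>m | m \<in> {1..M ^ p} \<and> int m dvd n. divisor_count m ^ p)"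
proof -
  let ?D = "{d \<in> {1..<M}. int d dvd n}"
  let ?Ms = "{m. m \<in> {1..M ^ p} \<and> int m dvd n}"
  let ?T = "\<lambda>m. {xs. set xs \<subseteq> {k. k dvd m} \<and> length xs = p}"
  have "small_divisor_count M n ^ p = card {xs. set xs \<subseteq> ?D \<and> length xs = p}"
    by (simp add: small_divisor_count_def card_lists_length_eq)
  also have "\<dots> \<le> card (\<Union>m\<in>?Ms. ?T m)"
  proof (rule card_mono)
    show "finite (\<Union>m\<in>?Ms. ?T m)"
      by (rule finite_UN_I) (auto intro!: finite_lists_length_eq)
    show "{xs. set xs \<subseteq> ?D \<and> length xs = p} \<subseteq> (\<Union>m\<in>?Ms. ?T m)"
    proof
      fix xs assume "xs \<in> {xs. set xs \<subseteq> ?D \<and> length xs = p}"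
      then have xs: "set xs \<subseteq> ?D" "length xs = p" by auto
      define m where "m = Lcm (set xs)"
      have pos: "0 < prod_list xs \<and> prod_list xs \<le> M ^ length xs" if "set xs \<subseteq> ?D" for xs
        using that by (induction xs) (auto intro!: mult_mono)
      have "k dvd prod_list xs" if "k \<in> set xs" for k
        using that by (induction xs) auto
      then have "m dvd prod_list xs" unfolding m_def by (rule Lcm_least)
      then have m: "0 < m" "m \<le> M ^ p"
        using pos[OF xs(1)] xs(2) by (auto dest: dvd_imp_le intro: dvd_pos_nat)
      have "k dvd nat \<bar>n\<bar>" if "k \<in> set xs" for k
        using that xs(1) by (auto simp: subset_iff)
      then have "m dvd nat \<bar>n\<bar>" unfolding m_def by (rule Lcm_least)
      then have "int m dvd n" by (metis dvd_abs_iff int_dvd_int_iff abs_ge_zero nat_0_le)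
      with m have "m \<in> ?Ms" by simp
      moreover have "xs \<in> ?T m" using xs(2) by (auto simp: m_def dvd_Lcm)
      ultimately show "xs \<in> (\<Union>m\<in>?Ms. ?T m)" by blast
    qed
  qed
  also have "\<dots> \<le> (\<Sum>m\<in>?Ms. card (?T m))"
    by (rule card_UN_le) simp
  also have "\<dots> = (\<Sum>m\<in>?Ms. divisor_count m ^ p)"
    by (rule sum.cong) (auto simp: divisor_count_def card_lists_length_eq)
  finally show ?thesis .
qed

text \<open>By the tuple count the moment is at most a small power of \<open>2 ^ i\<close> times the average number of divisors
\<open>m \<le> M ^ p\<close>. Since \<open>M ^ p\<close> does not exceed the length of the interval, each \<open>m\<close> divides about a
fraction \<open>1 / m\<close> of the arguments, and the harmonic sum is linear in \<open>i\<close>.\<close>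

lemma small_divisor_count_moment:
  fixes p :: nat
  assumes \<epsilon>: "0 < \<epsilon>" and p: "0 < p"
  shows "\<exists>C>0. \<forall>i j t x z. p * (i + 1) \<le> j \<longrightarrow>
    (\<Sum>y\<in>cell t j z. real (small_divisor_count (2 ^ (i + 1)) (y - x)) ^ p) \<le> C * 2 powr (\<epsilon> * real i) * 2 ^ j"
proof -
  define \<delta> where "\<delta> = \<epsilon> / (2 * real p * real p)"
  have \<delta>: "0 < \<delta>" "\<delta> * real p * real p = \<epsilon> / 2" using \<epsilon> p by (simp_all add: \<delta>_def)
  obtain C where C: "0 < C" "\<And>n. 0 < n \<Longrightarrow> real (divisor_count n) \<le> C * real n powr \<delta>"
    using divisor_count_le_powr[OF \<delta>(1)] by blast
  define C' where "C' = C ^ p * (real p + 2) * (1 / (\<epsilon> / 2 * ln 2)) * 2 powr \<epsilon>"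
  have "(\<Sum>y\<in>cell t j z. real (small_divisor_count (2 ^ (i + 1)) (y - x)) ^ p) \<le> C' * 2 powr (\<epsilon> * real i) * 2 ^ j"
    if ij: "p * (i + 1) \<le> j" for i j t x z
  proof -
    define M :: nat where "M = 2 ^ (i + 1)"
    define D where "D = C ^ p * 2 powr (\<epsilon> / 2 * real (i + 1))"
    have D0: "0 \<le> D" using C by (simp add: D_def)
    have Mp: "M ^ p = 2 ^ (p * (i + 1))" unfolding M_def by (metis power_mult mult.commute)
    have Dm: "real (divisor_count m ^ p) \<le> D" if "m \<in> {1..M ^ p}" for m
    proof -
      have "real (divisor_count m) \<le> C * real m powr \<delta>" using that by (intro C) auto
      also have "\<dots> \<le> C * real (M ^ p) powr \<delta>"
        using that C \<delta> by (intro mult_left_mono powr_mono2 of_nat_mono) auto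
      finally have "real (divisor_count m) ^ p \<le> (C * real (M ^ p) powr \<delta>) ^ p"
        by (intro power_mono) auto
      also have "\<dots> = C ^ p * (2 powr (real (p * (i + 1)) * \<delta>)) ^ p"
        by (simp only: Mp of_nat_power of_nat_numeral powr_realpow[symmetric] powr_powr power_mult_distrib)
      also have "(2 powr (real (p * (i + 1)) * \<delta>)) ^ p = 2 powr (\<epsilon> / 2 * real (i + 1))"
        unfolding \<delta>(2)[symmetric] by (simp add: powr_powr powr_realpow[symmetric] algebra_simps)
      finally show ?thesis by (simp add: D_def)
    qed
    have "(\<Sum>y\<in>cell t j z. real (small_divisor_count M (y - x)) ^ p) \<le>
      (\<Sum>y\<in>cell t j z. \<Sum>m | m \<in> {1..M ^ p} \<and> int m dvd y - x. D)"
    proof (rule sum_mono)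
      fix y
      have "real (small_divisor_count M (y - x)) ^ p = real (small_divisor_count M (y - x) ^ p)" by simp
      also have "\<dots> \<le> real (\<Sum>m | m \<in> {1..M ^ p} \<and> int m dvd y - x. divisor_count m ^ p)"
        by (rule of_nat_mono[OF small_divisor_count_power_le])
      also have "\<dots> \<le> (\<Sum>m | m \<in> {1..M ^ p} \<and> int m dvd y - x. D)"
        unfolding of_nat_sum using Dm by (intro sum_mono) auto
      finally show "real (small_divisor_count M (y - x)) ^ p \<le> (\<Sum>m | m \<in> {1..M ^ p} \<and> int m dvd y - x. D)" .
    qed
    also have "\<dots> = (\<Sum>y\<in>cell t j z. \<Sum>m\<in>{1..M ^ p}. if int m dvd y - x then D else 0)"
      by (rule sum.cong[OF refl], rule sum.inter_filter) simp
    also have "\<dots> = (\<Sum>m\<in>{1..M ^ p}. \<Sum>y\<in>cell t j z. if int m dvd y - x then D else 0)"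
      by (rule sum.swap)
    also have "\<dots> = (\<Sum>m\<in>{1..M ^ p}. real (card {y \<in> cell t j z. int m dvd y - x}) * D)"
      by (rule sum.cong[OF refl], subst sum.inter_filter[symmetric]) simp_all
    also have "\<dots> \<le> (\<Sum>m\<in>{1..M ^ p}. (2 ^ j * inverse (real m) + 1) * D)"
      using card_dvd_cell_le[of _ t j z x] D0 by (intro sum_mono mult_right_mono) (auto simp: divide_inverse)
    also have "\<dots> = (2 ^ j * harm (M ^ p) + real (M ^ p)) * D"
      by (simp add: sum.distrib sum_distrib_left sum_distrib_right harm_def algebra_simps)
    also have "\<dots> \<le> (2 ^ j * (real (p * (i + 1)) + 1) + 2 ^ j) * D"
      using harm_pow2_le[of "p * (i + 1)"] D0 ij
      by (intro mult_right_mono add_mono mult_left_mono) (auto simp: Mp)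
    also have "\<dots> = 2 ^ j * D * (real p * real (i + 1) + 2)" by (simp add: algebra_simps)
    also have "\<dots> \<le> 2 ^ j * D * ((real p + 2) * real (i + 1))"
      using D0 by (intro mult_left_mono) (auto simp: algebra_simps)
    also have "\<dots> \<le> 2 ^ j * D * ((real p + 2) * (1 / (\<epsilon> / 2 * ln 2) * 2 powr (\<epsilon> / 2 * real (i + 1))))"
      using D0 nat_le_powr[of "\<epsilon> / 2" "i + 1"] \<epsilon> by (intro mult_left_mono) auto
    also have "\<dots> = C ^ p * (real p + 2) * (1 / (\<epsilon> / 2 * ln 2)) *
        (2 powr (\<epsilon> / 2 * real (i + 1)) * 2 powr (\<epsilon> / 2 * real (i + 1))) * 2 ^ j"
      by (simp add: D_def mult_ac)
    also have "2 powr (\<epsilon> / 2 * real (i + 1)) * 2 powr (\<epsilon> / 2 * real (i + 1)) = 2 powr \<epsilon> * 2 powr (\<epsilon> * real i)"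
      by (simp add: powr_add[symmetric] algebra_simps)
    finally show ?thesis by (simp add: M_def C'_def mult_ac)
  qed
  moreover have "0 < C'" using C \<epsilon> by (simp add: C'_def)
  ultimately show ?thesis by blast
qed

section \<open>Exponential sums and almost orthogonality\<close>

definition unit_exp :: "real \<Rightarrow> complex" where
  "unit_exp \<theta> = cis (2 * pi * \<theta>)"

lemma unit_exp_0 [simp]: "unit_exp 0 = 1"
  by (simp add: unit_exp_def)

lemma unit_exp_add: "unit_exp (a + b) = unit_exp a * unit_exp b"
  by (simp add: unit_exp_def cis_mult distrib_left)

lemma norm_unit_exp [simp]: "norm (unit_exp a) = 1"
  by (simp add: unit_exp_def)

lemma cnj_unit_exp: "cnj (unit_exp a) = unit_exp (- a)"
  by (simp add: unit_exp_def cis_cnj)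

lemma unit_exp_of_int [simp]: "unit_exp (of_int n) = 1"
  by (simp add: unit_exp_def cis_multiple_2pi)

lemma unit_exp_of_nat_mult: "unit_exp (of_nat n * a) = unit_exp a ^ n"
  by (simp add: unit_exp_def Complex.DeMoivre mult_ac)

lemma unit_exp_eq_1_imp: "unit_exp a = 1 \<Longrightarrow> a \<in> \<int>"
proof -
  assume "unit_exp a = 1"
  then have "cos (2 * pi * a) = 1" by (simp add: unit_exp_def complex_eq_iff)
  then obtain n :: int where "2 * pi * a = of_int n * 2 * pi" using cos_one_2pi_int by metis
  then have "a = of_int n" by simp
  then show ?thesis by simp
qed

text \<open>By the mean value theorem \<open>sin u \<ge> u cos u\<close>, and doubling the angle gives
\<open>sin x \<ge> x (1 + cos x) / 2\<close>.\<close>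

lemma sin_ge_half:
  fixes x :: real assumes "0 \<le> x" "x \<le> pi / 2" shows "x / 2 \<le> sin x"
proof (cases "x = 0")
  case False
  then have x: "0 < x / 2" using assms by simp
  obtain z where z: "0 < z" "z < x / 2" "sin (x / 2) - sin 0 = (x / 2 - 0) * cos z"
    using MVT2[OF x, of sin cos] by (auto intro: derivative_eq_intros)
  have "cos (x / 2) \<le> cos z" by (rule cos_monotone_0_pi_le) (use z assms in auto)
  then have 1: "x / 2 * cos (x / 2) \<le> sin (x / 2)" using z(3) x by (simp add: mult_left_mono)
  have c: "0 \<le> cos (x / 2)" by (rule cos_ge_zero) (use assms x in auto)
  have "x / 2 \<le> x / 2 * (1 + cos x)"
    using assms cos_ge_zero[of x] by (simp add: distrib_left)
  also have "\<dots> = 2 * (x / 2 * cos (x / 2)) * cos (x / 2)"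
    using cos_double_cos[of "x / 2"] by (simp add: power2_eq_square)
  also have "\<dots> \<le> 2 * sin (x / 2) * cos (x / 2)"
    using 1 c by (intro mult_right_mono) auto
  also have "\<dots> = sin x" using sin_double[of "x / 2"] by simp
  finally show ?thesis .
qed simp

lemma norm_1_minus_unit_exp: "norm (1 - unit_exp a) = 2 * \<bar>sin (pi * a)\<bar>"
proof -
  have "(norm (1 - unit_exp a))\<^sup>2 = (1 - cos (2 * pi * a))\<^sup>2 + (sin (2 * pi * a))\<^sup>2"
    by (simp add: unit_exp_def cmod_power2)
  also have "\<dots> = 2 - 2 * cos (2 * (pi * a))"
    using sin_cos_squared_add[of "2 * pi * a"] by (simp add: power2_eq_square algebra_simps)
  also have "\<dots> = (2 * \<bar>sin (pi * a)\<bar>)\<^sup>2"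
    unfolding cos_double_sin by (simp add: power_mult_distrib)
  finally show ?thesis by (rule power2_eq_imp_eq) auto
qed

lemma norm_1_minus_unit_exp_ge:
  assumes "\<bar>a\<bar> < 1"
  shows "min (2 * \<bar>a\<bar>) (2 * (1 - \<bar>a\<bar>)) \<le> norm (1 - unit_exp a)"
proof -
  have s: "\<bar>sin (pi * a)\<bar> = \<bar>sin (pi * \<bar>a\<bar>)\<bar>" by (cases "0 \<le> a") auto
  have pi2: "2 \<le> pi" using pi_ge_two .
  show ?thesis
  proof (cases "\<bar>a\<bar> \<le> 1/2")
    case True
    have "pi * \<bar>a\<bar> / 2 \<le> sin (pi * \<bar>a\<bar>)" by (rule sin_ge_half) (use True in auto)
    moreover have "2 * \<bar>a\<bar> \<le> pi * \<bar>a\<bar>" using pi2 by (rule mult_right_mono) simp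
    ultimately show ?thesis unfolding norm_1_minus_unit_exp s by linarith
  next
    case False
    have "pi * (1 - \<bar>a\<bar>) / 2 \<le> sin (pi * (1 - \<bar>a\<bar>))"
      by (rule sin_ge_half) (use False assms in auto)
    moreover have "sin (pi * (1 - \<bar>a\<bar>)) = sin (pi * \<bar>a\<bar>)"
      using sin_pi_minus[of "pi * \<bar>a\<bar>"] by (simp add: algebra_simps)
    moreover have "2 * (1 - \<bar>a\<bar>) \<le> pi * (1 - \<bar>a\<bar>)" using pi2 assms by (intro mult_right_mono) auto
    ultimately show ?thesis unfolding norm_1_minus_unit_exp s by linarith
  qed
qed

text \<open>The modulus of the inner product on \<open>X\<close> of two characters whose frequencies differ by \<open>\<theta>\<close>.\<close>

definition exp_sum :: "int set \<Rightarrow> real \<Rightarrow> real" where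
  "exp_sum X \<theta> = norm (\<Sum>x\<in>X. unit_exp (\<theta> * of_int x))"

lemma exp_sum_nonneg [simp]: "0 \<le> exp_sum X \<theta>"
  by (simp add: exp_sum_def)

lemma exp_sum_minus: "exp_sum X (- \<theta>) = exp_sum X \<theta>"
proof -
  have "(\<Sum>x\<in>X. unit_exp (- \<theta> * of_int x)) = cnj (\<Sum>x\<in>X. unit_exp (\<theta> * of_int x))"
    by (simp add: cnj_sum cnj_unit_exp)
  then show ?thesis by (simp only: exp_sum_def complex_mod_cnj)
qed

lemma exp_sum_le_card: "exp_sum X \<theta> \<le> real (card X)"
  unfolding exp_sum_def using norm_sum[of "\<lambda>x. unit_exp (\<theta> * of_int x)" X] by simp

lemma exp_sum_interval_le:
  assumes "0 < \<bar>\<theta>\<bar>" "\<bar>\<theta>\<bar> < 1"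
  shows "exp_sum {a..<a + int L} \<theta> \<le> 1 / \<bar>\<theta>\<bar> + 1 / (1 - \<bar>\<theta>\<bar>)"
proof -
  have ne: "unit_exp \<theta> \<noteq> 1"
  proof
    assume "unit_exp \<theta> = 1"
    then obtain n :: int where "\<theta> = of_int n" using unit_exp_eq_1_imp Ints_cases by blast
    then show False using assms by (simp flip: of_int_abs)
  qed
  have "{a..<a + int L} = (\<lambda>k. a + int k) ` {..<L}"
  proof (intro set_eqI iffI)
    fix x assume "x \<in> {a..<a + int L}"
    then have "x = a + int (nat (x - a))" "nat (x - a) \<in> {..<L}" by auto
    then show "x \<in> (\<lambda>k. a + int k) ` {..<L}" by blast
  qed auto
  then have "(\<Sum>x\<in>{a..<a + int L}. unit_exp (\<theta> * of_int x)) = (\<Sum>k<L. unit_exp (\<theta> * of_int (a + int k)))"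
    by (simp add: sum.reindex inj_on_def)
  also have "\<dots> = unit_exp (\<theta> * of_int a) * (\<Sum>k<L. unit_exp \<theta> ^ k)"
    unfolding sum_distrib_left
    by (intro sum.cong refl) (simp add: distrib_left unit_exp_add unit_exp_of_nat_mult[symmetric] mult.commute)
  also have "(\<Sum>k<L. unit_exp \<theta> ^ k) = (unit_exp \<theta> ^ L - 1) / (unit_exp \<theta> - 1)"
    using ne by (rule geometric_sum)
  finally have "exp_sum {a..<a + int L} \<theta> = norm (unit_exp \<theta> ^ L - 1) / norm (1 - unit_exp \<theta>)"
    by (simp add: exp_sum_def norm_mult norm_divide norm_minus_commute)
  also have "\<dots> \<le> 2 / norm (1 - unit_exp \<theta>)"
    using norm_triangle_ineq4[of "unit_exp \<theta> ^ L" 1] by (intro divide_right_mono) (auto simp: norm_power)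
  also have "\<dots> \<le> 2 / min (2 * \<bar>\<theta>\<bar>) (2 * (1 - \<bar>\<theta>\<bar>))"
    using assms norm_1_minus_unit_exp_ge[OF assms(2)] by (intro divide_left_mono mult_pos_pos) (auto simp: ne)
  also have "\<dots> \<le> 1 / \<bar>\<theta>\<bar> + 1 / (1 - \<bar>\<theta>\<bar>)"
  proof -
    have h: "2 / (2 * c) = 1 / c" for c :: real by simp
    have "0 \<le> 1 / \<bar>\<theta>\<bar>" "0 \<le> 1 / (1 - \<bar>\<theta>\<bar>)" using assms by simp_all
    then show ?thesis unfolding min_def by (simp only: h split: if_split) linarith
  qed
  finally show ?thesis .
qed

text \<open>Schur's test for the Gram matrix of the characters: expand the square and estimate each product of two
coefficients by the mean of their squares.\<close>

lemma almost_orthogonal_dual: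
  fixes pos :: "'p \<Rightarrow> real" and u :: "'p \<Rightarrow> complex"
  assumes \<Delta>: "\<And>p. p \<in> P \<Longrightarrow> (\<Sum>p'\<in>P. exp_sum X (pos p - pos p')) \<le> \<Delta>"
  shows "(\<Sum>x\<in>X. (norm (\<Sum>p\<in>P. u p * unit_exp (pos p * of_int x)))\<^sup>2) \<le> \<Delta> * (\<Sum>p\<in>P. (norm (u p))\<^sup>2)"
proof -
  let ?E = "\<lambda>p x. unit_exp (pos p * of_int x)"
  have "complex_of_real (\<Sum>x\<in>X. (norm (\<Sum>p\<in>P. u p * ?E p x))\<^sup>2) =
      (\<Sum>x\<in>X. (\<Sum>p\<in>P. u p * ?E p x) * cnj (\<Sum>p\<in>P. u p * ?E p x))"
    by (simp only: of_real_sum complex_norm_square)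
  also have "\<dots> = (\<Sum>x\<in>X. \<Sum>p\<in>P. \<Sum>p'\<in>P. u p * cnj (u p') * unit_exp ((pos p - pos p') * of_int x))"
    by (simp add: cnj_sum sum_product cnj_unit_exp algebra_simps flip: unit_exp_add)
  also have "\<dots> = (\<Sum>p\<in>P. \<Sum>p'\<in>P. u p * cnj (u p') * (\<Sum>x\<in>X. unit_exp ((pos p - pos p') * of_int x)))"
    by (subst sum.swap, intro sum.cong refl, subst sum.swap) (simp add: sum_distrib_left)
  finally have "norm (complex_of_real (\<Sum>x\<in>X. (norm (\<Sum>p\<in>P. u p * ?E p x))\<^sup>2)) =
      norm (\<Sum>p\<in>P. \<Sum>p'\<in>P. u p * cnj (u p') * (\<Sum>x\<in>X. unit_exp ((pos p - pos p') * of_int x)))"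
    by (rule arg_cong)
  then have "(\<Sum>x\<in>X. (norm (\<Sum>p\<in>P. u p * ?E p x))\<^sup>2) =
      norm (\<Sum>p\<in>P. \<Sum>p'\<in>P. u p * cnj (u p') * (\<Sum>x\<in>X. unit_exp ((pos p - pos p') * of_int x)))"
    by (subst (asm) norm_of_real, subst (asm) abs_of_nonneg) (auto intro: sum_nonneg)
  also have "\<dots> \<le> (\<Sum>p\<in>P. \<Sum>p'\<in>P. norm (u p) * norm (u p') * exp_sum X (pos p - pos p'))"
    by (rule order_trans[OF norm_sum], rule sum_mono, rule order_trans[OF norm_sum])
       (simp add: norm_mult exp_sum_def)
  also have "\<dots> \<le> (\<Sum>p\<in>P. \<Sum>p'\<in>P. ((norm (u p))\<^sup>2 + (norm (u p'))\<^sup>2) / 2 * exp_sum X (pos p - pos p'))"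
  proof (intro sum_mono mult_right_mono)
    fix p p' show "norm (u p) * norm (u p') \<le> ((norm (u p))\<^sup>2 + (norm (u p'))\<^sup>2) / 2"
      using sum_squares_bound[of "norm (u p)" "norm (u p')"] by simp
  qed simp
  also have "\<dots> = (\<Sum>p\<in>P. \<Sum>p'\<in>P. (norm (u p))\<^sup>2 / 2 * exp_sum X (pos p - pos p')) +
      (\<Sum>p\<in>P. \<Sum>p'\<in>P. (norm (u p'))\<^sup>2 / 2 * exp_sum X (pos p - pos p'))"
    by (simp add: sum.distrib[symmetric] add_divide_distrib distrib_right)
  also have "(\<Sum>p\<in>P. \<Sum>p'\<in>P. (norm (u p'))\<^sup>2 / 2 * exp_sum X (pos p - pos p')) =
      (\<Sum>p\<in>P. \<Sum>p'\<in>P. (norm (u p))\<^sup>2 / 2 * exp_sum X (pos p - pos p'))"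
    by (subst sum.swap) (metis (no_types, lifting) exp_sum_minus minus_diff_eq sum.cong)
  also have "(\<Sum>p\<in>P. \<Sum>p'\<in>P. (norm (u p))\<^sup>2 / 2 * exp_sum X (pos p - pos p')) +
      (\<Sum>p\<in>P. \<Sum>p'\<in>P. (norm (u p))\<^sup>2 / 2 * exp_sum X (pos p - pos p')) =
      (\<Sum>p\<in>P. (norm (u p))\<^sup>2 * (\<Sum>p'\<in>P. exp_sum X (pos p - pos p')))"
    by (simp add: sum.distrib[symmetric] sum_distrib_left)
  also have "\<dots> \<le> (\<Sum>p\<in>P. (norm (u p))\<^sup>2 * \<Delta>)"
    by (intro sum_mono mult_left_mono \<Delta>) auto
  also have "\<dots> = \<Delta> * (\<Sum>p\<in>P. (norm (u p))\<^sup>2)"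
    by (simp add: sum_distrib_left mult.commute)
  finally show ?thesis .
qed

text \<open>This is the dual of the previous inequality: a matrix and its adjoint have the same norm.\<close>

lemma almost_orthogonal:
  fixes pos :: "'p \<Rightarrow> real" and f :: "int \<Rightarrow> complex"
  assumes \<Delta>: "\<And>p. p \<in> P \<Longrightarrow> (\<Sum>p'\<in>P. exp_sum X (pos p - pos p')) \<le> \<Delta>" and "0 \<le> \<Delta>"
  shows "(\<Sum>p\<in>P. (norm (\<Sum>x\<in>X. f x * unit_exp (pos p * of_int x)))\<^sup>2) \<le> \<Delta> * (\<Sum>x\<in>X. (norm (f x))\<^sup>2)"
proof -
  define v where "v p = (\<Sum>x\<in>X. f x * unit_exp (pos p * of_int x))" for p
  define w where "w x = (\<Sum>p\<in>P. cnj (v p) * unit_exp (pos p * of_int x))" for x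
  define S where "S = (\<Sum>p\<in>P. (norm (v p))\<^sup>2)"
  define F where "F = (\<Sum>x\<in>X. (norm (f x))\<^sup>2)"
  have S0: "0 \<le> S" "0 \<le> F" by (simp_all add: S_def F_def sum_nonneg)
  have "complex_of_real S = (\<Sum>p\<in>P. cnj (v p) * v p)"
    by (simp only: S_def of_real_sum complex_norm_square mult.commute)
  also have "\<dots> = (\<Sum>p\<in>P. \<Sum>x\<in>X. f x * (cnj (v p) * unit_exp (pos p * of_int x)))"
    by (subst (2) v_def) (simp add: sum_distrib_left mult_ac)
  also have "\<dots> = (\<Sum>x\<in>X. f x * w x)"
    unfolding w_def by (subst sum.swap) (simp add: sum_distrib_left)
  finally have "norm (complex_of_real S) = norm (\<Sum>x\<in>X. f x * w x)" by simp
  then have "S \<le> (\<Sum>x\<in>X. norm (f x) * norm (w x))"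
    using S0 norm_sum[of "\<lambda>x. f x * w x" X] by (simp add: norm_mult)
  then have "S\<^sup>2 \<le> (\<Sum>x\<in>X. norm (f x) * norm (w x))\<^sup>2" using S0 by (intro power_mono)
  also have "\<dots> \<le> F * (\<Sum>x\<in>X. (norm (w x))\<^sup>2)"
    unfolding F_def by (rule Cauchy_Schwarz_ineq_sum)
  also have "(\<Sum>x\<in>X. (norm (w x))\<^sup>2) \<le> \<Delta> * (\<Sum>p\<in>P. (norm (cnj (v p)))\<^sup>2)"
    unfolding w_def by (rule almost_orthogonal_dual) (rule \<Delta>)
  then have "F * (\<Sum>x\<in>X. (norm (w x))\<^sup>2) \<le> F * (\<Delta> * S)"
    using S0 by (intro mult_left_mono) (simp_all add: S_def)
  finally have "S * S \<le> \<Delta> * F * S" by (simp add: power2_eq_square mult_ac)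
  then have "S \<le> \<Delta> * F"
    using S0 assms(2) by (cases "S = 0") auto
  then show ?thesis by (simp add: S_def F_def v_def)
qed

text \<open>The operator factors through the coefficients at the frequencies in \<open>P\<close>: analyse on \<open>Y\<close>, multiply by
\<open>w\<close>, synthesise on \<open>X\<close>. Both outer factors are almost isometries up to the Gram bounds, so its norm
is governed by the size of \<open>w\<close>.\<close>

lemma frequency_operator_bound:
  fixes pos :: "'p \<Rightarrow> real" and f :: "int \<Rightarrow> complex" and w :: "'p \<Rightarrow> real"
  assumes \<Delta>: "\<And>p. p \<in> P \<Longrightarrow> (\<Sum>p'\<in>P. exp_sum X (pos p - pos p')) \<le> \<Delta>" and "0 \<le> \<Delta>"
    and \<Delta>': "\<And>p. p \<in> P \<Longrightarrow> (\<Sum>p'\<in>P. exp_sum Y (pos p - pos p')) \<le> \<Delta>'" and "0 \<le> \<Delta>'"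
    and w: "\<And>p. p \<in> P \<Longrightarrow> \<bar>w p\<bar> \<le> W"
  shows "(\<Sum>x\<in>X. (norm (\<Sum>y\<in>Y. (\<Sum>p\<in>P. of_real (w p) * unit_exp (pos p * of_int (y - x))) * f y))\<^sup>2)
    \<le> W\<^sup>2 * \<Delta> * \<Delta>' * (\<Sum>y\<in>Y. (norm (f y))\<^sup>2)"
proof -
  define v where "v p = (\<Sum>y\<in>Y. f y * unit_exp (pos p * of_int y))" for p
  have eq: "(\<Sum>y\<in>Y. (\<Sum>p\<in>P. of_real (w p) * unit_exp (pos p * of_int (y - x))) * f y) =
      (\<Sum>p\<in>P. (of_real (w p) * v p) * unit_exp (- pos p * of_int x))" for x
  proof -
    have "(\<Sum>y\<in>Y. (\<Sum>p\<in>P. of_real (w p) * unit_exp (pos p * of_int (y - x))) * f y) =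
      (\<Sum>p\<in>P. \<Sum>y\<in>Y. of_real (w p) * unit_exp (pos p * of_int (y - x)) * f y)"
      by (subst sum.swap) (simp add: sum_distrib_right)
    also have "\<dots> = (\<Sum>p\<in>P. \<Sum>y\<in>Y. of_real (w p) * (f y * unit_exp (pos p * of_int y)) * unit_exp (- pos p * of_int x))"
    proof (intro sum.cong refl)
      fix p y
      have "unit_exp (pos p * of_int (y - x)) = unit_exp (pos p * of_int y) * unit_exp (- pos p * of_int x)"
        by (simp add: unit_exp_add[symmetric] algebra_simps)
      then show "of_real (w p) * unit_exp (pos p * of_int (y - x)) * f y =
          of_real (w p) * (f y * unit_exp (pos p * of_int y)) * unit_exp (- pos p * of_int x)"
        by (simp only: mult_ac)
    qed
    also have "\<dots> = (\<Sum>p\<in>P. (of_real (w p) * v p) * unit_exp (- pos p * of_int x))"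
      by (simp add: v_def sum_distrib_left sum_distrib_right)
    finally show ?thesis .
  qed
  have "(\<Sum>x\<in>X. (norm (\<Sum>p\<in>P. (of_real (w p) * v p) * unit_exp (- pos p * of_int x)))\<^sup>2) \<le>
      \<Delta> * (\<Sum>p\<in>P. (norm (of_real (w p) * v p))\<^sup>2)"
  proof (rule almost_orthogonal_dual)
    fix p assume "p \<in> P"
    have "exp_sum X (- pos p - - pos p') = exp_sum X (pos p - pos p')" for p'
      using exp_sum_minus[of X "pos p - pos p'"] by simp
    then show "(\<Sum>p'\<in>P. exp_sum X (- pos p - - pos p')) \<le> \<Delta>" using \<Delta>[OF \<open>p \<in> P\<close>] by simp
  qed
  also have "\<dots> \<le> \<Delta> * (\<Sum>p\<in>P. W\<^sup>2 * (norm (v p))\<^sup>2)"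
  proof (intro mult_left_mono sum_mono)
    fix p assume "p \<in> P"
    from w[OF this] have "\<bar>w p\<bar>\<^sup>2 \<le> W\<^sup>2" by (intro power_mono) auto
    then show "(norm (of_real (w p) * v p))\<^sup>2 \<le> W\<^sup>2 * (norm (v p))\<^sup>2"
      by (simp add: norm_mult power_mult_distrib mult_right_mono)
  qed (rule assms)
  also have "\<dots> = W\<^sup>2 * \<Delta> * (\<Sum>p\<in>P. (norm (v p))\<^sup>2)" by (simp add: sum_distrib_left mult_ac)
  also have "\<dots> \<le> W\<^sup>2 * \<Delta> * (\<Delta>' * (\<Sum>y\<in>Y. (norm (f y))\<^sup>2))"
    unfolding v_def using assms by (intro mult_left_mono almost_orthogonal) auto
  finally show ?thesis by (simp only: eq mult.assoc)
qed

section \<open>Ramanujan sums and Farey fractions\<close>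

definition ramanujan :: "nat \<Rightarrow> int \<Rightarrow> complex" where
  "ramanujan q n = (\<Sum>b\<in>totatives q. unit_exp (real b / real q * of_int n))"

lemma sum_unit_exp_complete:
  assumes "0 < k"
  shows "(\<Sum>b\<in>{0<..k}. unit_exp (real b / real k * of_int n)) = (if int k dvd n then of_nat k else 0)"
proof -
  define z where "z = unit_exp (of_int n / real k)"
  have pw: "unit_exp (real b / real k * of_int n) = z ^ b" for b
    by (simp add: z_def unit_exp_of_nat_mult[symmetric])
  show ?thesis
  proof (cases "int k dvd n")
    case True
    then obtain m where "n = int k * m" by (elim dvdE)
    then have "z = 1" using assms by (simp add: z_def)
    then show ?thesis unfolding pw using True by simp
  next
    case False
    have "z \<noteq> 1"
    proof
      assume "z = 1"
      then obtain m :: int where "of_int n / real k = of_int m"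
        using unit_exp_eq_1_imp Ints_cases unfolding z_def by blast
      then have "real_of_int n = real_of_int (m * int k)" using assms by (simp add: field_simps)
      then have "n = m * int k" by (simp only: of_int_eq_iff)
      then show False using False by simp
    qed
    moreover have "z ^ k = 1" using pw[of k] assms by simp
    moreover have "(\<Sum>b\<in>{0<..k}. z ^ b) = z * (\<Sum>b<k. z ^ b)"
      unfolding sum_distrib_left
      by (rule sum.reindex_bij_witness[of _ Suc "\<lambda>b. b - 1"]) (auto simp: gr0_conv_Suc)
    ultimately show ?thesis unfolding pw using False by (simp add: geometric_sum)
  qed
qed

text \<open>The fractions \<open>b / k\<close> are sorted by their reduced denominators.\<close>

lemma sum_ramanujan_divisors:
  assumes "0 < k"
  shows "(\<Sum>q | q dvd k. ramanujan q n) = (if int k dvd n then of_nat k else 0)"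
proof -
  let ?e = "\<lambda>b. unit_exp (real b / real k * of_int n)"
  have "(\<Sum>b\<in>{0<..k}. ?e b) = (\<Sum>d | d dvd k. \<Sum>b | b \<in> {0<..k} \<and> gcd b k = d. ?e b)"
    using assms by (intro sum.group[symmetric]) auto
  also have "\<dots> = (\<Sum>d | d dvd k. ramanujan (k div d) n)"
  proof (rule sum.cong[OF refl])
    fix d assume "d \<in> {d. d dvd k}"
    then have d: "d dvd k" "0 < d" using assms by (auto intro: dvd_pos_nat)
    have "(\<Sum>b | b \<in> {0<..k} \<and> gcd b k = d. ?e b) = (\<Sum>b\<in>totatives (k div d). ?e (b * d))"
      using sum.reindex_bij_betw[OF bij_betw_totatives_gcd_eq[OF d(1) assms], of ?e] by simp
    also have "\<dots> = ramanujan (k div d) n"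
      unfolding ramanujan_def using d by (intro sum.cong refl) (simp add: real_of_nat_div)
    finally show "(\<Sum>b | b \<in> {0<..k} \<and> gcd b k = d. ?e b) = ramanujan (k div d) n" .
  qed
  also have "\<dots> = (\<Sum>q | q dvd k. ramanujan q n)"
    using assms by (intro sum.reindex_bij_witness[of _ "(div) k" "(div) k"]) (auto elim: dvdE)
  finally show ?thesis using sum_unit_exp_complete[OF assms, of n] by simp
qed

lemma prod_primes_dvd_iff:
  fixes b :: nat
  assumes "finite X" "\<And>p. p \<in> X \<Longrightarrow> prime p"
  shows "\<Prod>X dvd b \<longleftrightarrow> (\<forall>p\<in>X. p dvd b)"
  using assms
proof (induction X)
  case (insert p X)
  have "coprime p (\<Prod>X)"
    using insert by (intro prod_coprime_right) (auto intro: primes_coprime)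
  then have "p * \<Prod>X dvd b \<longleftrightarrow> p dvd b \<and> \<Prod>X dvd b"
    by (auto intro: divides_mult dest: dvd_mult_left dvd_mult_right)
  then show ?case using insert by simp
qed simp

text \<open>Inclusion and exclusion over the primes dividing \<open>q\<close>, obtained by multiplying out the product of the
factors \<open>1 - [p dvd b]\<close>.\<close>

lemma coprime_indicator_expand:
  fixes q b :: nat
  assumes "0 < q"
  shows "(if coprime b q then 1 else 0) =
    (\<Sum>X\<in>Pow (prime_factors q). (-1) ^ card X * (if \<Prod>X dvd b then 1 else (0::complex)))"
proof -
  let ?P = "prime_factors q"
  have "(if coprime b q then 1 else 0) = (\<Prod>p\<in>?P. (if p dvd b then -1 else 0) + (1::complex))"
  proof (cases "coprime b q")
    case True
    then have "\<not> p dvd b" if "p \<in> ?P" for p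
      using that by (metis coprime_common_divisor in_prime_factors_iff not_prime_unit)
    then show ?thesis using True by simp
  next
    case False
    then obtain p where "prime p" "p dvd b" "p dvd q"
      by (metis coprime_iff_gcd_eq_1 gcd_greatest_iff prime_factor_nat)
    then have "p \<in> ?P" using assms by (auto simp: in_prime_factors_iff)
    then show ?thesis using False \<open>p dvd b\<close> by (auto intro!: prod_zero[symmetric])
  qed
  also have "\<dots> = (\<Sum>X\<in>Pow ?P. (\<Prod>p\<in>X. if p dvd b then -1 else 0) * (\<Prod>p\<in>?P - X. 1))"
    by (rule prod_add) simp
  also have "\<dots> = (\<Sum>X\<in>Pow ?P. (-1) ^ card X * (if \<Prod>X dvd b then 1 else 0))"
  proof (rule sum.cong[OF refl])
    fix X assume "X \<in> Pow ?P"
    then have X: "finite X" "\<And>p. p \<in> X \<Longrightarrow> prime p" by (auto intro: finite_subset)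
    have "(\<Prod>p\<in>X. if p dvd b then -1 else (0::complex)) = (-1) ^ card X * (if \<Prod>X dvd b then 1 else 0)"
    proof (cases "\<forall>p\<in>X. p dvd b")
      case False
      then show ?thesis using X by (auto simp: prod_primes_dvd_iff intro!: prod_zero)
    qed (simp add: prod_primes_dvd_iff X)
    then show "(\<Prod>p\<in>X. if p dvd b then -1 else (0::complex)) * (\<Prod>p\<in>?P - X. 1) =
        (-1) ^ card X * (if \<Prod>X dvd b then 1 else 0)" by simp
  qed
  finally show ?thesis .
qed

text \<open>By inclusion and exclusion the Ramanujan sum is an alternating sum, over products \<open>D\<close> of distinct primes
dividing \<open>q\<close>, of complete sums modulo \<open>q div D\<close>; such a sum is \<open>q div D\<close> or 0. Different sets
of primes give different divisors \<open>q div D\<close>.\<close>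

lemma norm_ramanujan_le:
  assumes q: "0 < q"
  shows "norm (ramanujan q n) \<le> (\<Sum>d | d dvd q \<and> int d dvd n. real d)"
proof -
  let ?P = "prime_factors q"
  let ?e = "\<lambda>b. unit_exp (real b / real q * of_int n)"
  let ?h = "\<lambda>d. if int d dvd n then real d else 0"
  have tot: "totatives q = {b \<in> {0<..q}. coprime b q}" by (auto simp: in_totatives_iff)
  have "ramanujan q n = (\<Sum>b\<in>{0<..q}. if coprime b q then ?e b else 0)"
    unfolding ramanujan_def tot by (rule sum.inter_filter) simp
  also have "\<dots> = (\<Sum>b\<in>{0<..q}. (if coprime b q then 1 else 0) * ?e b)"
    by (intro sum.cong refl) auto
  also have "\<dots> = (\<Sum>b\<in>{0<..q}. \<Sum>X\<in>Pow ?P. (-1) ^ card X * (if \<Prod>X dvd b then ?e b else 0))"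
    unfolding coprime_indicator_expand[OF q] sum_distrib_right by (intro sum.cong refl) auto
  also have "\<dots> = (\<Sum>X\<in>Pow ?P. (-1) ^ card X * (\<Sum>b\<in>{0<..q}. if \<Prod>X dvd b then ?e b else 0))"
    by (subst sum.swap) (simp add: sum_distrib_left)
  finally have "norm (ramanujan q n) \<le> (\<Sum>X\<in>Pow ?P. norm (\<Sum>b\<in>{0<..q}. if \<Prod>X dvd b then ?e b else 0))"
    using norm_sum by (simp add: norm_mult norm_power sum_norm_le)
  also have "\<dots> = (\<Sum>X\<in>Pow ?P. ?h (q div \<Prod>X))"
  proof (rule sum.cong[OF refl])
    fix X assume "X \<in> Pow ?P"
    then have X: "finite X" "\<And>p. p \<in> X \<Longrightarrow> prime p" "\<And>p. p \<in> X \<Longrightarrow> p dvd q"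
      by (auto intro: finite_subset)
    define D where "D = \<Prod>X"
    have "D dvd q" using X by (simp add: D_def prod_primes_dvd_iff)
    then obtain c where c: "q = D * c" by (elim dvdE)
    then have pos: "0 < D" "0 < c" using q by (cases "D = 0"; cases "c = 0"; simp)+
    have "(\<Sum>b\<in>{0<..q}. if D dvd b then ?e b else 0) = (\<Sum>b\<in>{b \<in> {0<..q}. D dvd b}. ?e b)"
      by (rule sum.inter_filter[symmetric]) simp
    also have "\<dots> = (\<Sum>b\<in>{0<..c}. unit_exp (real b / real c * of_int n))"
      using pos c by (intro sum.reindex_bij_witness[of _ "\<lambda>b. D * b" "\<lambda>b. b div D"]) (auto elim!: dvdE)
    also have "\<dots> = (if int c dvd n then of_nat c else 0)" by (rule sum_unit_exp_complete[OF pos(2)])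
    finally show "norm (\<Sum>b\<in>{0<..q}. if \<Prod>X dvd b then ?e b else 0) = ?h (q div \<Prod>X)"
      using pos c by (simp add: D_def)
  qed
  also have "\<dots> = (\<Sum>d\<in>(\<lambda>X. q div \<Prod>X) ` Pow ?P. ?h d)"
  proof (rule sum.reindex[symmetric, unfolded o_def])
    show "inj_on (\<lambda>X. q div \<Prod>X) (Pow ?P)"
    proof (rule inj_onI)
      fix X Y assume XY: "X \<in> Pow ?P" "Y \<in> Pow ?P" "q div \<Prod>X = q div \<Prod>Y"
      have fact: "\<Prod>X dvd q \<and> finite X \<and> (\<forall>p. prime p \<longrightarrow> (p dvd \<Prod>X \<longleftrightarrow> p \<in> X))" if "X \<in> Pow ?P" for X
      proof -
        from that have X: "finite X" "\<And>p. p \<in> X \<Longrightarrow> prime p" "\<And>p. p \<in> X \<Longrightarrow> p dvd q"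
          by (auto intro: finite_subset)
        have "p dvd \<Prod>X \<longleftrightarrow> p \<in> X" if pp: "prime p" for p
        proof
          assume "p dvd \<Prod>X"
          then obtain p' where "p' \<in> X" "p dvd p'"
            using prime_dvd_prod_iff[OF X(1) pp, of "\<lambda>x. x"] by auto
          then show "p \<in> X" using X(2) pp primes_dvd_imp_eq by blast
        qed (use X in \<open>auto intro: dvd_prodI\<close>)
        then show ?thesis using X by (simp add: prod_primes_dvd_iff)
      qed
      have "\<Prod>X = \<Prod>Y"
        using fact[OF XY(1)] fact[OF XY(2)] XY(3) q by (metis dvd_div_mult_self dvd_mult_div_cancel gr_implies_not0 mult_cancel_left mult_cancel_right mult_is_0)
      then show "X = Y" using fact[OF XY(1)] fact[OF XY(2)] XY(1,2)
        by (auto simp: in_prime_factors_iff)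
    qed
  qed
  also have "\<dots> \<le> (\<Sum>d\<in>{d. d dvd q}. ?h d)"
  proof (rule sum_mono2)
    show "(\<lambda>X. q div \<Prod>X) ` Pow ?P \<subseteq> {d. d dvd q}"
    proof
      fix d assume "d \<in> (\<lambda>X. q div \<Prod>X) ` Pow ?P"
      then obtain X where X: "X \<in> Pow ?P" "d = q div \<Prod>X" by blast
      have "\<Prod>X dvd q" using X(1) by (subst prod_primes_dvd_iff) (auto intro: finite_subset)
      then show "d \<in> {d. d dvd q}" using X(2) by (auto elim: dvdE)
    qed
  qed (use q in auto)
  also have "\<dots> = (\<Sum>d | d dvd q \<and> int d dvd n. real d)"
    using sum.inter_filter[of "{d. d dvd q}" real "\<lambda>d. int d dvd n"] q by simp
  finally show ?thesis .
qed

text \<open>The reduced fractions \<open>b / q\<close> in \<open>(0, 1]\<close> with \<open>a \<le> q < M\<close>, as pairs \<open>(q, b)\<close>.\<close>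

definition farey :: "nat \<Rightarrow> nat \<Rightarrow> (nat \<times> nat) set" where
  "farey a M = Sigma {q. 0 < q \<and> a \<le> q \<and> q < M} totatives"

definition farey_point :: "nat \<times> nat \<Rightarrow> real" where
  "farey_point = (\<lambda>(q, b). real b / real q)"

lemma finite_farey [simp]: "finite (farey a M)"
  unfolding farey_def by (intro finite_SigmaI) auto

lemma card_farey_le: "card (farey a M) \<le> M ^ 2"
proof -
  have "farey a M \<subseteq> {0<..M} \<times> {0<..M}" by (auto simp: farey_def in_totatives_iff)
  then have "card (farey a M) \<le> card ({0<..M} \<times> {0<..M})" by (intro card_mono) auto
  then show ?thesis by (simp add: power2_eq_square card_cartesian_product)
qed

lemma sum_farey:
  "(\<Sum>P\<in>farey a M. of_real (w (fst P)) * unit_exp (farey_point P * of_int n)) =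
    (\<Sum>q | 0 < q \<and> a \<le> q \<and> q < M. of_real (w q) * ramanujan q n)"
  unfolding farey_def ramanujan_def sum_distrib_left
  by (subst sum.Sigma) (auto simp: farey_point_def split_def)

lemma farey_point_diff:
  assumes "P \<in> farey a M" "P' \<in> farey a M" "P \<noteq> P'"
  shows "1 / (real (fst P) * real (fst P')) \<le> \<bar>farey_point P - farey_point P'\<bar>"
    and "\<bar>farey_point P - farey_point P'\<bar> \<le> 1 - 1 / (real (fst P) * real (fst P'))"
proof -
  obtain q b q' b' where P: "P = (q, b)" "P' = (q', b')" by (cases P; cases P')
  have q: "0 < q" "0 < q'" "0 < b" "b \<le> q" "0 < b'" "b' \<le> q'" "coprime b q" "coprime b' q'"
    using assms by (auto simp: P farey_def in_totatives_iff)
  define u where "u = int b * int q' - int b' * int q"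
  have "u \<noteq> 0"
  proof
    assume "u = 0"
    then have e: "b * q' = b' * q" by (simp add: u_def flip: of_nat_mult)
    have "q dvd q'" using e q(7) by (metis coprime_commute coprime_dvd_mult_right_iff dvd_triv_right)
    moreover have "q' dvd q" using e q(8) by (metis coprime_commute coprime_dvd_mult_right_iff dvd_triv_right)
    ultimately have "q = q'" by (rule dvd_antisym)
    then have "b = b'" using e q by simp
    then show False using \<open>q = q'\<close> assms(3) P by simp
  qed
  have eq: "farey_point P - farey_point P' = of_int u / (real q * real q')"
    using q by (simp add: P farey_point_def u_def field_simps)
  have "int b * int q' \<le> int q * int q'" "int b' * int q \<le> int q' * int q"
    using q by (intro mult_right_mono; simp)+
  moreover have "0 < int b * int q'" "0 < int b' * int q" using q by simp_all
  ultimately have "\<bar>u\<bar> < int q * int q'" unfolding u_def by (simp add: mult.commute)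
  then have "\<bar>u\<bar> + 1 \<le> int (q * q')" by simp
  then have "real_of_int (\<bar>u\<bar> + 1) \<le> real_of_int (int (q * q'))" by (simp only: of_int_le_iff)
  then have up: "\<bar>real_of_int u\<bar> + 1 \<le> real q * real q'" by simp
  have "1 \<le> \<bar>u\<bar>" using \<open>u \<noteq> 0\<close> by simp
  then have lo: "1 \<le> \<bar>real_of_int u\<bar>" by (simp flip: of_int_abs)
  show "1 / (real (fst P) * real (fst P')) \<le> \<bar>farey_point P - farey_point P'\<bar>"
    unfolding eq using lo q by (simp add: P abs_mult divide_right_mono)
  have "\<bar>farey_point P - farey_point P'\<bar> + 1 / (real q * real q') = (\<bar>real_of_int u\<bar> + 1) / (real q * real q')"
    unfolding eq using q by (simp add: abs_mult add_divide_distrib)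
  also have "\<dots> \<le> 1" using up q by (simp add: divide_le_eq)
  finally show "\<bar>farey_point P - farey_point P'\<bar> \<le> 1 - 1 / (real (fst P) * real (fst P'))"
    by (simp add: P)
qed

text \<open>Different fractions are at distance at least \<open>1 / M\<^sup>2\<close> modulo 1, so every term off the diagonal is at most
\<open>2 M\<^sup>2\<close>, and there are at most \<open>M\<^sup>2\<close> of them. Nothing is lost once \<open>M ^ 4\<close> is below the length
of the interval.\<close>

lemma farey_gram_small:
  assumes "P \<in> farey a M"
  shows "(\<Sum>P'\<in>farey a M. exp_sum {c..<c + int L} (farey_point P - farey_point P')) \<le> real L + 2 * real M ^ 4"
proof -
  let ?D = "\<lambda>P'. exp_sum {c..<c + int L} (farey_point P - farey_point P')"
  have off: "?D P' \<le> 2 * real M ^ 2" if "P' \<in> farey a M - {P}" for P'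
  proof -
    let ?\<theta> = "farey_point P - farey_point P'"
    let ?r = "real (fst P) * real (fst P')"
    have r: "0 < ?r" using assms that by (auto simp: farey_def)
    have "?r \<le> real M * real M"
      using assms that by (intro mult_mono) (auto simp: farey_def)
    then have rM: "?r \<le> real M ^ 2" by (simp add: power2_eq_square)
    have 1: "1 / ?r \<le> \<bar>?\<theta>\<bar>" "1 / ?r \<le> 1 - \<bar>?\<theta>\<bar>"
      using farey_point_diff[of P a M P'] assms that by auto
    have r1: "0 < 1 / ?r" using r by simp
    have "?D P' \<le> 1 / \<bar>?\<theta>\<bar> + 1 / (1 - \<bar>?\<theta>\<bar>)"
      using 1 r1 by (intro exp_sum_interval_le) linarith+
    also have "\<dots> \<le> 1 / (1 / ?r) + 1 / (1 / ?r)"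
      using 1 r1 by (intro add_mono divide_left_mono mult_pos_pos) linarith+
    also have "\<dots> = 2 * ?r" by simp
    finally show ?thesis using rM by linarith
  qed
  have "(\<Sum>P'\<in>farey a M. ?D P') = ?D P + (\<Sum>P'\<in>farey a M - {P}. ?D P')"
    by (rule sum.remove) (use assms in auto)
  also have "?D P \<le> real L" using exp_sum_le_card[of "{c..<c + int L}" 0] by simp
  also have "(\<Sum>P'\<in>farey a M - {P}. ?D P') \<le> (\<Sum>P'\<in>farey a M - {P}. 2 * real M ^ 2)"
    by (rule sum_mono) (rule off)
  also have "\<dots> = real (card (farey a M - {P})) * (2 * real M ^ 2)" by simp
  also have "\<dots> \<le> real (M ^ 2) * (2 * real M ^ 2)"
    using card_farey_le[of a M] card_Diff1_le[of "farey a M" P]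
    by (intro mult_right_mono of_nat_mono) auto
  also have "\<dots> = 2 * real M ^ 4" by (simp flip: power_add)
  finally show ?thesis by simp
qed

section \<open>The large sieve on dyadic cells\<close>

lemma sum_dist_le:
  fixes G :: "nat \<Rightarrow> real"
  assumes "\<And>l. 0 \<le> G l" "m0 \<le> L"
  shows "(\<Sum>m\<le>L. G ((m - m0) + (m0 - m))) \<le> 2 * (\<Sum>l\<le>L. G l)"
proof -
  have "(\<Sum>m\<le>L. G ((m - m0) + (m0 - m))) =
      (\<Sum>m\<in>{..m0}. G ((m - m0) + (m0 - m))) + (\<Sum>m\<in>{m0<..L}. G ((m - m0) + (m0 - m)))"
    by (subst sum.union_disjoint[symmetric]) (use assms in \<open>auto intro!: sum.cong\<close>)
  also have "(\<Sum>m\<in>{..m0}. G ((m - m0) + (m0 - m))) = (\<Sum>l\<in>{..m0}. G l)"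
    by (rule sum.reindex_bij_witness[of _ "\<lambda>l. m0 - l" "\<lambda>m. m0 - m"]) auto
  also have "\<dots> \<le> (\<Sum>l\<le>L. G l)" using assms by (intro sum_mono2) auto
  also have "(\<Sum>m\<in>{m0<..L}. G ((m - m0) + (m0 - m))) = (\<Sum>l\<in>{0<..L - m0}. G l)"
    by (rule sum.reindex_bij_witness[of _ "\<lambda>l. m0 + l" "\<lambda>m. m - m0"]) auto
  also have "\<dots> \<le> (\<Sum>l\<le>L. G l)" using assms by (intro sum_mono2) auto
  finally show ?thesis by simp
qed

text \<open>Here \<open>M\<close> may be as large as the square root of the length \<open>L\<close>. The fractions are \<open>1 / L\<close>-separated
modulo 1, so they occupy different bins of length \<open>1 / L\<close>, and a fraction \<open>l\<close> bins away contributes at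
most about \<open>L / l + L / (L - l)\<close>. Summing over the bins loses a logarithm, which the weights of the large
denominators absorb.\<close>

lemma farey_gram_log:
  assumes P: "P \<in> farey a M" and M: "(M - 1)\<^sup>2 \<le> L" and L: "0 < L"
  shows "(\<Sum>P'\<in>farey a M. exp_sum {c..<c + int L} (farey_point P - farey_point P')) \<le> 12 * real L * harm (L + 1)"
proof -
  let ?D = "\<lambda>P'. exp_sum {c..<c + int L} (farey_point P - farey_point P')"
  \<comment> \<open>the bin of length \<open>1 / L\<close> that contains the fraction\<close>
  define bin where "bin P' = nat \<lfloor>real L * farey_point P'\<rfloor>" for P'
  define l where "l P' = (bin P' - bin P) + (bin P - bin P')" for P'
  define G where "G k = 3 * real L / (real k + 1) + 3 * real L / (real (L - k) + 1)" for k
  have G0: "0 \<le> G k" for k by (simp add: G_def)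
  have pos01: "0 \<le> farey_point P' \<and> farey_point P' \<le> 1" if "P' \<in> farey a M" for P'
    using that by (auto simp: farey_def farey_point_def in_totatives_iff)
  have bin: "real (bin P') \<le> real L * farey_point P'" "real L * farey_point P' < real (bin P') + 1"
    if "P' \<in> farey a M" for P'
  proof -
    have "real (bin P') = of_int \<lfloor>real L * farey_point P'\<rfloor>" using pos01[OF that] by (simp add: bin_def)
    then show "real (bin P') \<le> real L * farey_point P'" "real L * farey_point P' < real (bin P') + 1"
      by linarith+
  qed
  have bin_le: "bin P' \<le> L" if "P' \<in> farey a M" for P'
  proof -
    have "real L * farey_point P' \<le> real L * 1" using pos01[OF that] by (intro mult_left_mono) auto
    then have "real (bin P') \<le> real L" using bin(1)[OF that] by linarith
    then show ?thesis by simp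
  qed
  have inj: "inj_on bin (farey a M)"
  proof (rule inj_onI, rule ccontr)
    fix x y assume xy: "x \<in> farey a M" "y \<in> farey a M" "bin x = bin y" "x \<noteq> y"
    have "fst x \<le> M - 1" "fst y \<le> M - 1" "0 < fst x" "0 < fst y" using xy by (auto simp: farey_def)
    then have "fst x * fst y \<le> L" using M mult_le_mono[of "fst x" "M - 1" "fst y" "M - 1"]
      by (simp add: power2_eq_square)
    then have "real (fst x) * real (fst y) \<le> real L" by (simp flip: of_nat_mult)
    then have "1 / real L \<le> 1 / (real (fst x) * real (fst y))"
      using \<open>0 < fst x\<close> \<open>0 < fst y\<close> L by (intro divide_left_mono) auto
    also have "\<dots> \<le> \<bar>farey_point x - farey_point y\<bar>" by (rule farey_point_diff(1)[OF xy(1,2,4)])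
    finally have "1 \<le> real L * \<bar>farey_point x - farey_point y\<bar>" using L by (simp add: field_simps)
    also have "\<dots> = \<bar>real L * farey_point x - real L * farey_point y\<bar>"
      by (simp add: right_diff_distrib[symmetric] abs_mult)
    also have "\<dots> < 1" using bin[OF xy(1)] bin[OF xy(2)] xy(3) by linarith
    finally show False by simp
  qed
  have DG: "?D P' \<le> G (l P')" if P': "P' \<in> farey a M" for P'
  proof -
    have DL: "?D P' \<le> real L" using exp_sum_le_card[of "{c..<c + int L}"] by (metis card_atLeastLessThan_int add_diff_cancel_left' nat_int)
    have lL: "l P' \<le> L" using bin_le[OF P] bin_le[OF P'] by (simp add: l_def)
    have lr: "real (l P') = \<bar>real (bin P) - real (bin P')\<bar>"
      by (cases "bin P \<le> bin P'") (auto simp: l_def)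
    consider "l P' \<le> 2" | "L - l P' \<le> 2" | "2 < l P'" "2 < L - l P'" by linarith
    then show ?thesis
    proof cases
      case 1
      have "real L \<le> 3 * real L / (real (l P') + 1)"
        using 1 by (simp add: le_divide_eq) (simp add: mult.commute mult_left_mono)
      then show ?thesis using DL by (simp add: G_def add_increasing2)
    next
      case 2
      then have "real (L - l P') \<le> 2" by simp
      then have "real L \<le> 3 * real L / (real (L - l P') + 1)"
        by (simp add: le_divide_eq) (simp add: mult.commute mult_left_mono)
      then show ?thesis using DL by (simp add: G_def add_increasing)
    next
      case 3
      define th where "th = farey_point P - farey_point P'"
      have "\<bar>real L * farey_point P - real L * farey_point P'\<bar> = real L * \<bar>th\<bar>"
        by (simp add: th_def right_diff_distrib[symmetric] abs_mult)
      then have th: "real (l P') - 1 \<le> real L * \<bar>th\<bar>" "real L * \<bar>th\<bar> \<le> real (l P') + 1"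
        using bin[OF P] bin[OF P'] unfolding lr by linarith+
      have d: "real (L - l P') = real L - real (l P')" using lL by simp
      have l2: "2 < real (l P')" "2 < real (L - l P')" using 3 by simp_all
      have 4: "(real (l P') + 1) / (3 * real L) \<le> \<bar>th\<bar>"
      proof -
        have "real (l P') + 1 \<le> 3 * (real L * \<bar>th\<bar>)" using th(1) l2 by linarith
        then show ?thesis using L by (simp add: divide_le_eq mult_ac)
      qed
      have 5: "(real (L - l P') + 1) / (3 * real L) \<le> 1 - \<bar>th\<bar>"
      proof -
        have "e + 1 \<le> 3 * (real L - x)" if "x \<le> k + 1" "2 < e" "e = real L - k" for e x k
          using that by argo
        from this[OF th(2) l2(2) d] have "real (L - l P') + 1 \<le> 3 * (real L - real L * \<bar>th\<bar>)" .
        then show ?thesis using L by (intro mult_imp_div_pos_le) (auto simp: algebra_simps)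
      qed
      have p4: "0 < (real (l P') + 1) / (3 * real L)" "0 < (real (L - l P') + 1) / (3 * real L)"
        using L by simp_all
      have "?D P' \<le> 1 / \<bar>th\<bar> + 1 / (1 - \<bar>th\<bar>)"
        unfolding th_def[symmetric] using 4 5 p4 by (intro exp_sum_interval_le) linarith+
      also have "\<dots> \<le> 1 / ((real (l P') + 1) / (3 * real L)) + 1 / ((real (L - l P') + 1) / (3 * real L))"
        using 4 5 p4 by (intro add_mono divide_left_mono mult_pos_pos) linarith+
      also have "\<dots> = G (l P')" by (simp add: G_def)
      finally show ?thesis .
    qed
  qed
  have "(\<Sum>P'\<in>farey a M. ?D P') \<le> (\<Sum>P'\<in>farey a M. G (l P'))" by (rule sum_mono) (rule DG)
  also have "\<dots> = (\<Sum>m\<in>bin ` farey a M. G ((m - bin P) + (bin P - m)))"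
    by (simp add: sum.reindex[OF inj] l_def o_def)
  also have "\<dots> \<le> (\<Sum>m\<le>L. G ((m - bin P) + (bin P - m)))"
    using bin_le G0 by (intro sum_mono2) auto
  also have "\<dots> \<le> 2 * (\<Sum>k\<le>L. G k)" by (rule sum_dist_le[OF G0 bin_le[OF P]])
  also have "(\<Sum>k\<le>L. G k) = 3 * real L * (\<Sum>k\<le>L. 1 / (real k + 1)) + 3 * real L * (\<Sum>k\<le>L. 1 / (real (L - k) + 1))"
    by (simp add: G_def sum.distrib sum_distrib_left)
  also have "(\<Sum>k\<le>L. 1 / (real (L - k) + 1)) = (\<Sum>k\<le>L. 1 / (real k + 1))"
    by (rule sum.reindex_bij_witness[of _ "\<lambda>k. L - k" "\<lambda>k. L - k"]) auto
  also have "(\<Sum>k\<le>L. 1 / (real k + 1)) = harm (L + 1)"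
    unfolding harm_altdef by (simp add: lessThan_Suc_atMost inverse_eq_divide add.commute)
  finally show ?thesis by simp
qed

text \<open>Written out, this is the trigonometric polynomial with coefficient \<open>w q\<close> at every reduced fraction
\<open>b / q\<close> with \<open>a \<le> q < M\<close>.\<close>

definition freq_kernel :: "(nat \<Rightarrow> real) \<Rightarrow> nat \<Rightarrow> nat \<Rightarrow> int \<Rightarrow> complex" where
  "freq_kernel w a M n = (\<Sum>q | 0 < q \<and> a \<le> q \<and> q < M. of_real (w q) * ramanujan q n)"

definition cell_op :: "int \<Rightarrow> nat \<Rightarrow> (int \<Rightarrow> complex) \<Rightarrow> (int \<Rightarrow> complex) \<Rightarrow> int \<Rightarrow> complex" where
  "cell_op t j H f x = (\<Sum>y\<in>cell t j x. H (y - x) * f y) / 2 ^ j"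

lemma cell_op_add: "cell_op t j (\<lambda>n. H n + H' n) f x = cell_op t j H f x + cell_op t j H' f x"
  by (simp add: cell_op_def sum.distrib distrib_right add_divide_distrib)

lemma freq_kernel_l2:
  assumes w: "\<And>q. 0 < q \<Longrightarrow> a \<le> q \<Longrightarrow> q < M \<Longrightarrow> \<bar>w q\<bar> \<le> W"
    and X: "\<And>P. P \<in> farey a M \<Longrightarrow> (\<Sum>P'\<in>farey a M. exp_sum X (farey_point P - farey_point P')) \<le> \<Delta>" "0 \<le> \<Delta>"
    and Y: "\<And>P. P \<in> farey a M \<Longrightarrow> (\<Sum>P'\<in>farey a M. exp_sum Y (farey_point P - farey_point P')) \<le> \<Delta>'" "0 \<le> \<Delta>'"
  shows "(\<Sum>x\<in>X. (norm (\<Sum>y\<in>Y. freq_kernel w a M (y - x) * f y))\<^sup>2)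
    \<le> W\<^sup>2 * \<Delta> * \<Delta>' * (\<Sum>y\<in>Y. (norm (f y))\<^sup>2)"
proof -
  have "\<bar>w (fst P)\<bar> \<le> W" if "P \<in> farey a M" for P
    using that by (intro w) (auto simp: farey_def)
  from frequency_operator_bound[where pos = farey_point and w = "\<lambda>P. w (fst P)" and P = "farey a M" and f = f, OF X Y this]
  show ?thesis by (simp only: sum_farey freq_kernel_def)
qed

lemma cell_gram_small:
  assumes "P \<in> farey a M" "M ^ 4 \<le> 2 ^ j"
  shows "(\<Sum>P'\<in>farey a M. exp_sum (cell t j z) (farey_point P - farey_point P')) \<le> 3 * 2 ^ j"
proof -
  have "real (M ^ 4) \<le> real (2 ^ j)" using assms(2) by (rule of_nat_mono)
  then have "real M ^ 4 \<le> 2 ^ j" by simp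
  then show ?thesis
    using farey_gram_small[OF assms(1), where c = "t + 2 ^ j * ((z - t) div 2 ^ j)" and L = "2 ^ j"]
    by (simp add: cell_interval)
qed

lemma cell_gram_log:
  assumes "P \<in> farey a M" "(M - 1)\<^sup>2 \<le> 2 ^ j"
  shows "(\<Sum>P'\<in>farey a M. exp_sum (cell t j z) (farey_point P - farey_point P')) \<le> 12 * 2 ^ j * (real j + 2)"
proof -
  have "(1::nat) \<le> 2 ^ j" by simp
  then have "harm (2 ^ j + 1) \<le> (harm (2 ^ (j + 1)) :: real)" by (intro harm_mono) simp
  also have "\<dots> \<le> real (j + 1) + 1" by (rule harm_pow2_le)
  finally have h: "12 * 2 ^ j * harm (2 ^ j + 1) \<le> 12 * 2 ^ j * (real j + 2)"
    by (intro mult_left_mono) auto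
  have "(\<Sum>P'\<in>farey a M. exp_sum (cell t j z) (farey_point P - farey_point P')) \<le> 12 * 2 ^ j * harm (2 ^ j + 1)"
    using farey_gram_log[OF assms(1), where c = "t + 2 ^ j * ((z - t) div 2 ^ j)" and L = "2 ^ j"] assms(2)
    by (simp add: cell_interval)
  then show ?thesis using h by (rule order_trans)
qed

lemma cell_op_l2_cells:
  assumes W: "\<And>q. 0 < q \<Longrightarrow> a \<le> q \<Longrightarrow> q < M \<Longrightarrow> \<bar>w q\<bar> \<le> W"
    and \<Delta>: "\<And>P z. P \<in> farey a M \<Longrightarrow> (\<Sum>P'\<in>farey a M. exp_sum (cell t j z) (farey_point P - farey_point P')) \<le> \<Delta> * 2 ^ j" "0 \<le> \<Delta>"
    and "j \<le> m"
  shows "(\<Sum>x\<in>cell t m z. (norm (cell_op t j (freq_kernel w a M) f x))\<^sup>2) \<le> (W * \<Delta>)\<^sup>2 * (\<Sum>x\<in>cell t m z. (norm (f x))\<^sup>2)"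
  unfolding sum_distrib_left
proof (rule sum_cells_mono[OF \<open>j \<le> m\<close>])
  fix z
  have "(\<Sum>x\<in>cell t j z. (norm (cell_op t j (freq_kernel w a M) f x))\<^sup>2) =
      (\<Sum>x\<in>cell t j z. (norm (\<Sum>y\<in>cell t j z. freq_kernel w a M (y - x) * f y))\<^sup>2) / (2 ^ j)\<^sup>2"
    unfolding sum_divide_distrib
    by (intro sum.cong refl) (simp add: cell_op_def cell_eq norm_divide norm_power power_divide)
  also have "\<dots> \<le> (W\<^sup>2 * (\<Delta> * 2 ^ j) * (\<Delta> * 2 ^ j) * (\<Sum>y\<in>cell t j z. (norm (f y))\<^sup>2)) / (2 ^ j)\<^sup>2"
    using \<Delta> by (intro divide_right_mono freq_kernel_l2 W) auto
  also have "\<dots> = (W * \<Delta>)\<^sup>2 * (\<Sum>y\<in>cell t j z. (norm (f y))\<^sup>2)"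
    by (simp add: power2_eq_square)
  finally show "(\<Sum>x\<in>cell t j z. (norm (cell_op t j (freq_kernel w a M) f x))\<^sup>2) \<le>
      (\<Sum>x\<in>cell t j z. (W * \<Delta>)\<^sup>2 * (norm (f x))\<^sup>2)"
    by (simp only: sum_distrib_left)
qed

lemma cell_op_l2_small:
  assumes "\<And>q. 0 < q \<Longrightarrow> a \<le> q \<Longrightarrow> q < M \<Longrightarrow> \<bar>w q\<bar> \<le> W" "M ^ 4 \<le> 2 ^ j" "j \<le> m"
  shows "(\<Sum>x\<in>cell t m z. (norm (cell_op t j (freq_kernel w a M) f x))\<^sup>2) \<le> (W * 3)\<^sup>2 * (\<Sum>x\<in>cell t m z. (norm (f x))\<^sup>2)"
  using assms by (intro cell_op_l2_cells cell_gram_small) auto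

lemma cell_op_l2_log:
  assumes "\<And>q. 0 < q \<Longrightarrow> a \<le> q \<Longrightarrow> q < M \<Longrightarrow> \<bar>w q\<bar> \<le> W" "(M - 1)\<^sup>2 \<le> 2 ^ j" "j \<le> m"
  shows "(\<Sum>x\<in>cell t m z. (norm (cell_op t j (freq_kernel w a M) f x))\<^sup>2) \<le>
    (W * (12 * (real j + 2)))\<^sup>2 * (\<Sum>x\<in>cell t m z. (norm (f x))\<^sup>2)"
proof (rule cell_op_l2_cells)
  fix P z assume "P \<in> farey a M"
  from cell_gram_log[OF this assms(2), of t z]
  show "(\<Sum>P'\<in>farey a M. exp_sum (cell t j z) (farey_point P - farey_point P')) \<le> 12 * (real j + 2) * 2 ^ j"
    by (simp add: algebra_simps)
qed (use assms in auto)

section \<open>Maximal operators with periodic kernels\<close>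

lemma sum_cell_avg:
  fixes \<phi> :: "int \<Rightarrow> 'a::real_normed_field"
  assumes "j \<le> m"
  shows "(\<Sum>y\<in>cell t m z. cell_avg t j \<phi> y) = (\<Sum>y\<in>cell t m z. \<phi> y)"
proof -
  let ?I = "cell t m z"
  have sub: "cell t j y \<subseteq> ?I" if "y \<in> ?I" for y
    using cell_mono[OF assms, of t y] cell_eq[OF that] by simp
  have "(\<Sum>y\<in>?I. cell_avg t j \<phi> y) = (\<Sum>y\<in>?I. \<Sum>y'\<in>?I. if y' \<in> cell t j y then \<phi> y' / 2 ^ j else 0)"
  proof (rule sum.cong[OF refl])
    fix y assume "y \<in> ?I"
    then have "?I \<inter> cell t j y = cell t j y" using sub by blast
    then show "cell_avg t j \<phi> y = (\<Sum>y'\<in>?I. if y' \<in> cell t j y then \<phi> y' / 2 ^ j else 0)"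
      by (simp add: sum.inter_restrict[symmetric] cell_avg_def sum_divide_distrib)
  qed
  also have "\<dots> = (\<Sum>y'\<in>?I. \<Sum>y\<in>?I. if y' \<in> cell t j y then \<phi> y' / 2 ^ j else 0)"
    by (rule sum.swap)
  also have "\<dots> = (\<Sum>y'\<in>?I. \<phi> y')"
  proof (rule sum.cong[OF refl])
    fix y' assume "y' \<in> ?I"
    then have e: "?I \<inter> cell t j y' = cell t j y'" using sub by blast
    have "(\<Sum>y\<in>?I. if y' \<in> cell t j y then \<phi> y' / 2 ^ j else 0) =
        (\<Sum>y\<in>?I. if y \<in> cell t j y' then \<phi> y' / 2 ^ j else 0)"
      by (intro sum.cong refl) (auto simp: mem_cell)
    also have "\<dots> = \<phi> y'"
      unfolding sum.inter_restrict[OF finite_cell, symmetric] e by simp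
    finally show "(\<Sum>y\<in>?I. if y' \<in> cell t j y then \<phi> y' / 2 ^ j else 0) = \<phi> y'" .
  qed
  finally show ?thesis .
qed

lemma cell_avg_tower:
  fixes \<phi> :: "int \<Rightarrow> 'a::real_normed_field"
  shows "j \<le> m \<Longrightarrow> cell_avg t m (cell_avg t j \<phi>) z = cell_avg t m \<phi> z"
  unfolding cell_avg_def[of t m] by (simp add: sum_cell_avg)

lemma norm_cell_avg_le: "norm (cell_avg t j \<phi> x) \<le> cell_avg t j (\<lambda>y. norm (\<phi> y)) x"
  unfolding cell_avg_def by (simp add: norm_divide norm_power divide_right_mono norm_sum)

lemma cell_op_eq_avg: "cell_op t j H f x = cell_avg t j (\<lambda>y. H (y - x) * f y) x"
  by (simp add: cell_op_def cell_avg_def)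

text \<open>A period \<open>\<Lambda>\<close> of \<open>H\<close> is no longer than the cells of level \<open>J\<close>. For \<open>x\<close> in the class \<open>u\<close>
modulo \<open>\<Lambda>\<close> the kernel may be frozen at \<open>u\<close>, and the average at any level above \<open>J\<close> is an
average of the averages \<open>\<phi> u\<close> at level \<open>J\<close>. Doob's inequality for each \<open>u\<close> bounds the maximal
function \<open>\<Phi> u\<close>. Since \<open>\<Phi> u\<close> is constant on cells of level \<open>J\<close>, its square sum over one residue
class is about \<open>1 / \<Lambda>\<close> of its square sum over all points, and the sum over \<open>u\<close> of the square sums of
\<open>\<phi> u\<close> is the single-scale hypothesis.\<close>

lemma periodic_maximal_l2:
  fixes H f :: "int \<Rightarrow> complex"
  assumes per: "\<And>n. H n = H (n mod int \<Lambda>)" and \<Lambda>: "0 < \<Lambda>" "\<Lambda> \<le> 2 ^ J"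
    and block: "\<And>z. (\<Sum>u\<in>{0..<int \<Lambda>}. (norm (\<Sum>y\<in>cell t J z. H (y - u) * f y))\<^sup>2)
      \<le> B * real \<Lambda> * 2 ^ J * (\<Sum>y\<in>cell t J z. (norm (f y))\<^sup>2)"
    and B: "0 \<le> B" and X: "X \<subseteq> cell t m z" and jx: "\<And>x. x \<in> X \<Longrightarrow> J \<le> jx x \<and> jx x \<le> m"
  shows "(\<Sum>x\<in>X. (norm (cell_op t (jx x) H f x))\<^sup>2) \<le> 8 * B * (\<Sum>y\<in>cell t m z. (norm (f y))\<^sup>2)"
proof (cases "X = {}")
  case True
  then show ?thesis using B by (simp add: sum_nonneg)
next
  case False
  then have Jm: "J \<le> m" using jx by force
  let ?I = "cell t m z"
  define \<phi> where "\<phi> u y = norm (cell_avg t J (\<lambda>y. H (y - u) * f y) y)" for u y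
  define \<Phi> where "\<Phi> u y = Max ((\<lambda>j. cell_avg t j (\<phi> u) y) ` {J..m})" for u y
  have \<phi>0: "0 \<le> \<phi> u y" for u y by (simp add: \<phi>_def)
  have \<Phi>_ge: "cell_avg t j (\<phi> u) y \<le> \<Phi> u y" if "J \<le> j" "j \<le> m" for j u y
    unfolding \<Phi>_def by (rule Max_ge) (use that in auto)
  have \<Phi>_at: "\<exists>j. j \<le> m \<and> \<Phi> u y = cell_avg t j (\<phi> u) y" for u y
  proof -
    have "\<Phi> u y \<in> (\<lambda>j. cell_avg t j (\<phi> u) y) ` {J..m}"
      unfolding \<Phi>_def by (rule Max_in) (use Jm in auto)
    then show ?thesis by auto
  qed
  have \<Phi>_const: "\<Phi> u y = \<Phi> u y'" if "y \<in> cell t J y'" for u y y'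
  proof -
    have "cell_avg t j (\<phi> u) y = cell_avg t j (\<phi> u) y'" if "j \<in> {J..m}" for j
      by (rule cell_avg_const_on_cell) (use cell_mono[of J j t y'] that \<open>y \<in> cell t J y'\<close> in auto)
    then show ?thesis unfolding \<Phi>_def by (intro arg_cong[of _ _ Max] image_cong) auto
  qed
  have pt: "norm (cell_op t (jx x) H f x) \<le> \<Phi> (x mod int \<Lambda>) x" if "x \<in> X" for x
  proof -
    let ?u = "x mod int \<Lambda>"
    have "H (y - x) = H (y - ?u)" for y
      by (subst (1 2) per) (simp add: mod_diff_right_eq)
    then have "cell_op t (jx x) H f x = cell_avg t (jx x) (\<lambda>y. H (y - ?u) * f y) x" by (simp add: cell_op_eq_avg)
    also have "\<dots> = cell_avg t (jx x) (cell_avg t J (\<lambda>y. H (y - ?u) * f y)) x"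
      using jx[OF that] by (simp add: cell_avg_tower)
    finally have "norm (cell_op t (jx x) H f x) \<le> cell_avg t (jx x) (\<phi> ?u) x"
      unfolding \<phi>_def by (simp add: norm_cell_avg_le)
    also have "\<dots> \<le> \<Phi> ?u x" using jx[OF that] by (intro \<Phi>_ge) auto
    finally show ?thesis .
  qed
  have cnt: "(\<Sum>x\<in>?I. if x mod int \<Lambda> = u then (\<Phi> u x)\<^sup>2 else 0) \<le> (\<Sum>x\<in>?I. 2 / real \<Lambda> * (\<Phi> u x)\<^sup>2)"
    if u: "u \<in> {0..<int \<Lambda>}" for u
  proof (rule sum_cells_mono[OF Jm])
    fix v
    have "(\<Sum>x\<in>cell t J v. if x mod int \<Lambda> = u then (\<Phi> u x)\<^sup>2 else 0) =
        (\<Sum>x\<in>cell t J v. if int \<Lambda> dvd x - u then (\<Phi> u v)\<^sup>2 else 0)"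
    proof (rule sum.cong[OF refl])
      fix x assume "x \<in> cell t J v"
      have "x mod int \<Lambda> = u \<longleftrightarrow> int \<Lambda> dvd x - u"
        using u by (metis mod_eq_dvd_iff atLeastLessThan_iff mod_pos_pos_trivial)
      then show "(if x mod int \<Lambda> = u then (\<Phi> u x)\<^sup>2 else 0) = (if int \<Lambda> dvd x - u then (\<Phi> u v)\<^sup>2 else 0)"
        using \<Phi>_const[OF \<open>x \<in> cell t J v\<close>] by simp
    qed
    also have "\<dots> = real (card {x \<in> cell t J v. int \<Lambda> dvd x - u}) * (\<Phi> u v)\<^sup>2"
      by (subst sum.inter_filter[symmetric]) simp_all
    also have "\<dots> \<le> (2 * 2 ^ J / real \<Lambda>) * (\<Phi> u v)\<^sup>2"
    proof (rule mult_right_mono)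
      have "real \<Lambda> \<le> real (2 ^ J)" using \<Lambda>(2) by (rule of_nat_mono)
      then have "1 \<le> 2 ^ J / real \<Lambda>" using \<Lambda>(1) by simp
      then show "real (card {x \<in> cell t J v. int \<Lambda> dvd x - u}) \<le> 2 * 2 ^ J / real \<Lambda>"
        using card_dvd_cell_le[OF \<Lambda>(1), of t J v u] by simp
    qed simp
    also have "\<dots> = (\<Sum>x\<in>cell t J v. 2 / real \<Lambda> * (\<Phi> u v)\<^sup>2)" by simp
    also have "\<dots> = (\<Sum>x\<in>cell t J v. 2 / real \<Lambda> * (\<Phi> u x)\<^sup>2)"
      by (rule sum.cong[OF refl]) (simp add: \<Phi>_const)
    finally show "(\<Sum>x\<in>cell t J v. if x mod int \<Lambda> = u then (\<Phi> u x)\<^sup>2 else 0) \<le>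
        (\<Sum>x\<in>cell t J v. 2 / real \<Lambda> * (\<Phi> u x)\<^sup>2)" .
  qed
  have doob: "(\<Sum>x\<in>?I. (\<Phi> u x)\<^sup>2) \<le> 4 * (\<Sum>x\<in>?I. (\<phi> u x)\<^sup>2)" for u
  proof -
    from \<Phi>_at obtain k where k: "\<And>y. k y \<le> m" "\<And>y. \<Phi> u y = cell_avg t (k y) (\<phi> u) y" by metis
    show ?thesis unfolding k(2) by (rule doob_maximal) (use k(1) \<phi>0 in auto)
  qed
  have sq: "(\<Sum>u\<in>{0..<int \<Lambda>}. (\<phi> u y)\<^sup>2) \<le> B * real \<Lambda> * cell_avg t J (\<lambda>y. (norm (f y))\<^sup>2) y" for y
  proof -
    have "(\<Sum>u\<in>{0..<int \<Lambda>}. (\<phi> u y)\<^sup>2) =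
        (\<Sum>u\<in>{0..<int \<Lambda>}. (norm (\<Sum>y\<in>cell t J y. H (y - u) * f y))\<^sup>2) / (2 ^ J)\<^sup>2"
    proof -
      have "(\<phi> u y)\<^sup>2 = (norm (\<Sum>y\<in>cell t J y. H (y - u) * f y))\<^sup>2 / (2 ^ J)\<^sup>2" for u
        by (simp add: \<phi>_def cell_avg_def norm_divide norm_power power_divide)
      then show ?thesis by (simp only: sum_divide_distrib)
    qed
    also have "\<dots> \<le> B * real \<Lambda> * 2 ^ J * (\<Sum>y\<in>cell t J y. (norm (f y))\<^sup>2) / (2 ^ J)\<^sup>2"
      by (rule divide_right_mono[OF block]) simp
    also have "\<dots> = B * real \<Lambda> * cell_avg t J (\<lambda>y. (norm (f y))\<^sup>2) y"
      by (simp add: cell_avg_def power2_eq_square)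
    finally show ?thesis .
  qed
  have "(\<Sum>x\<in>X. (norm (cell_op t (jx x) H f x))\<^sup>2) \<le> (\<Sum>x\<in>X. (\<Phi> (x mod int \<Lambda>) x)\<^sup>2)"
    by (intro sum_mono power_mono pt) auto
  also have "\<dots> \<le> (\<Sum>x\<in>?I. (\<Phi> (x mod int \<Lambda>) x)\<^sup>2)"
    using X by (intro sum_mono2) auto
  also have "\<dots> = (\<Sum>x\<in>?I. \<Sum>u\<in>{0..<int \<Lambda>}. if x mod int \<Lambda> = u then (\<Phi> u x)\<^sup>2 else 0)"
  proof (rule sum.cong[OF refl])
    fix x
    have "x mod int \<Lambda> \<in> {0..<int \<Lambda>}" using \<Lambda>(1) by simp
    then show "(\<Phi> (x mod int \<Lambda>) x)\<^sup>2 = (\<Sum>u\<in>{0..<int \<Lambda>}. if x mod int \<Lambda> = u then (\<Phi> u x)\<^sup>2 else 0)"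
      by (subst sum.delta') auto
  qed
  also have "\<dots> = (\<Sum>u\<in>{0..<int \<Lambda>}. \<Sum>x\<in>?I. if x mod int \<Lambda> = u then (\<Phi> u x)\<^sup>2 else 0)"
    by (rule sum.swap)
  also have "\<dots> \<le> (\<Sum>u\<in>{0..<int \<Lambda>}. \<Sum>x\<in>?I. 2 / real \<Lambda> * (\<Phi> u x)\<^sup>2)"
    by (rule sum_mono) (rule cnt)
  also have "\<dots> \<le> (\<Sum>u\<in>{0..<int \<Lambda>}. 2 / real \<Lambda> * (4 * (\<Sum>x\<in>?I. (\<phi> u x)\<^sup>2)))"
  proof (rule sum_mono)
    fix u
    have "2 / real \<Lambda> * (\<Sum>x\<in>?I. (\<Phi> u x)\<^sup>2) \<le> 2 / real \<Lambda> * (4 * (\<Sum>x\<in>?I. (\<phi> u x)\<^sup>2))"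
      by (rule mult_left_mono[OF doob]) simp
    then show "(\<Sum>x\<in>?I. 2 / real \<Lambda> * (\<Phi> u x)\<^sup>2) \<le> 2 / real \<Lambda> * (4 * (\<Sum>x\<in>?I. (\<phi> u x)\<^sup>2))"
      by (simp only: sum_distrib_left)
  qed
  also have "\<dots> = 8 / real \<Lambda> * (\<Sum>x\<in>?I. \<Sum>u\<in>{0..<int \<Lambda>}. (\<phi> u x)\<^sup>2)"
    by (subst sum.swap) (simp add: sum_distrib_left)
  also have "\<dots> \<le> 8 / real \<Lambda> * (\<Sum>x\<in>?I. B * real \<Lambda> * cell_avg t J (\<lambda>y. (norm (f y))\<^sup>2) x)"
    by (intro mult_left_mono sum_mono sq) auto
  also have "\<dots> = 8 * B * (\<Sum>x\<in>?I. (norm (f x))\<^sup>2)"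
    using \<Lambda>(1) by (simp add: sum_distrib_left[symmetric] sum_cell_avg[OF Jm])
  finally show ?thesis .
qed

text \<open>For finitely many scales a maximal operator is dominated by its square function.\<close>

lemma selector_square_sum:
  fixes \<phi> :: "nat \<Rightarrow> int \<Rightarrow> real"
  assumes "X \<subseteq> I" "finite I" "finite Js" "\<And>x. x \<in> X \<Longrightarrow> jx x \<in> Js" "\<And>j x. 0 \<le> \<phi> j x"
  shows "(\<Sum>x\<in>X. \<phi> (jx x) x) \<le> (\<Sum>j\<in>Js. \<Sum>x\<in>I. \<phi> j x)"
proof -
  have "(\<Sum>x\<in>X. \<phi> (jx x) x) \<le> (\<Sum>x\<in>X. \<Sum>j\<in>Js. \<phi> j x)"
    using assms by (intro sum_mono member_le_sum) auto
  also have "\<dots> \<le> (\<Sum>x\<in>I. \<Sum>j\<in>Js. \<phi> j x)"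
    using assms by (intro sum_mono2 sum_nonneg) auto
  finally show ?thesis by (subst sum.swap)
qed

lemma sum_inverse_squares_le: "(\<Sum>j\<in>{1..m}. 1 / (real j)\<^sup>2) \<le> 2"
proof -
  have "(\<Sum>j\<in>{1..Suc m}. 1 / (real j)\<^sup>2) \<le> 2 - 1 / real (Suc m)" for m
  proof (induction m)
    case (Suc m)
    have "1 / (real (Suc (Suc m)))\<^sup>2 \<le> 1 / (real (Suc m) * real (Suc (Suc m)))"
      by (intro divide_left_mono) (auto simp: power2_eq_square intro: mult_right_mono)
    also have "\<dots> = 1 / real (Suc m) - 1 / real (Suc (Suc m))" by (simp add: field_simps)
    finally show ?case using Suc by simp
  qed simp
  from this[of m] have "(\<Sum>j\<in>{1..Suc m}. 1 / (real j)\<^sup>2) \<le> 2" by (simp add: order_trans)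
  moreover have "(\<Sum>j\<in>{1..m}. 1 / (real j)\<^sup>2) \<le> (\<Sum>j\<in>{1..Suc m}. 1 / (real j)\<^sup>2)"
    by (intro sum_mono2) auto
  ultimately show ?thesis by linarith
qed

lemma norm_add_sq_le: "(norm (a + b :: complex))\<^sup>2 \<le> 2 * (norm a)\<^sup>2 + 2 * (norm b)\<^sup>2"
proof -
  have "(norm (a + b))\<^sup>2 \<le> (norm a + norm b)\<^sup>2" by (intro power_mono norm_triangle_ineq) simp
  also have "\<dots> \<le> 2 * (norm a)\<^sup>2 + 2 * (norm b)\<^sup>2"
    using sum_squares_bound[of "norm a" "norm b"] by (simp add: power2_sum)
  finally show ?thesis .
qed

section \<open>The divisor kernel and its frequency bands\<close>

definition divisor_cutoff :: "nat \<Rightarrow> nat" where "divisor_cutoff j = 2 ^ (j div 2)"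

text \<open>Each \<open>k \<le> K = divisor_cutoff j\<close> contributes \<open>1 / k\<close> to the weight of every denominator \<open>q\<close>
dividing it, which adds up to \<open>harm (K div q) / q\<close>; the factor \<open>1 / q\<close> is split off.\<close>

definition freq_coef :: "nat \<Rightarrow> nat \<Rightarrow> real" where
  "freq_coef j q = harm (divisor_cutoff j div q) / real j"

definition freq_weight :: "nat \<Rightarrow> nat \<Rightarrow> real" where
  "freq_weight j q = freq_coef j q / real q"

text \<open>The divisor count truncated at \<open>divisor_cutoff j\<close>, normalised by \<open>j\<close> so that its mean is of order 1.\<close>

definition divisor_kernel :: "nat \<Rightarrow> int \<Rightarrow> real" where
  "divisor_kernel j n = real (card {k \<in> {1..divisor_cutoff j}. int k dvd n}) / real j"

definition band :: "nat \<Rightarrow> nat \<Rightarrow> int \<Rightarrow> complex" where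
  "band j i = freq_kernel (freq_weight j) (2 ^ i) (2 ^ (i + 1))"

text \<open>The kernel is to be used without its value at 0, which is of size \<open>2 ^ (j / 2) / j\<close> and would ruin the
moments. That value is therefore subtracted here; the bands are left untouched.\<close>

definition tail :: "nat \<Rightarrow> nat \<Rightarrow> int \<Rightarrow> complex" where
  "tail c j n = freq_kernel (freq_weight j) (2 ^ (j div c)) (divisor_cutoff j + 1) n - (if n = 0 then of_real (divisor_kernel j 0) else 0)"

lemma sum_multiples_inverse:
  assumes "0 < q"
  shows "(\<Sum>k\<in>{1..K}. if q dvd k then 1 / real k else 0) = harm (K div q) / real q"
proof -
  have "(\<Sum>k\<in>{1..K}. if q dvd k then 1 / real k else 0) = (\<Sum>k\<in>{k \<in> {1..K}. q dvd k}. 1 / real k)"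
    by (rule sum.inter_filter[symmetric]) simp
  also have "\<dots> = (\<Sum>m\<in>{1..K div q}. 1 / (real m * real q))"
    using assms
    by (intro sum.reindex_bij_witness[of _ "\<lambda>m. m * q" "\<lambda>k. k div q"])
       (auto elim!: dvdE simp: less_eq_div_iff_mult_less_eq Suc_le_eq mult.commute)
  also have "\<dots> = harm (K div q) / real q"
    by (simp add: harm_def sum_divide_distrib inverse_eq_divide)
  finally show ?thesis .
qed

lemma divisor_kernel_eq_freq: "of_real (divisor_kernel j n) = freq_kernel (freq_weight j) 1 (divisor_cutoff j + 1) n"
proof -
  let ?K = "divisor_cutoff j"
  have "of_nat (card {k \<in> {1..?K}. int k dvd n}) = (\<Sum>k\<in>{1..?K}. if int k dvd n then 1 else (0::complex))"
    by (subst sum.inter_filter[symmetric]) simp_all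
  also have "\<dots> = (\<Sum>k\<in>{1..?K}. \<Sum>q\<in>{1..?K}. of_real (if q dvd k then 1 / real k else 0) * ramanujan q n)"
  proof (rule sum.cong[OF refl])
    fix k assume k: "k \<in> {1..?K}"
    have "(if int k dvd n then 1 else 0) = of_real (1 / real k) * (if int k dvd n then of_nat k else (0::complex))"
      using k by simp
    also have "\<dots> = of_real (1 / real k) * (\<Sum>q | q dvd k. ramanujan q n)"
      using k by (subst sum_ramanujan_divisors) auto
    also have "{q. q dvd k} = {q \<in> {1..?K}. q dvd k}"
      using k by (auto dest: dvd_imp_le intro: Suc_leI dvd_pos_nat)
    also have "of_real (1 / real k) * (\<Sum>q\<in>{q \<in> {1..?K}. q dvd k}. ramanujan q n) =
        (\<Sum>q\<in>{1..?K}. of_real (if q dvd k then 1 / real k else 0) * ramanujan q n)"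
      unfolding sum.inter_filter[OF finite_atLeastAtMost] sum_distrib_left by (intro sum.cong refl) auto
    finally show "(if int k dvd n then 1 else 0) =
        (\<Sum>q\<in>{1..?K}. of_real (if q dvd k then 1 / real k else 0) * ramanujan q n)" .
  qed
  also have "\<dots> = (\<Sum>q\<in>{1..?K}. of_real (\<Sum>k\<in>{1..?K}. if q dvd k then 1 / real k else 0) * ramanujan q n)"
    by (subst sum.swap) (simp add: sum_distrib_right)
  also have "\<dots> = (\<Sum>q\<in>{1..?K}. of_real (harm (?K div q) / real q) * ramanujan q n)"
    by (intro sum.cong refl) (subst sum_multiples_inverse, auto)
  finally have "of_real (divisor_kernel j n) = (\<Sum>q\<in>{1..?K}. of_real (harm (?K div q) / real q) * ramanujan q n) / of_nat j"
    by (simp add: divisor_kernel_def)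
  also have "\<dots> = (\<Sum>q\<in>{1..?K}. of_real (freq_weight j q) * ramanujan q n)"
    by (simp add: sum_divide_distrib freq_weight_def freq_coef_def mult.commute)
  also have "{1..?K} = {q. 0 < q \<and> 1 \<le> q \<and> q < ?K + 1}" by auto
  finally show ?thesis by (simp add: freq_kernel_def)
qed

lemma freq_kernel_split:
  assumes "a \<le> b" "b \<le> M"
  shows "freq_kernel w a M n = freq_kernel w a b n + freq_kernel w b M n"
  unfolding freq_kernel_def
  by (subst sum.union_disjoint[symmetric]) (use assms in \<open>auto intro!: sum.cong\<close>)

lemma sum_bands: "(\<Sum>i<k. band j i n) = freq_kernel (freq_weight j) 1 (2 ^ k) n"
proof (induction k)
  case 0
  have "{q::nat. 0 < q \<and> 1 \<le> q \<and> q < 1} = {}" by auto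
  then show ?case by (simp only: freq_kernel_def lessThan_0 sum.empty power_0)
next
  case (Suc k)
  then show ?case
    using freq_kernel_split[of 1 "2 ^ k" "2 ^ Suc k" "freq_weight j" n] by (simp add: band_def)
qed

lemma divisor_kernel_decomposition:
  assumes "2 \<le> c"
  shows "of_real (if n = 0 then 0 else divisor_kernel j n) = (\<Sum>i<j div c. band j i n) + tail c j n"
proof -
  have "j div c \<le> j div 2" using assms by (intro div_le_mono2) auto
  then have "(2::nat) ^ (j div c) \<le> divisor_cutoff j" by (simp add: divisor_cutoff_def)
  then have "of_real (divisor_kernel j n) = (\<Sum>i<j div c. band j i n) + freq_kernel (freq_weight j) (2 ^ (j div c)) (divisor_cutoff j + 1) n"
    unfolding divisor_kernel_eq_freq sum_bands by (intro freq_kernel_split) auto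
  then show ?thesis by (cases "n = 0") (simp_all add: tail_def)
qed

lemma freq_coef_nonneg [simp]: "0 \<le> freq_coef j q"
  by (simp add: freq_coef_def harm_nonneg)

lemma freq_coef_le_1: "freq_coef j q \<le> 1"
proof (cases "j = 0")
  case False
  have "harm (divisor_cutoff j div q) \<le> (harm (divisor_cutoff j) :: real)" by (intro harm_mono) simp
  also have "\<dots> \<le> real (j div 2) + 1" unfolding divisor_cutoff_def by (rule harm_pow2_le)
  also have "\<dots> = real (j div 2 + 1)" by simp
  also have "\<dots> \<le> real j" using False by (intro of_nat_mono) linarith
  finally show ?thesis using False by (simp add: freq_coef_def)
qed (simp add: freq_coef_def)

text \<open>The difference of the two harmonic numbers has at most \<open>K / Q\<close> terms, each at most \<open>q / K\<close>. Hence within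
a band the coefficient is constant up to an error that is square summable in \<open>j\<close>.\<close>

lemma freq_coef_diff_le:
  assumes "0 < Q" "Q \<le> q" "q < 2 * Q" "0 < j"
  shows "\<bar>freq_coef j q - freq_coef j Q\<bar> \<le> 2 / real j"
proof -
  let ?K = "divisor_cutoff j"
  have K: "0 < ?K" by (simp add: divisor_cutoff_def)
  have le: "?K div q \<le> ?K div Q" using assms by (intro div_le_mono2) auto
  have "harm (?K div Q) = harm (?K div q) + (\<Sum>m\<in>{?K div q<..?K div Q}. inverse (real m))"
    unfolding harm_def by (subst sum.union_disjoint[symmetric]) (use le in \<open>auto intro!: sum.cong\<close>)
  also have "(\<Sum>m\<in>{?K div q<..?K div Q}. inverse (real m)) \<le> (\<Sum>m\<in>{?K div q<..?K div Q}. real q / real ?K)"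
  proof (rule sum_mono)
    fix m assume "m \<in> {?K div q<..?K div Q}"
    then have "?K div q < m" by simp
    then have "?K < m * q" using assms by (simp add: div_less_iff_less_mult)
    then have "real ?K < real m * real q" by (simp flip: of_nat_mult)
    moreover have "0 < m" using \<open>?K div q < m\<close> by simp
    ultimately show "inverse (real m) \<le> real q / real ?K"
      using K by (simp add: field_simps)
  qed
  also have "\<dots> = real (?K div Q - ?K div q) * (real q / real ?K)" by simp
  also have "\<dots> \<le> (real ?K / real Q) * (real q / real ?K)"
    using of_nat_div_le_of_nat[of ?K Q, where 'a=real] le by (intro mult_right_mono) auto
  also have "\<dots> = real q / real Q" using K by simp
  also have "\<dots> \<le> 2" using assms by (simp add: divide_le_eq)
  finally have "harm (?K div Q) - harm (?K div q) \<le> (2::real)" by simp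
  moreover have "harm (?K div q) \<le> (harm (?K div Q) :: real)" using le by (rule harm_mono)
  ultimately have "\<bar>harm (?K div q) - harm (?K div Q)\<bar> \<le> (2::real)" by linarith
  moreover have "freq_coef j q - freq_coef j Q = (harm (?K div q) - harm (?K div Q)) / real j"
    by (simp add: freq_coef_def diff_divide_distrib)
  ultimately show ?thesis using assms by (simp add: abs_divide divide_right_mono)
qed

lemma card_multiples_band_le:
  assumes "0 < d"
  shows "card {q \<in> {Q..<2 * Q}. d dvd q} \<le> Q div d + 1"
proof -
  have "card {q \<in> {Q..<2 * Q}. d dvd q} = card (int ` {q \<in> {Q..<2 * Q}. d dvd q})"
    by (simp add: card_image)
  also have "\<dots> \<le> card {y \<in> {int Q..<int Q + int Q}. int d dvd y - 0}"
    by (rule card_mono) (auto intro: finite_subset[of _ "{int Q..<int Q + int Q}"])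
  also have "\<dots> \<le> Q div d + 1" by (rule card_dvd_shift_le[OF assms])
  finally show ?thesis .
qed

text \<open>Insert the bound for the Ramanujan sums by common divisors and sum over \<open>q\<close> first.\<close>

lemma norm_freq_kernel_le:
  assumes "\<And>q. 0 < q \<Longrightarrow> a \<le> q \<Longrightarrow> q < M \<Longrightarrow> \<bar>w q\<bar> \<le> v q"
  shows "norm (freq_kernel w a M n) \<le>
    (\<Sum>d | d \<in> {1..<M} \<and> int d dvd n. real d * (\<Sum>q | 0 < q \<and> a \<le> q \<and> q < M \<and> d dvd q. v q))"
proof -
  let ?A = "{q. 0 < q \<and> a \<le> q \<and> q < M}"
  let ?B = "{d. d \<in> {1..<M} \<and> int d dvd n}"
  have fin: "finite ?A" "finite ?B" by (rule finite_subset[of _ "{..<M}"]; auto)+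
  have "norm (freq_kernel w a M n) \<le> (\<Sum>q\<in>?A. \<bar>w q\<bar> * norm (ramanujan q n))"
    unfolding freq_kernel_def by (rule order_trans[OF norm_sum]) (simp add: norm_mult)
  also have "\<dots> \<le> (\<Sum>q\<in>?A. v q * (\<Sum>d | d dvd q \<and> int d dvd n. real d))"
    using assms norm_ramanujan_le by (intro sum_mono mult_mono) (auto intro: order_trans[OF abs_ge_zero])
  also have "\<dots> = (\<Sum>q\<in>?A. \<Sum>d\<in>?B. if d dvd q then real d * v q else 0)"
  proof (rule sum.cong[OF refl])
    fix q assume q: "q \<in> ?A"
    have "{d. d dvd q \<and> int d dvd n} = {d \<in> ?B. d dvd q}"
      using q by (auto dest: dvd_imp_le intro: Suc_leI dvd_pos_nat)
    then have "(\<Sum>d | d dvd q \<and> int d dvd n. real d) = (\<Sum>d\<in>?B. if d dvd q then real d else 0)"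
      by (simp only: sum.inter_filter[OF fin(2)])
    then show "v q * (\<Sum>d | d dvd q \<and> int d dvd n. real d) = (\<Sum>d\<in>?B. if d dvd q then real d * v q else 0)"
      by (simp add: sum_distrib_left if_distrib mult.commute cong: if_cong)
  qed
  also have "\<dots> = (\<Sum>d\<in>?B. \<Sum>q\<in>?A. if d dvd q then real d * v q else 0)"
    by (rule sum.swap)
  also have "\<dots> = (\<Sum>d\<in>?B. real d * (\<Sum>q | 0 < q \<and> a \<le> q \<and> q < M \<and> d dvd q. v q))"
  proof (rule sum.cong[OF refl])
    fix d
    have "{q. 0 < q \<and> a \<le> q \<and> q < M \<and> d dvd q} = {q \<in> ?A. d dvd q}" by auto
    then have "(\<Sum>q | 0 < q \<and> a \<le> q \<and> q < M \<and> d dvd q. v q) = (\<Sum>q\<in>?A. if d dvd q then v q else 0)"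
      by (simp only: sum.inter_filter[OF fin(1)])
    then show "(\<Sum>q\<in>?A. if d dvd q then real d * v q else 0) =
        real d * (\<Sum>q | 0 < q \<and> a \<le> q \<and> q < M \<and> d dvd q. v q)"
      by (simp add: sum_distrib_left if_distrib cong: if_cong)
  qed
  finally show ?thesis .
qed

lemma abs_freq_weight_le: "\<bar>freq_weight j q\<bar> \<le> 1 / real q"
  using freq_coef_le_1[of j q] by (simp add: freq_weight_def divide_right_mono)

text \<open>In a band of denominators near \<open>Q\<close> there are at most \<open>3 Q / d\<close> multiples of \<open>d\<close>, which cancels the
weight \<open>d / Q\<close>.\<close>

lemma norm_band_le: "norm (band j i n) \<le> 3 * real (small_divisor_count (2 ^ (i + 1)) n)"
proof -
  define Q :: nat where "Q = 2 ^ i"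
  have Q: "0 < Q" "2 ^ (i + 1) = 2 * Q" by (simp_all add: Q_def)
  have "norm (band j i n) \<le> (\<Sum>d | d \<in> {1..<2 * Q} \<and> int d dvd n.
      real d * (\<Sum>q | 0 < q \<and> Q \<le> q \<and> q < 2 * Q \<and> d dvd q. 1 / real Q))"
    unfolding band_def Q Q_def[symmetric]
  proof (rule norm_freq_kernel_le)
    fix q assume "0 < q" "Q \<le> q"
    then have "1 / real q \<le> 1 / real Q" using Q by (intro divide_left_mono) auto
    then show "\<bar>freq_weight j q\<bar> \<le> 1 / real Q" using abs_freq_weight_le[of j q] by linarith
  qed
  also have "\<dots> \<le> (\<Sum>d | d \<in> {1..<2 * Q} \<and> int d dvd n. 3)"
  proof (rule sum_mono)
    fix d assume "d \<in> {d. d \<in> {1..<2 * Q} \<and> int d dvd n}"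
    then have d: "0 < d" "d < 2 * Q" by auto
    have e: "{q. 0 < q \<and> Q \<le> q \<and> q < 2 * Q \<and> d dvd q} = {q \<in> {Q..<2 * Q}. d dvd q}" using Q by auto
    have "d * (Q div d + 1) \<le> 3 * Q"
    proof -
      have "d * (Q div d) \<le> Q" by simp
      then show ?thesis using d(2) unfolding distrib_left by linarith
    qed
    then have "d * card {q \<in> {Q..<2 * Q}. d dvd q} \<le> 3 * Q"
      using card_multiples_band_le[OF d(1), of Q] by (meson mult_le_mono2 order_trans)
    then have "real (d * card {q \<in> {Q..<2 * Q}. d dvd q}) \<le> real (3 * Q)" by (rule of_nat_mono)
    then have "real d * real (card {q \<in> {Q..<2 * Q}. d dvd q}) \<le> 3 * real Q" by simp
    then show "real d * (\<Sum>q | 0 < q \<and> Q \<le> q \<and> q < 2 * Q \<and> d dvd q. 1 / real Q) \<le> 3"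
      unfolding e using Q by (simp add: divide_le_eq)
  qed
  also have "\<dots> = 3 * real (small_divisor_count (2 ^ (i + 1)) n)"
    by (simp add: small_divisor_count_def Q_def)
  finally show ?thesis .
qed

lemma norm_freq_tail_le:
  assumes "n \<noteq> 0"
  shows "norm (freq_kernel (freq_weight j) a (divisor_cutoff j + 1) n) \<le> real (divisor_count (nat \<bar>n\<bar>)) * (real j + 1)"
proof -
  let ?K = "divisor_cutoff j"
  have "norm (freq_kernel (freq_weight j) a (?K + 1) n) \<le> (\<Sum>d | d \<in> {1..<?K + 1} \<and> int d dvd n.
      real d * (\<Sum>q | 0 < q \<and> a \<le> q \<and> q < ?K + 1 \<and> d dvd q. 1 / real q))"
    by (rule norm_freq_kernel_le) (rule abs_freq_weight_le)
  also have "\<dots> \<le> (\<Sum>d | d \<in> {1..<?K + 1} \<and> int d dvd n. real j + 1)"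
  proof (rule sum_mono)
    fix d assume "d \<in> {d. d \<in> {1..<?K + 1} \<and> int d dvd n}"
    then have d: "0 < d" by auto
    have "(\<Sum>q | 0 < q \<and> a \<le> q \<and> q < ?K + 1 \<and> d dvd q. 1 / real q) \<le> (\<Sum>q\<in>{q \<in> {1..?K}. d dvd q}. 1 / real q)"
      by (intro sum_mono2) auto
    also have "\<dots> = harm (?K div d) / real d"
      unfolding sum.inter_filter[OF finite_atLeastAtMost] by (rule sum_multiples_inverse[OF d])
    also have "\<dots> \<le> (real j + 1) / real d"
    proof (rule divide_right_mono)
      have "harm (?K div d) \<le> (harm ?K :: real)" by (intro harm_mono) simp
      also have "\<dots> \<le> real (j div 2) + 1" unfolding divisor_cutoff_def by (rule harm_pow2_le)
      also have "\<dots> \<le> real j + 1" by simp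
      finally show "harm (?K div d) \<le> real j + 1" .
    qed simp
    finally show "real d * (\<Sum>q | 0 < q \<and> a \<le> q \<and> q < ?K + 1 \<and> d dvd q. 1 / real q) \<le> real j + 1"
      using d by (simp add: field_simps)
  qed
  also have "\<dots> = real (card {d. d \<in> {1..<?K + 1} \<and> int d dvd n}) * (real j + 1)" by simp
  also have "\<dots> \<le> real (divisor_count (nat \<bar>n\<bar>)) * (real j + 1)"
  proof (intro mult_right_mono of_nat_mono)
    have fin: "finite {k. k dvd nat \<bar>n\<bar>}" using assms by (intro finite_divisors_nat) simp
    show "card {d. d \<in> {1..<?K + 1} \<and> int d dvd n} \<le> divisor_count (nat \<bar>n\<bar>)"
      unfolding divisor_count_def by (rule card_mono[OF fin]) auto
  qed simp
  finally show ?thesis .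
qed

text \<open>At 0 the full punctured kernel vanishes, so the tail is minus the sum of the bands, and a Ramanujan sum is
at most \<open>q\<close> in modulus.\<close>

lemma norm_tail_0_le:
  assumes "2 \<le> c"
  shows "norm (tail c j 0) \<le> 2 ^ (j div c)"
proof -
  have "tail c j 0 = - (\<Sum>i<j div c. band j i 0)"
    using divisor_kernel_decomposition[OF assms, of 0 j] by (simp add: add_eq_0_iff)
  also have "\<dots> = - freq_kernel (freq_weight j) 1 (2 ^ (j div c)) 0" by (simp only: sum_bands)
  finally have "norm (tail c j 0) = norm (freq_kernel (freq_weight j) 1 (2 ^ (j div c)) 0)" by simp
  also have "\<dots> \<le> (\<Sum>q | 0 < q \<and> 1 \<le> q \<and> q < 2 ^ (j div c). \<bar>freq_weight j q\<bar> * norm (ramanujan q 0))"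
    unfolding freq_kernel_def by (rule order_trans[OF norm_sum]) (simp add: norm_mult)
  also have "\<dots> \<le> (\<Sum>q | 0 < q \<and> 1 \<le> q \<and> q < (2::nat) ^ (j div c). 1)"
  proof (rule sum_mono)
    fix q :: nat assume "q \<in> {q. 0 < q \<and> 1 \<le> q \<and> q < 2 ^ (j div c)}"
    then have q: "0 < q" by simp
    have "norm (ramanujan q 0) \<le> real q"
      unfolding ramanujan_def using totient_le[of q] by (simp add: totient_def)
    then have "\<bar>freq_weight j q\<bar> * norm (ramanujan q 0) \<le> 1 / real q * real q"
      by (intro mult_mono abs_freq_weight_le) auto
    then show "\<bar>freq_weight j q\<bar> * norm (ramanujan q 0) \<le> 1" using q by simp
  qed
  also have "\<dots> = real (card {q. 0 < q \<and> 1 \<le> q \<and> q < (2::nat) ^ (j div c)})" by simp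
  also have "\<dots> \<le> real (card {..<(2::nat) ^ (j div c)})"
    by (intro of_nat_mono card_mono) auto
  finally show ?thesis by simp
qed

section \<open>Gain and loss of the pieces of the kernel\<close>

lemma ramanujan_periodic:
  assumes "q dvd \<Lambda>" "0 < q"
  shows "ramanujan q (n mod int \<Lambda>) = ramanujan q n"
  unfolding ramanujan_def
proof (rule sum.cong[OF refl])
  fix b
  obtain k where k: "\<Lambda> = q * k" using assms(1) by (elim dvdE)
  have "n = n mod int \<Lambda> + int q * (int k * (n div int \<Lambda>))"
    using mod_mult_div_eq[of n "int \<Lambda>"] by (simp add: k mult.assoc)
  then have "real_of_int n = of_int (n mod int \<Lambda>) + real q * of_int (int k * (n div int \<Lambda>))"
    by (metis of_int_add of_int_mult of_int_of_nat_eq)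
  then have "real b / real q * of_int n = real b / real q * of_int (n mod int \<Lambda>) + of_int (int b * (int k * (n div int \<Lambda>)))"
    using assms(2) by (simp add: field_simps)
  then show "unit_exp (real b / real q * of_int (n mod int \<Lambda>)) = unit_exp (real b / real q * of_int n)"
    by (simp only: unit_exp_add unit_exp_of_int mult_1_right)
qed

lemma cell_op_linear:
  "cell_op t j (\<lambda>n. c * H n + H' n) f x = c * cell_op t j H f x + cell_op t j H' f x"
  by (simp add: cell_op_def sum.distrib distrib_right add_divide_distrib sum_distrib_left mult.assoc)

text \<open>The main part depends on \<open>j\<close> only through a scalar, so that periodicity can be exploited for all scales
simultaneously.\<close>

lemma band_freeze:
  "band j i n = of_real (freq_coef j (2 ^ i)) * freq_kernel (\<lambda>q. 1 / real q) (2 ^ i) (2 ^ (i + 1)) n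
    + freq_kernel (\<lambda>q. (freq_coef j q - freq_coef j (2 ^ i)) / real q) (2 ^ i) (2 ^ (i + 1)) n"
  unfolding band_def freq_kernel_def sum_distrib_left sum.distrib[symmetric]
  by (intro sum.cong refl) (simp add: freq_weight_def diff_divide_distrib algebra_simps)

text \<open>Scales below \<open>J\<close> are treated by the square function; from \<open>J\<close> on, the common period of the Ramanujan
sums in the band fits into a cell.\<close>

lemma frozen_band_gain:
  assumes X: "X \<subseteq> cell t m z" and jx: "\<And>x. x \<in> X \<Longrightarrow> 4 * (i + 1) \<le> jx x \<and> jx x \<le> m"
  shows "(\<Sum>x\<in>X. (norm (cell_op t (jx x) (freq_kernel (\<lambda>q. 1 / real q) (2 ^ i) (2 ^ (i + 1))) f x))\<^sup>2)
    \<le> 126 * (real i + 1) / 2 ^ i * (\<Sum>x\<in>cell t m z. (norm (f x))\<^sup>2)"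
proof -
  define M :: nat where "M = 2 ^ (i + 1)"
  define P where "P = freq_kernel (\<lambda>q. 1 / real q) (2 ^ i) M"
  \<comment> \<open>chosen so that \<open>2 ^ J = M ^ (M + 4)\<close>, which is at least \<open>\<Lambda>\<close>\<close>
  define J where "J = (i + 1) * (M + 4)"
  \<comment> \<open>the factor \<open>M ^ 4\<close> makes a full period long enough for almost orthogonality\<close>
  define \<Lambda> where "\<Lambda> = fact M * M ^ 4"
  define F where "F = (\<Sum>x\<in>cell t m z. (norm (f x))\<^sup>2)"
  have F0: "0 \<le> F" by (simp add: F_def sum_nonneg)
  have M0: "0 < M" by (simp add: M_def)
  have W: "\<bar>1 / real q\<bar> \<le> 1 / 2 ^ i" if "0 < q" "2 ^ i \<le> q" for q :: nat
  proof -
    have "real (2 ^ i) \<le> real q" using that(2) by (rule of_nat_mono)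
    then show ?thesis using that(1) by (simp add: frac_le)
  qed
  have M4: "M ^ 4 \<le> 2 ^ j" if "4 * (i + 1) \<le> j" for j
  proof -
    have "M ^ 4 = 2 ^ (4 * (i + 1))" unfolding M_def by (metis power_mult mult.commute)
    then show ?thesis using that by (simp only: power_increasing_iff)
  qed
  have \<Lambda>0: "0 < \<Lambda>" "M ^ 4 \<le> \<Lambda>" using M0 by (simp_all add: \<Lambda>_def)
  have "\<Lambda> \<le> M ^ M * M ^ 4"
    unfolding \<Lambda>_def using fact_le_power[of M, where 'a=nat] by (intro mult_right_mono) auto
  also have "\<dots> = 2 ^ J" unfolding J_def M_def by (metis power_add power_mult)
  finally have \<Lambda>J: "\<Lambda> \<le> 2 ^ J" .
  have J4: "4 * (i + 1) \<le> J"
    unfolding J_def by (subst mult.commute, rule mult_le_mono2) simp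
  define Xl where "Xl = {x \<in> X. jx x < J}"
  define Xh where "Xh = {x \<in> X. J \<le> jx x}"
  have low: "(\<Sum>x\<in>Xl. (norm (cell_op t (jx x) P f x))\<^sup>2) \<le> 54 * (real i + 1) / 2 ^ i * F"
  proof -
    have "(\<Sum>x\<in>Xl. (norm (cell_op t (jx x) P f x))\<^sup>2) \<le>
        (\<Sum>j\<in>{j. 4 * (i + 1) \<le> j \<and> j \<le> m \<and> j < J}. \<Sum>x\<in>cell t m z. (norm (cell_op t j P f x))\<^sup>2)"
      by (rule selector_square_sum) (use X jx in \<open>auto simp: Xl_def\<close>)
    also have "\<dots> \<le> (\<Sum>j\<in>{j. 4 * (i + 1) \<le> j \<and> j \<le> m \<and> j < J}. (1 / 2 ^ i * 3)\<^sup>2 * F)"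
      unfolding P_def F_def by (intro sum_mono cell_op_l2_small W M4) auto
    also have "\<dots> = real (card {j. 4 * (i + 1) \<le> j \<and> j \<le> m \<and> j < J}) * ((1 / 2 ^ i * 3)\<^sup>2 * F)" by simp
    also have "\<dots> \<le> real J * ((1 / 2 ^ i * 3)\<^sup>2 * F)"
    proof (intro mult_right_mono of_nat_mono)
      have "card {j. 4 * (i + 1) \<le> j \<and> j \<le> m \<and> j < J} \<le> card {..<J}" by (rule card_mono) auto
      then show "card {j. 4 * (i + 1) \<le> j \<and> j \<le> m \<and> j < J} \<le> J" by simp
    qed (use F0 in auto)
    also have "\<dots> \<le> (6 * (real i + 1) * 2 ^ i) * ((1 / 2 ^ i * 3)\<^sup>2 * F)"
    proof (rule mult_right_mono)
      have "(1::real) \<le> 2 ^ i" by simp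
      then have le: "(real i + 1) * (2 * 2 ^ i + 4) \<le> (real i + 1) * (6 * 2 ^ i)"
        by (intro mult_left_mono) auto
      have "real J = (real i + 1) * (2 * 2 ^ i + 4)" by (simp add: J_def M_def algebra_simps)
      also note le
      also have "(real i + 1) * (6 * 2 ^ i) = 6 * (real i + 1) * 2 ^ i" by simp
      finally show "real J \<le> 6 * (real i + 1) * 2 ^ i" .
    qed (use F0 in auto)
    also have "\<dots> = 54 * (real i + 1) / 2 ^ i * F"
      by (simp add: power2_eq_square field_simps)
    finally show ?thesis .
  qed
  have high: "(\<Sum>x\<in>Xh. (norm (cell_op t (jx x) P f x))\<^sup>2) \<le> 8 * (9 / 4 ^ i) * F"
    unfolding F_def
  proof (rule periodic_maximal_l2[where J = J and \<Lambda> = \<Lambda>])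
    show "P n = P (n mod int \<Lambda>)" for n
      unfolding P_def freq_kernel_def
    proof (rule sum.cong[OF refl])
      fix q assume "q \<in> {q. 0 < q \<and> 2 ^ i \<le> q \<and> q < M}"
      then have "0 < q" "q dvd fact M" by (auto intro: dvd_fact)
      then have "ramanujan q (n mod int \<Lambda>) = ramanujan q n"
        by (intro ramanujan_periodic) (auto simp: \<Lambda>_def)
      then show "of_real (1 / real q) * ramanujan q n = of_real (1 / real q) * ramanujan q (n mod int \<Lambda>)"
        by simp
    qed
    show "(\<Sum>u\<in>{0..<int \<Lambda>}. (norm (\<Sum>y\<in>cell t J z. P (y - u) * f y))\<^sup>2)
      \<le> 9 / 4 ^ i * real \<Lambda> * 2 ^ J * (\<Sum>y\<in>cell t J z. (norm (f y))\<^sup>2)" for z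
    proof -
      have "real (M ^ 4) \<le> real \<Lambda>" using \<Lambda>0(2) by (rule of_nat_mono)
      then have "real M ^ 4 \<le> real \<Lambda>" by (simp only: of_nat_power)
      then have "(\<Sum>P'\<in>farey (2 ^ i) M. exp_sum {0..<int \<Lambda>} (farey_point p - farey_point P')) \<le> 3 * real \<Lambda>"
        if p: "p \<in> farey (2 ^ i) M" for p
      proof -
        have "(\<Sum>P'\<in>farey (2 ^ i) M. exp_sum {0..<int \<Lambda>} (farey_point p - farey_point P')) \<le> real \<Lambda> + 2 * real M ^ 4"
          using farey_gram_small[OF p, where c = 0 and L = \<Lambda>] by simp
        then show ?thesis using \<open>real M ^ 4 \<le> real \<Lambda>\<close> by linarith
      qed
      then have "(\<Sum>u\<in>{0..<int \<Lambda>}. (norm (\<Sum>y\<in>cell t J z. P (y - u) * f y))\<^sup>2)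
          \<le> (1 / 2 ^ i)\<^sup>2 * (3 * real \<Lambda>) * (3 * 2 ^ J) * (\<Sum>y\<in>cell t J z. (norm (f y))\<^sup>2)"
        unfolding P_def using M4[OF J4] by (intro freq_kernel_l2 W cell_gram_small) auto
      also have "(1 / 2 ^ i)\<^sup>2 * (3 * real \<Lambda>) * (3 * 2 ^ J) = 9 / 4 ^ i * real \<Lambda> * 2 ^ J"
        by (simp add: power2_eq_square power_mult_distrib[symmetric])
      finally show ?thesis .
    qed
  qed (use \<Lambda>0 \<Lambda>J X jx in \<open>auto simp: Xh_def\<close>)
  have "8 * (9 / 4 ^ i) \<le> 72 * (real i + 1) / 2 ^ i"
  proof -
    have "(2::real) ^ i * 1 \<le> 4 ^ i * (real i + 1)" by (intro mult_mono power_mono) auto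
    then show ?thesis by (simp add: field_simps)
  qed
  then have high': "(\<Sum>x\<in>Xh. (norm (cell_op t (jx x) P f x))\<^sup>2) \<le> 72 * (real i + 1) / 2 ^ i * F"
    using high F0 by (meson mult_right_mono order_trans)
  have fX: "finite X" using X by (rule finite_subset) simp
  have "(\<Sum>x\<in>X. (norm (cell_op t (jx x) P f x))\<^sup>2) =
      (\<Sum>x\<in>Xl. (norm (cell_op t (jx x) P f x))\<^sup>2) + (\<Sum>x\<in>Xh. (norm (cell_op t (jx x) P f x))\<^sup>2)"
    unfolding Xl_def Xh_def using fX
    by (subst sum.union_disjoint[symmetric]) (auto intro!: sum.cong)
  also have "\<dots> \<le> 54 * (real i + 1) / 2 ^ i * F + 72 * (real i + 1) / 2 ^ i * F"
    by (rule add_mono[OF low high'])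
  also have "\<dots> = 126 * (real i + 1) / 2 ^ i * F" by (simp add: add_divide_distrib distrib_right[symmetric])
  finally show ?thesis by (simp only: P_def M_def F_def)
qed

text \<open>The error of freezing the coefficients has size \<open>1 / j\<close>, so its square function converges.\<close>

lemma band_gain:
  assumes X: "X \<subseteq> cell t m z" and jx: "\<And>x. x \<in> X \<Longrightarrow> 4 * (i + 1) \<le> jx x \<and> jx x \<le> m"
  shows "(\<Sum>x\<in>X. (norm (cell_op t (jx x) (band (jx x) i) f x))\<^sup>2)
    \<le> 400 * (real i + 1) / 2 ^ i * (\<Sum>x\<in>cell t m z. (norm (f x))\<^sup>2)"
proof -
  define P where "P = freq_kernel (\<lambda>q. 1 / real q) (2 ^ i) (2 ^ (i + 1))"
  define E where "E j = freq_kernel (\<lambda>q. (freq_coef j q - freq_coef j (2 ^ i)) / real q) (2 ^ i) (2 ^ (i + 1))" for j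
  define F where "F = (\<Sum>x\<in>cell t m z. (norm (f x))\<^sup>2)"
  have F0: "0 \<le> F" by (simp add: F_def sum_nonneg)
  have M4: "(2 ^ (i + 1)) ^ 4 \<le> (2::nat) ^ j" if "4 * (i + 1) \<le> j" for j
  proof -
    have "(2 ^ (i + 1)) ^ 4 = (2::nat) ^ (4 * (i + 1))" by (metis power_mult mult.commute)
    then show ?thesis using that by (simp only: power_increasing_iff)
  qed
  have pt: "(norm (cell_op t j (band j i) f x))\<^sup>2 \<le> 2 * (norm (cell_op t j P f x))\<^sup>2 + 2 * (norm (cell_op t j (E j) f x))\<^sup>2" for j x
  proof -
    have "band j i = (\<lambda>n. of_real (freq_coef j (2 ^ i)) * P n + E j n)"
      by (rule ext) (simp only: band_freeze P_def E_def)
    then have "cell_op t j (band j i) f x = of_real (freq_coef j (2 ^ i)) * cell_op t j P f x + cell_op t j (E j) f x"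
      by (simp only: cell_op_linear)
    then have "(norm (cell_op t j (band j i) f x))\<^sup>2 \<le>
        2 * (norm (of_real (freq_coef j (2 ^ i)) * cell_op t j P f x))\<^sup>2 + 2 * (norm (cell_op t j (E j) f x))\<^sup>2"
      by (simp only: norm_add_sq_le)
    moreover have "norm (of_real (freq_coef j (2 ^ i)) * cell_op t j P f x) \<le> 1 * norm (cell_op t j P f x)"
      unfolding norm_mult using freq_coef_le_1 by (intro mult_right_mono) auto
    then have "(norm (of_real (freq_coef j (2 ^ i)) * cell_op t j P f x))\<^sup>2 \<le> (norm (cell_op t j P f x))\<^sup>2"
      by (intro power_mono) auto
    ultimately show ?thesis by linarith
  qed
  have E: "(\<Sum>x\<in>X. (norm (cell_op t (jx x) (E (jx x)) f x))\<^sup>2) \<le> 72 / 4 ^ i * F"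
  proof -
    have "(\<Sum>x\<in>X. (norm (cell_op t (jx x) (E (jx x)) f x))\<^sup>2) \<le>
        (\<Sum>j\<in>{j. 4 * (i + 1) \<le> j \<and> j \<le> m}. \<Sum>x\<in>cell t m z. (norm (cell_op t j (E j) f x))\<^sup>2)"
      by (rule selector_square_sum) (use X jx in auto)
    also have "\<dots> \<le> (\<Sum>j\<in>{j. 4 * (i + 1) \<le> j \<and> j \<le> m}. (2 / real j / 2 ^ i * 3)\<^sup>2 * F)"
    proof (rule sum_mono)
      fix j assume j: "j \<in> {j. 4 * (i + 1) \<le> j \<and> j \<le> m}"
      have W: "\<bar>(freq_coef j q - freq_coef j (2 ^ i)) / real q\<bar> \<le> 2 / real j / 2 ^ i"
        if "0 < q" "2 ^ i \<le> q" "q < 2 ^ (i + 1)" for q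
      proof -
        have "real (2 ^ i) \<le> real q" using that(2) by (rule of_nat_mono)
        moreover have "\<bar>freq_coef j q - freq_coef j (2 ^ i)\<bar> \<le> 2 / real j"
          by (rule freq_coef_diff_le) (use that j in auto)
        ultimately have "\<bar>freq_coef j q - freq_coef j (2 ^ i)\<bar> / real q \<le> 2 / real j / 2 ^ i"
          by (intro frac_le) auto
        then show ?thesis by (simp add: abs_divide)
      qed
      show "(\<Sum>x\<in>cell t m z. (norm (cell_op t j (E j) f x))\<^sup>2) \<le> (2 / real j / 2 ^ i * 3)\<^sup>2 * F"
        unfolding E_def F_def by (rule cell_op_l2_small) (use W M4 j in auto)
    qed
    also have "\<dots> = (\<Sum>j\<in>{j. 4 * (i + 1) \<le> j \<and> j \<le> m}. 36 / 4 ^ i * F * (1 / (real j)\<^sup>2))"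
      by (intro sum.cong refl) (simp add: power2_eq_square power_mult_distrib[symmetric])
    also have "\<dots> \<le> 36 / 4 ^ i * F * (\<Sum>j\<in>{1..m}. 1 / (real j)\<^sup>2)"
      unfolding sum_distrib_left using F0 by (intro sum_mono2) auto
    also have "\<dots> \<le> 36 / 4 ^ i * F * 2"
      using F0 by (intro mult_left_mono sum_inverse_squares_le) auto
    finally show ?thesis by simp
  qed
  have Pg: "(\<Sum>x\<in>X. (norm (cell_op t (jx x) P f x))\<^sup>2) \<le> 126 * (real i + 1) / 2 ^ i * F"
    unfolding P_def F_def by (rule frozen_band_gain[OF X]) (rule jx)
  have c: "72 / 4 ^ i \<le> 72 * (real i + 1) / 2 ^ i"
  proof -
    have "(2::real) ^ i * 1 \<le> 4 ^ i * (real i + 1)" by (intro mult_mono power_mono) auto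
    then show ?thesis by (simp add: field_simps)
  qed
  have "(\<Sum>x\<in>X. (norm (cell_op t (jx x) (band (jx x) i) f x))\<^sup>2) \<le>
      2 * (\<Sum>x\<in>X. (norm (cell_op t (jx x) P f x))\<^sup>2) + 2 * (\<Sum>x\<in>X. (norm (cell_op t (jx x) (E (jx x)) f x))\<^sup>2)"
    unfolding sum_distrib_left sum.distrib[symmetric] by (rule sum_mono) (rule pt)
  also have "\<dots> \<le> 2 * (126 * (real i + 1) / 2 ^ i * F) + 2 * (72 / 4 ^ i * F)"
    using E Pg by linarith
  also have "\<dots> \<le> 2 * (126 * (real i + 1) / 2 ^ i * F) + 2 * (72 * (real i + 1) / 2 ^ i * F)"
    using mult_right_mono[OF c F0] by linarith
  also have "\<dots> \<le> 400 * (real i + 1) / 2 ^ i * F"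
  proof -
    have e: "k * (real i + 1) / 2 ^ i * F = k * ((real i + 1) / 2 ^ i * F)" for k by simp
    have "0 \<le> (real i + 1) / 2 ^ i * F" using F0 by simp
    moreover have "2 * (126 * y) + 2 * (72 * y) \<le> 400 * y" if "0 \<le> y" for y :: real
      using that by simp
    ultimately show ?thesis unfolding e by blast
  qed
  finally show ?thesis by (simp only: F_def)
qed

text \<open>The weights are at most \<open>2 ^ (- (j div c))\<close>, which beats the factor \<open>j\<close> lost in the large sieve. The
subtracted diagonal acts as multiplication by at most \<open>2 ^ (- j / 2)\<close>.\<close>

lemma tail_gain:
  assumes X: "X \<subseteq> cell t m z" and "j \<le> m"
  shows "(\<Sum>x\<in>X. (norm (cell_op t j (tail c j) f x))\<^sup>2) \<le>
    2 * ((12 * (real j + 2) / 2 ^ (j div c))\<^sup>2 + 1 / 2 ^ j) * (\<Sum>x\<in>cell t m z. (norm (f x))\<^sup>2)"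
proof -
  define R where "R = freq_kernel (freq_weight j) (2 ^ (j div c)) (divisor_cutoff j + 1)"
  define F where "F = (\<Sum>x\<in>cell t m z. (norm (f x))\<^sup>2)"
  have "divisor_cutoff j ^ 2 = 2 ^ (2 * (j div 2))" by (simp add: divisor_cutoff_def power_mult[symmetric] mult.commute)
  also have "\<dots> \<le> 2 ^ j" by (rule power_increasing) auto
  finally have K2: "divisor_cutoff j ^ 2 \<le> 2 ^ j" .
  have pt: "(norm (cell_op t j (tail c j) f x))\<^sup>2 \<le> 2 * (norm (cell_op t j R f x))\<^sup>2 + 2 * (1 / 2 ^ j * (norm (f x))\<^sup>2)" for x
  proof -
    have "cell_op t j (tail c j) f x = cell_op t j R f x + - (of_real (divisor_kernel j 0) * f x / 2 ^ j)"
    proof -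
      have "(\<Sum>y\<in>cell t j x. tail c j (y - x) * f y) =
          (\<Sum>y\<in>cell t j x. R (y - x) * f y) - (\<Sum>y\<in>cell t j x. if y = x then of_real (divisor_kernel j 0) * f x else 0)"
        unfolding sum_subtractf[symmetric]
        by (intro sum.cong refl) (auto simp: tail_def R_def left_diff_distrib)
      then show ?thesis by (simp add: cell_op_def diff_divide_distrib)
    qed
    then have "(norm (cell_op t j (tail c j) f x))\<^sup>2 \<le>
        2 * (norm (cell_op t j R f x))\<^sup>2 + 2 * (norm (- (of_real (divisor_kernel j 0) * f x / 2 ^ j)))\<^sup>2"
      by (simp only: norm_add_sq_le)
    also have "(norm (- (of_real (divisor_kernel j 0) * f x / 2 ^ j)))\<^sup>2 = (divisor_kernel j 0)\<^sup>2 / (2 ^ j)\<^sup>2 * (norm (f x))\<^sup>2"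
      by (simp add: norm_divide norm_mult norm_power power_divide power_mult_distrib)
    also have "\<dots> \<le> 1 / 2 ^ j * (norm (f x))\<^sup>2"
    proof (rule mult_right_mono)
      have "divisor_kernel j 0 \<le> real (divisor_cutoff j)"
      proof (cases "j = 0")
        case False
        have "{k \<in> {1..divisor_cutoff j}. int k dvd 0} = {1..divisor_cutoff j}" by auto
        then have "divisor_kernel j 0 = real (divisor_cutoff j) / real j" by (simp only: divisor_kernel_def) simp
        also have "\<dots> \<le> real (divisor_cutoff j) / 1" using False by (intro divide_left_mono) auto
        finally show ?thesis by simp
      qed (simp add: divisor_kernel_def)
      then have "(divisor_kernel j 0)\<^sup>2 \<le> real (divisor_cutoff j) ^ 2" by (intro power_mono) (auto simp: divisor_kernel_def)
      also have "\<dots> = real (divisor_cutoff j ^ 2)" by simp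
      also have "\<dots> \<le> real (2 ^ j)" using K2 by (rule of_nat_mono)
      finally show "(divisor_kernel j 0)\<^sup>2 / (2 ^ j)\<^sup>2 \<le> 1 / 2 ^ j"
        by (simp add: divide_le_eq power2_eq_square)
    qed simp
    finally show ?thesis by simp
  qed
  have "(\<Sum>x\<in>X. (norm (cell_op t j (tail c j) f x))\<^sup>2) \<le> (\<Sum>x\<in>cell t m z. (norm (cell_op t j (tail c j) f x))\<^sup>2)"
    using X by (intro sum_mono2) auto
  also have "\<dots> \<le> 2 * (\<Sum>x\<in>cell t m z. (norm (cell_op t j R f x))\<^sup>2) + 2 * (1 / 2 ^ j * F)"
    unfolding F_def sum_distrib_left sum.distrib[symmetric] by (rule sum_mono) (rule pt)
  also have "(\<Sum>x\<in>cell t m z. (norm (cell_op t j R f x))\<^sup>2) \<le> (1 / 2 ^ (j div c) * (12 * (real j + 2)))\<^sup>2 * F"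
    unfolding R_def F_def
  proof (rule cell_op_l2_log)
    fix q :: nat assume q: "0 < q" "2 ^ (j div c) \<le> q"
    have "real (2 ^ (j div c)) \<le> real q" using q(2) by (rule of_nat_mono)
    then have "1 / real q \<le> 1 / 2 ^ (j div c)" using q(1) by (simp add: frac_le)
    then show "\<bar>freq_weight j q\<bar> \<le> 1 / 2 ^ (j div c)" using abs_freq_weight_le[of j q] by linarith
  qed (use K2 assms in auto)
  finally have fin: "(\<Sum>x\<in>X. (norm (cell_op t j (tail c j) f x))\<^sup>2) \<le>
      2 * ((1 / 2 ^ (j div c) * (12 * (real j + 2)))\<^sup>2 * F) + 2 * (1 / 2 ^ j * F)" by simp
  have alg: "2 * (A * F) + 2 * (B * F) = 2 * (A + B) * F" for A B :: real
    by (simp add: algebra_simps)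
  from fin show ?thesis
    unfolding F_def[symmetric] alg by (simp only: times_divide_eq_left mult_1_left)
qed

lemma band_loss:
  fixes p :: nat
  assumes "0 < \<epsilon>" "0 < p"
  shows "\<exists>C>0. \<forall>i j t x z. p * (i + 1) \<le> j \<longrightarrow>
    (\<Sum>y\<in>cell t j z. norm (band j i (y - x)) ^ p) \<le> C * 2 powr (\<epsilon> * real i) * 2 ^ j"
proof -
  obtain C where C: "0 < C" and le: "\<And>i j t x z. p * (i + 1) \<le> j \<Longrightarrow>
    (\<Sum>y\<in>cell t j z. real (small_divisor_count (2 ^ (i + 1)) (y - x)) ^ p) \<le> C * 2 powr (\<epsilon> * real i) * 2 ^ j"
    using small_divisor_count_moment[OF assms] by metis
  have "(\<Sum>y\<in>cell t j z. norm (band j i (y - x)) ^ p) \<le> (3 ^ p * C) * 2 powr (\<epsilon> * real i) * 2 ^ j"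
    if "p * (i + 1) \<le> j" for i j t x z
  proof -
    have "(\<Sum>y\<in>cell t j z. norm (band j i (y - x)) ^ p) \<le>
        (\<Sum>y\<in>cell t j z. 3 ^ p * real (small_divisor_count (2 ^ (i + 1)) (y - x)) ^ p)"
      unfolding power_mult_distrib[symmetric] by (intro sum_mono power_mono norm_band_le) auto
    also have "\<dots> \<le> 3 ^ p * (C * 2 powr (\<epsilon> * real i) * 2 ^ j)"
      unfolding sum_distrib_left[symmetric] by (intro mult_left_mono le that) auto
    finally show ?thesis by (simp only: mult.assoc)
  qed
  then show ?thesis using C by (intro exI[of _ "3 ^ p * C"]) auto
qed

text \<open>Off the diagonal the divisor bound applies. The diagonal value is at most \<open>2 ^ (j div c)\<close>, whose
\<open>p\<close>-th power does not exceed the length \<open>2 ^ j\<close> because \<open>p \<le> c\<close>.\<close>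

lemma tail_loss:
  fixes p :: nat
  assumes \<epsilon>: "0 < \<epsilon>" and p: "0 < p" and c: "2 \<le> c" "p \<le> c"
  shows "\<exists>C>0. \<forall>j t x. (\<Sum>y\<in>cell t j x. norm (tail c j (y - x)) ^ p) \<le> C * 2 powr (\<epsilon> * real j) * 2 ^ j"
proof -
  define \<delta> where "\<delta> = \<epsilon> / (2 * real p)"
  have \<delta>: "0 < \<delta>" "2 * \<delta> * real p = \<epsilon>" using \<epsilon> p by (simp_all add: \<delta>_def)
  obtain C where C: "0 < C" "\<And>n. 0 < n \<Longrightarrow> real (divisor_count n) \<le> C * real n powr \<delta>"
    using divisor_count_le_powr[OF \<delta>(1)] by blast
  define B where "B = C * (1 / (\<delta> * ln 2) * 2 powr \<delta>)"
  have B0: "0 < B" using C \<delta> by (simp add: B_def)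
  have "(\<Sum>y\<in>cell t j x. norm (tail c j (y - x)) ^ p) \<le> (B ^ p + 1) * 2 powr (\<epsilon> * real j) * 2 ^ j" for j t x
  proof -
    define T where "T = B ^ p * 2 powr (\<epsilon> * real j)"
    have T0: "0 \<le> T" using B0 by (simp add: T_def)
    have off: "norm (tail c j (y - x)) ^ p \<le> T" if y: "y \<in> cell t j x - {x}" for y
    proof -
      have ne: "y - x \<noteq> 0" using y by simp
      have "\<bar>y - x\<bar> < 2 ^ j" using y self_in_cell[of x t j] by (auto simp: cell_interval)
      then have "nat \<bar>y - x\<bar> \<le> 2 ^ j" by (simp add: nat_le_iff)
      then have n: "real (nat \<bar>y - x\<bar>) \<le> real (2 ^ j)" by (rule of_nat_mono)
      have "norm (tail c j (y - x)) \<le> real (divisor_count (nat \<bar>y - x\<bar>)) * (real j + 1)"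
        using norm_freq_tail_le[OF ne, of j "2 ^ (j div c)"] ne by (simp add: tail_def)
      also have "\<dots> \<le> (C * real (nat \<bar>y - x\<bar>) powr \<delta>) * (real j + 1)"
        using ne by (intro mult_right_mono C) auto
      also have "\<dots> \<le> (C * real (2 ^ j) powr \<delta>) * (real j + 1)"
        using C \<delta> n by (intro mult_right_mono mult_left_mono powr_mono2) auto
      also have "\<dots> \<le> (C * real (2 ^ j) powr \<delta>) * (1 / (\<delta> * ln 2) * 2 powr (\<delta> * real (j + 1)))"
        using nat_le_powr[OF \<delta>(1), of "j + 1"] C by (intro mult_left_mono) auto
      also have "real (2 ^ j) powr \<delta> = 2 powr (\<delta> * real j)"
        by (simp add: powr_powr powr_realpow[symmetric] mult.commute)
      also have "(C * 2 powr (\<delta> * real j)) * (1 / (\<delta> * ln 2) * 2 powr (\<delta> * real (j + 1))) =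
          B * (2 powr (\<delta> * real j) * 2 powr (\<delta> * real j))"
        by (simp add: B_def powr_add distrib_left)
      also have "2 powr (\<delta> * real j) * 2 powr (\<delta> * real j) = 2 powr (2 * \<delta> * real j)"
        by (simp add: powr_add[symmetric] mult.assoc)
      finally have "norm (tail c j (y - x)) ^ p \<le> (B * 2 powr (2 * \<delta> * real j)) ^ p"
        by (intro power_mono) auto
      also have "\<dots> = B ^ p * 2 powr (2 * \<delta> * real p * real j)"
        by (simp add: power_mult_distrib powr_powr powr_realpow[symmetric] mult_ac)
      finally show ?thesis by (simp only: \<delta>(2) T_def)
    qed
    have diag: "norm (tail c j (x - x)) ^ p \<le> 2 ^ j"
    proof -
      have "norm (tail c j (x - x)) ^ p \<le> (2 ^ (j div c)) ^ p"
        using norm_tail_0_le[OF c(1), of j] by (intro power_mono) auto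
      also have "\<dots> = 2 ^ (j div c * p)" by (simp add: power_mult)
      also have "\<dots> \<le> 2 ^ j"
      proof (rule power_increasing)
        have "j div c * p \<le> j div c * c" using c(2) by (rule mult_left_mono) simp
        also have "\<dots> \<le> j" by simp
        finally show "j div c * p \<le> j" .
      qed simp
      finally show ?thesis .
    qed
    have "(\<Sum>y\<in>cell t j x. norm (tail c j (y - x)) ^ p) =
        norm (tail c j (x - x)) ^ p + (\<Sum>y\<in>cell t j x - {x}. norm (tail c j (y - x)) ^ p)"
      by (rule sum.remove) auto
    also have "\<dots> \<le> 2 ^ j + (\<Sum>y\<in>cell t j x - {x}. T)"
      by (intro add_mono diag sum_mono off)
    also have "\<dots> \<le> 2 ^ j + (\<Sum>y\<in>cell t j x. T)"
      using T0 by (intro add_left_mono sum_mono2) auto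
    also have "\<dots> = (1 + B ^ p * 2 powr (\<epsilon> * real j)) * 2 ^ j" by (simp add: T_def algebra_simps)
    also have "\<dots> \<le> (B ^ p + 1) * 2 powr (\<epsilon> * real j) * 2 ^ j"
    proof (rule mult_right_mono)
      have "1 \<le> 2 powr (\<epsilon> * real j)" using \<epsilon> by (intro ge_one_powr_ge_zero) auto
      then show "1 + B ^ p * 2 powr (\<epsilon> * real j) \<le> (B ^ p + 1) * 2 powr (\<epsilon> * real j)"
        by (simp add: distrib_right)
    qed simp
    finally show ?thesis .
  qed
  moreover have "0 < B ^ p + 1" using B0 by (simp add: add_pos_pos)
  ultimately show ?thesis by blast
qed

section \<open>Interpolation by truncation\<close>

lemma young_le:
  fixes u v p q :: real
  assumes "1 < p" "1 < q" "1 / p + 1 / q = 1" "0 \<le> u" "0 \<le> v"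
  shows "u * v \<le> u powr p + v powr q"
proof -
  have "u * v \<le> u powr p / p + v powr q / q" by (rule Youngs_inequality[OF assms])
  also have "\<dots> \<le> u powr p / 1 + v powr q / 1"
    using assms by (intro add_mono divide_left_mono) auto
  finally show ?thesis by simp
qed

lemma norm_cell_op_le:
  "norm (cell_op t j H f x) \<le> (\<Sum>y\<in>cell t j x. norm (H (y - x)) * norm (f y)) / 2 ^ j"
  unfolding cell_op_def norm_divide norm_power
  by (simp add: divide_right_mono sum_norm_le norm_mult)

lemma cell_op_young:
  fixes f :: "int \<Rightarrow> real" and p :: nat
  assumes p: "1 < p" and q: "1 / real p + 1 / q = 1" "1 < q" and f: "\<And>y. 0 \<le> f y" and \<theta>: "0 < \<theta>"
    and H: "(\<Sum>y\<in>cell t j x. norm (H (y - x)) ^ p) \<le> V * 2 ^ j"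
    and F: "(\<Sum>y\<in>cell t j x. f y powr q) \<le> U * 2 ^ j"
  shows "norm (cell_op t j H (\<lambda>y. of_real (f y)) x) \<le> \<theta> powr p * V + \<theta> powr (- q) * U"
proof -
  have "norm (H (y - x)) * norm (complex_of_real (f y)) \<le>
      \<theta> powr p * norm (H (y - x)) ^ p + \<theta> powr (- q) * f y powr q" for y
  proof -
    have "norm (H (y - x)) * f y = (\<theta> * norm (H (y - x))) * (f y / \<theta>)" using \<theta> by simp
    also have "\<dots> \<le> (\<theta> * norm (H (y - x))) powr p + (f y / \<theta>) powr q"
      using p q \<theta> f by (intro young_le) auto
    also have "(\<theta> * norm (H (y - x))) powr p = \<theta> powr p * norm (H (y - x)) ^ p"
      using \<theta> p by (simp add: powr_mult powr_realpow')
    also have "(f y / \<theta>) powr q = \<theta> powr (- q) * f y powr q"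
      using \<theta> f by (simp add: powr_divide powr_minus field_simps)
    finally show ?thesis using f by simp
  qed
  then have "(\<Sum>y\<in>cell t j x. norm (H (y - x)) * norm (complex_of_real (f y))) \<le>
      (\<Sum>y\<in>cell t j x. \<theta> powr p * norm (H (y - x)) ^ p + \<theta> powr (- q) * f y powr q)"
    by (rule sum_mono)
  also have "\<dots> = \<theta> powr p * (\<Sum>y\<in>cell t j x. norm (H (y - x)) ^ p) + \<theta> powr (- q) * (\<Sum>y\<in>cell t j x. f y powr q)"
    by (simp add: sum.distrib sum_distrib_left)
  also have "\<dots> \<le> \<theta> powr p * (V * 2 ^ j) + \<theta> powr (- q) * (U * 2 ^ j)"
    by (intro add_mono mult_left_mono H F) auto
  also have "\<dots> = (\<theta> powr p * V + \<theta> powr (- q) * U) * 2 ^ j" by (simp add: algebra_simps)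
  finally have "(\<Sum>y\<in>cell t j x. norm (H (y - x)) * norm (complex_of_real (f y))) / 2 ^ j \<le>
      \<theta> powr p * V + \<theta> powr (- q) * U" by (simp add: divide_le_eq)
  then show ?thesis using norm_cell_op_le[of t j H "\<lambda>y. of_real (f y)" x] by linarith
qed

text \<open>The constant \<open>C'\<close> serves for every piece with parameter \<open>z\<close>, provided that the mean of the
\<open>r\<close>-th power of \<open>f\<close> over the selected cells is at most 4 and that of the \<open>s\<close>-th power of \<open>g\<close> over
the ambient cell is at most 1: a loss
\<open>z powr (- \<epsilon>)\<close> in the \<open>p\<close>-th moment and a gain \<open>z powr \<gamma>\<close> on \<open>\<ell>\<^sup>2\<close> yield the bound
\<open>C' * z powr \<nu>\<close>. For a band \<open>z = 2 ^ (- i)\<close>, for the tail \<open>z = 2 ^ (- j)\<close>.\<close>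

definition interpolates ::
    "real \<Rightarrow> real \<Rightarrow> real \<Rightarrow> nat \<Rightarrow> real \<Rightarrow> real \<Rightarrow> real \<Rightarrow> real \<Rightarrow> bool" where
  "interpolates r s \<gamma> p \<epsilon> \<nu> C C' \<longleftrightarrow> (\<forall>z t m w X jx f g H.
    0 < z \<longrightarrow> z \<le> 1 \<longrightarrow> X \<subseteq> cell t m w \<longrightarrow> (\<forall>y. 0 \<le> f y) \<longrightarrow> (\<forall>y. 0 \<le> g y) \<longrightarrow>
    (\<forall>x\<in>X. (\<Sum>y\<in>cell t (jx x) x. f y powr r) \<le> 4 * 2 ^ jx x) \<longrightarrow>
    (\<Sum>y\<in>cell t m w. g y powr s) \<le> 2 ^ m \<longrightarrow>
    (\<forall>x\<in>X. (\<Sum>y\<in>cell t (jx x) x. norm (H (jx x) (y - x)) ^ p) \<le> C * z powr (- \<epsilon>) * 2 ^ jx x) \<longrightarrow>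
    (\<forall>f. (\<Sum>x\<in>X. (norm (cell_op t (jx x) (H (jx x)) f x))\<^sup>2) \<le> (C * z powr \<gamma>)\<^sup>2 * (\<Sum>y\<in>cell t m w. (norm (f y))\<^sup>2)) \<longrightarrow>
    (\<Sum>x\<in>X. g x * norm (cell_op t (jx x) (H (jx x)) (\<lambda>y. of_real (f y)) x)) \<le> C' * z powr \<nu> * 2 ^ m)"

text \<open>Truncate both functions at the height \<open>h = z powr (- \<eta>)\<close>. The large part of \<open>f\<close> has a small
\<open>q\<close>-mean, with \<open>q < r\<close> conjugate to \<open>p\<close>, and the large part of \<open>g\<close> has a small mean; both
outweigh the loss. The bounded parts have \<open>\<ell>\<^sup>2\<close>-means at most \<open>h\<close>, which costs only half of the
gain when \<open>\<eta> = \<gamma> / 4\<close>.\<close>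

lemma truncation_interpolation:
  fixes r s \<gamma> :: real and p :: nat
  assumes r: "1 < r" and s: "1 < s" and p: "r / (r - 1) < real p" and \<gamma>: "0 < \<gamma>"
  shows "\<exists>\<epsilon>>0. \<exists>\<nu>>0. \<forall>C>0. \<exists>C'>0. interpolates r s \<gamma> p \<epsilon> \<nu> C C'"
proof -
  have r1: "1 < r / (r - 1)" using r by (simp add: field_simps)
  have p1: "1 < p" using p r1 by simp
  define q where "q = real p / (real p - 1)"
  have q: "1 / real p + 1 / q = 1" "1 < q"
    using p1 by (simp_all add: q_def field_simps)
  have qr: "q < r"
  proof -
    have "r < real p * (r - 1)" using p r by (simp add: divide_less_eq)
    then have "real p < r * (real p - 1)" by (simp add: algebra_simps)
    then show ?thesis using p1 by (simp add: q_def divide_less_eq)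
  qed
  define \<eta> where "\<eta> = \<gamma> / 4"
  \<comment> \<open>the parameter \<open>z powr \<sigma>\<close> balances the two terms of Young's inequality\<close>
  define \<sigma> where "\<sigma> = \<eta> * (r - q) / (2 * q)"
  have \<eta>: "0 < \<eta>" using \<gamma> by (simp add: \<eta>_def)
  have \<sigma>: "0 < \<sigma>" "\<sigma> * q = \<eta> * (r - q) / 2" using \<eta> qr q by (simp_all add: \<sigma>_def)
  define \<epsilon> where "\<epsilon> = min (real p * \<sigma> / 2) (\<eta> * (s - 1) / 2)"
  define \<nu> where "\<nu> = min (min (real p * \<sigma> / 2) (\<eta> * (r - q) / 2)) (min (\<eta> * (s - 1) / 2) (\<gamma> / 2))"
  have \<epsilon>: "0 < \<epsilon>" "\<epsilon> \<le> real p * \<sigma> / 2" "\<epsilon> \<le> \<eta> * (s - 1) / 2"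
    using p1 \<sigma> \<eta> s by (simp_all add: \<epsilon>_def)
  have \<nu>: "0 < \<nu>" "\<nu> \<le> real p * \<sigma> / 2" "\<nu> \<le> \<eta> * (r - q) / 2" "\<nu> \<le> \<eta> * (s - 1) / 2" "\<nu> \<le> \<gamma> / 2"
    using p1 \<sigma> \<eta> s qr \<gamma> by (auto simp: \<nu>_def)
  show ?thesis
  proof (rule exI[of _ \<epsilon>], intro conjI \<epsilon>(1), rule exI[of _ \<nu>], intro conjI \<nu>(1) allI impI)
    fix C :: real assume C: "0 < C"
    show "\<exists>C'>0. interpolates r s \<gamma> p \<epsilon> \<nu> C C'"
      unfolding interpolates_def
    proof (rule exI[of _ "2 * (C + 4) + (C + 5) + C"], intro conjI allI impI)
      show "0 < 2 * (C + 4) + (C + 5) + C" using C by simp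
    next
      fix z :: real and t m w and X :: "int set" and jx :: "int \<Rightarrow> nat" and f g :: "int \<Rightarrow> real"
        and H :: "nat \<Rightarrow> int \<Rightarrow> complex"
      assume z: "0 < z" "z \<le> 1" and X: "X \<subseteq> cell t m w" and f0: "\<forall>y. 0 \<le> f y" and g0: "\<forall>y. 0 \<le> g y"
        and fr: "\<forall>x\<in>X. (\<Sum>y\<in>cell t (jx x) x. f y powr r) \<le> 4 * 2 ^ jx x"
        and gs: "(\<Sum>y\<in>cell t m w. g y powr s) \<le> 2 ^ m"
        and H: "\<forall>x\<in>X. (\<Sum>y\<in>cell t (jx x) x. norm (H (jx x) (y - x)) ^ p) \<le> C * z powr (- \<epsilon>) * 2 ^ jx x"
        and G: "\<forall>f. (\<Sum>x\<in>X. (norm (cell_op t (jx x) (H (jx x)) f x))\<^sup>2) \<le> (C * z powr \<gamma>)\<^sup>2 * (\<Sum>y\<in>cell t m w. (norm (f y))\<^sup>2)"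
      have zmono: "z powr a \<le> z powr b" if "b \<le> a" for a b
        using z that by (intro powr_mono') auto
      have fX: "finite X" using X by (rule finite_subset) simp
      define h where "h = z powr (- \<eta>)"
      have h0: "0 < h" using z by (simp add: h_def)
      define f1 where "f1 y = (if f y \<le> h then f y else 0)" for y
      define f2 where "f2 y = (if f y \<le> h then 0 else f y)" for y
      define g1 where "g1 y = (if g y \<le> h then g y else 0)" for y
      define g2 where "g2 y = (if g y \<le> h then 0 else g y)" for y
      let ?O = "\<lambda>f x. cell_op t (jx x) (H (jx x)) (\<lambda>y. complex_of_real (f y)) x"
      have split: "?O f x = ?O f1 x + ?O f2 x" for x
        unfolding cell_op_def add_divide_distrib[symmetric] sum.distrib[symmetric] distrib_left[symmetric]
        by (intro arg_cong2[of _ _ _ _ "(/)"] sum.cong refl) (auto simp: f1_def f2_def)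
      have gsplit: "g x = g1 x + g2 x" for x by (simp add: g1_def g2_def)
      have pos: "0 \<le> f1 y" "0 \<le> f2 y" "0 \<le> g1 y" "0 \<le> g2 y" for y
        using f0 g0 by (simp_all add: f1_def f2_def g1_def g2_def)
      have big: "u powr a \<le> h powr (a - b) * u powr b" if "h < u" "a \<le> b" for u a b
      proof -
        have "u powr a = u powr (a - b) * u powr b" by (simp add: powr_add[symmetric])
        also have "\<dots> \<le> h powr (a - b) * u powr b"
          using that h0 by (intro mult_right_mono powr_mono2') auto
        finally show ?thesis .
      qed
      have gI: "(\<Sum>x\<in>X. g x) \<le> 2 * 2 ^ m"
      proof -
        have "g y \<le> 1 + g y powr s" for y
        proof (cases "g y \<le> 1")
          case False
          then have "g y powr 1 \<le> g y powr s" using s by (intro powr_mono) auto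
          then show ?thesis using False by simp
        qed (simp add: add_increasing2)
        then have "(\<Sum>x\<in>cell t m w. g x) \<le> (\<Sum>x\<in>cell t m w. 1 + g x powr s)" by (rule sum_mono)
        also have "\<dots> \<le> 2 * 2 ^ m" using gs by (simp add: sum.distrib)
        finally show ?thesis using sum_mono2[OF _ X, of g] g0 by force
      qed
      have g2I: "(\<Sum>x\<in>X. g2 x) \<le> z powr (\<eta> * (s - 1)) * 2 ^ m"
      proof -
        have "g2 y \<le> z powr (\<eta> * (s - 1)) * g y powr s" for y
        proof (cases "g y \<le> h")
          case False
          then have "g y powr 1 \<le> h powr (1 - s) * g y powr s" using s by (intro big) auto
          moreover have "h powr (1 - s) = z powr (\<eta> * (s - 1))"
            by (simp add: h_def powr_powr algebra_simps)
          ultimately show ?thesis using False h0 by (simp add: g2_def)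
        qed (simp add: g2_def)
        then have "(\<Sum>x\<in>cell t m w. g2 x) \<le> (\<Sum>x\<in>cell t m w. z powr (\<eta> * (s - 1)) * g x powr s)"
          by (rule sum_mono)
        also have "\<dots> \<le> z powr (\<eta> * (s - 1)) * 2 ^ m"
          unfolding sum_distrib_left[symmetric] using gs by (intro mult_left_mono) auto
        finally show ?thesis using sum_mono2[OF _ X, of g2] pos by force
      qed
      have O2: "norm (?O f2 x) \<le> (C + 4) * z powr \<nu>" if x: "x \<in> X" for x
      proof -
        have "f2 y powr q \<le> h powr (q - r) * f y powr r" for y
          using qr big[of "f y" q r] by (simp add: f2_def)
        then have "(\<Sum>y\<in>cell t (jx x) x. f2 y powr q) \<le> (\<Sum>y\<in>cell t (jx x) x. h powr (q - r) * f y powr r)"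
          by (rule sum_mono)
        also have "\<dots> \<le> h powr (q - r) * (4 * 2 ^ jx x)"
          unfolding sum_distrib_left[symmetric] using fr x by (intro mult_left_mono) auto
        finally have F2: "(\<Sum>y\<in>cell t (jx x) x. f2 y powr q) \<le> (4 * h powr (q - r)) * 2 ^ jx x" by simp
        have "norm (?O f2 x) \<le> (z powr \<sigma>) powr p * (C * z powr (- \<epsilon>)) + (z powr \<sigma>) powr (- q) * (4 * h powr (q - r))"
          by (rule cell_op_young[OF p1 q pos(2) _ _ F2]) (use H x z in auto)
        also have "(z powr \<sigma>) powr p * (C * z powr (- \<epsilon>)) = C * z powr (real p * \<sigma> - \<epsilon>)"
          by (simp add: powr_powr powr_add[symmetric] mult.commute mult.left_commute)
        also have "(z powr \<sigma>) powr (- q) * (4 * h powr (q - r)) = 4 * z powr (\<eta> * (r - q) - \<sigma> * q)"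
          by (simp add: h_def powr_powr powr_add[symmetric] algebra_simps)
        also have "C * z powr (real p * \<sigma> - \<epsilon>) \<le> C * z powr \<nu>"
          using C \<epsilon> \<nu> by (intro mult_left_mono zmono) auto
        also have "4 * z powr (\<eta> * (r - q) - \<sigma> * q) \<le> 4 * z powr \<nu>"
          using \<sigma>(2) \<nu> by (intro mult_left_mono zmono) auto
        finally show ?thesis by (simp add: distrib_right)
      qed
      have O1: "norm (?O f1 x) \<le> (C + 5) * z powr (- \<epsilon>)" if x: "x \<in> X" for x
      proof -
        have "f1 y powr q \<le> 1 + f y powr r" for y
        proof (cases "f1 y \<le> 1")
          case True
          then have "f1 y powr q \<le> 1 powr q" using pos q by (intro powr_mono2) auto
          then show ?thesis by (simp add: add_increasing2)
        next
          case False
          then have "f1 y = f y" by (auto simp: f1_def split: if_splits)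
          then have "f1 y powr q \<le> f y powr r" using False qr by (simp add: powr_mono)
          then show ?thesis by simp
        qed
        then have "(\<Sum>y\<in>cell t (jx x) x. f1 y powr q) \<le> (\<Sum>y\<in>cell t (jx x) x. 1 + f y powr r)"
          by (rule sum_mono)
        also have "\<dots> \<le> 5 * 2 ^ jx x" using fr x by (simp add: sum.distrib)
        finally have F1: "(\<Sum>y\<in>cell t (jx x) x. f1 y powr q) \<le> 5 * 2 ^ jx x" .
        have "norm (?O f1 x) \<le> 1 powr p * (C * z powr (- \<epsilon>)) + 1 powr (- q) * 5"
          by (rule cell_op_young[OF p1 q pos(1) _ _ F1]) (use H x in auto)
        also have "\<dots> \<le> C * z powr (- \<epsilon>) + 5 * z powr (- \<epsilon>)"
          using zmono[of "- \<epsilon>" 0] z \<epsilon> by simp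
        finally show ?thesis by (simp add: distrib_right)
      qed
      have A: "(\<Sum>x\<in>X. g x * norm (?O f2 x)) \<le> 2 * (C + 4) * z powr \<nu> * 2 ^ m"
      proof -
        have "(\<Sum>x\<in>X. g x * norm (?O f2 x)) \<le> (\<Sum>x\<in>X. g x * ((C + 4) * z powr \<nu>))"
          using g0 O2 by (intro sum_mono mult_left_mono) auto
        also have "\<dots> = (\<Sum>x\<in>X. g x) * ((C + 4) * z powr \<nu>)" by (simp add: sum_distrib_right)
        also have "\<dots> \<le> (2 * 2 ^ m) * ((C + 4) * z powr \<nu>)"
          using gI C by (intro mult_right_mono) auto
        also have "\<dots> = 2 * (C + 4) * z powr \<nu> * 2 ^ m" by (simp only: mult.assoc mult.commute mult.left_commute)
        finally show ?thesis .
      qed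
      have B: "(\<Sum>x\<in>X. g2 x * norm (?O f1 x)) \<le> (C + 5) * z powr \<nu> * 2 ^ m"
      proof -
        have "(\<Sum>x\<in>X. g2 x * norm (?O f1 x)) \<le> (\<Sum>x\<in>X. g2 x * ((C + 5) * z powr (- \<epsilon>)))"
          using pos O1 by (intro sum_mono mult_left_mono) auto
        also have "\<dots> = (\<Sum>x\<in>X. g2 x) * ((C + 5) * z powr (- \<epsilon>))" by (simp add: sum_distrib_right)
        also have "\<dots> \<le> (z powr (\<eta> * (s - 1)) * 2 ^ m) * ((C + 5) * z powr (- \<epsilon>))"
          using g2I C by (intro mult_right_mono) auto
        also have "\<dots> = (C + 5) * z powr (\<eta> * (s - 1) - \<epsilon>) * 2 ^ m"
        proof -
          have e: "z powr (\<eta> * (s - 1) - \<epsilon>) = z powr (\<eta> * (s - 1)) * z powr (- \<epsilon>)"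
            by (simp add: powr_add[symmetric])
          have alg: "a * b * (c * d) = c * (a * d) * b" for a b c d :: real by (simp only: mult_ac)
          show ?thesis unfolding e by (rule alg)
        qed
        also have "\<dots> \<le> (C + 5) * z powr \<nu> * 2 ^ m"
          using C \<epsilon> \<nu> by (intro mult_right_mono mult_left_mono zmono) auto
        finally show ?thesis .
      qed
      have D: "(\<Sum>x\<in>X. g1 x * norm (?O f1 x)) \<le> C * z powr \<nu> * 2 ^ m"
      proof -
        have sq: "(\<Sum>y\<in>cell t m w. (u y)\<^sup>2) \<le> h\<^sup>2 * 2 ^ m" if "\<And>y. 0 \<le> u y" "\<And>y. u y \<le> h" for u :: "int \<Rightarrow> real"
        proof -
          have "(\<Sum>y\<in>cell t m w. (u y)\<^sup>2) \<le> (\<Sum>y\<in>cell t m w. h\<^sup>2)"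
            using that by (intro sum_mono power_mono) auto
          also have "\<dots> = h\<^sup>2 * 2 ^ m" by simp
          finally show ?thesis .
        qed
        have "(\<Sum>x\<in>X. g1 x * norm (?O f1 x))\<^sup>2 \<le> (\<Sum>x\<in>X. (g1 x)\<^sup>2) * (\<Sum>x\<in>X. (norm (?O f1 x))\<^sup>2)"
          by (rule Cauchy_Schwarz_ineq_sum)
        also have "\<dots> \<le> (h\<^sup>2 * 2 ^ m) * ((C * z powr \<gamma>)\<^sup>2 * (h\<^sup>2 * 2 ^ m))"
        proof (rule mult_mono)
          have "(\<Sum>x\<in>X. (g1 x)\<^sup>2) \<le> (\<Sum>x\<in>cell t m w. (g1 x)\<^sup>2)" using X by (intro sum_mono2) auto
          also have "\<dots> \<le> h\<^sup>2 * 2 ^ m" using h0 pos by (intro sq) (auto simp: g1_def)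
          finally show "(\<Sum>x\<in>X. (g1 x)\<^sup>2) \<le> h\<^sup>2 * 2 ^ m" .
          have "(\<Sum>x\<in>X. (norm (?O f1 x))\<^sup>2) \<le> (C * z powr \<gamma>)\<^sup>2 * (\<Sum>y\<in>cell t m w. (norm (complex_of_real (f1 y)))\<^sup>2)"
            using G by blast
          also have "\<dots> = (C * z powr \<gamma>)\<^sup>2 * (\<Sum>y\<in>cell t m w. (f1 y)\<^sup>2)" by simp
          also have "\<dots> \<le> (C * z powr \<gamma>)\<^sup>2 * (h\<^sup>2 * 2 ^ m)"
            using h0 pos by (intro mult_left_mono sq) (auto simp: f1_def)
          finally show "(\<Sum>x\<in>X. (norm (?O f1 x))\<^sup>2) \<le> (C * z powr \<gamma>)\<^sup>2 * (h\<^sup>2 * 2 ^ m)" .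
        qed (auto simp: sum_nonneg)
        also have "\<dots> = (C * (z powr \<gamma> * (h * h)) * 2 ^ m)\<^sup>2"
        proof -
          have "(a\<^sup>2 * b) * ((c * d)\<^sup>2 * (a\<^sup>2 * b)) = (c * (d * (a * a)) * b)\<^sup>2" for a b c d :: real
            by (simp only: power2_eq_square mult_ac)
          then show ?thesis .
        qed
        also have "z powr \<gamma> * (h * h) = z powr (\<gamma> / 2)"
          by (simp add: h_def powr_add[symmetric] \<eta>_def)
        finally have "(\<Sum>x\<in>X. g1 x * norm (?O f1 x)) \<le> C * z powr (\<gamma> / 2) * 2 ^ m"
          by (rule power2_le_imp_le) (use C in simp)
        also have "\<dots> \<le> C * z powr \<nu> * 2 ^ m"
          using C \<nu> by (intro mult_right_mono mult_left_mono zmono) auto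
        finally show ?thesis .
      qed
      have "(\<Sum>x\<in>X. g x * norm (?O f x)) \<le>
          (\<Sum>x\<in>X. g x * norm (?O f2 x) + g2 x * norm (?O f1 x) + g1 x * norm (?O f1 x))"
      proof (rule sum_mono)
        fix x
        have "g x * norm (?O f x) \<le> g x * (norm (?O f1 x) + norm (?O f2 x))"
          unfolding split using g0 by (intro mult_left_mono norm_triangle_ineq) auto
        also have "\<dots> = g x * norm (?O f2 x) + g x * norm (?O f1 x)" by (simp add: distrib_left)
        also have "g x * norm (?O f1 x) = g2 x * norm (?O f1 x) + g1 x * norm (?O f1 x)"
          unfolding gsplit by (simp add: distrib_right)
        finally show "g x * norm (?O f x) \<le> g x * norm (?O f2 x) + g2 x * norm (?O f1 x) + g1 x * norm (?O f1 x)"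
          by simp
      qed
      also have "\<dots> \<le> 2 * (C + 4) * z powr \<nu> * 2 ^ m + (C + 5) * z powr \<nu> * 2 ^ m + C * z powr \<nu> * 2 ^ m"
        unfolding sum.distrib by (intro add_mono A B D)
      also have "\<dots> = (2 * (C + 4) + (C + 5) + C) * z powr \<nu> * 2 ^ m" by (simp add: algebra_simps)
      finally show "(\<Sum>x\<in>X. g x * norm (?O f x)) \<le> (2 * (C + 4) + (C + 5) + C) * z powr \<nu> * 2 ^ m" .
    qed
  qed
qed

section \<open>The linearised maximal operator on one cell\<close>

text \<open>Displacement 0 does not occur in the averages under study.\<close>

definition punctured_kernel :: "nat \<Rightarrow> int \<Rightarrow> complex" where
  "punctured_kernel j n = of_real (if n = 0 then 0 else divisor_kernel j n)"

lemma cell_op_sum: "cell_op t j (\<lambda>n. \<Sum>i\<in>A. H i n) f x = (\<Sum>i\<in>A. cell_op t j (H i) f x)"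
proof -
  have "(\<Sum>y\<in>cell t j x. (\<Sum>i\<in>A. H i (y - x)) * f y) = (\<Sum>i\<in>A. \<Sum>y\<in>cell t j x. H i (y - x) * f y)"
    by (subst sum.swap) (simp add: sum_distrib_right)
  then show ?thesis by (simp add: cell_op_def sum_divide_distrib)
qed

lemma cell_op_kern_eq:
  assumes "2 \<le> c"
  shows "cell_op t j (punctured_kernel j) f x = (\<Sum>i<j div c. cell_op t j (band j i) f x) + cell_op t j (tail c j) f x"
proof -
  have "punctured_kernel j = (\<lambda>n. (\<Sum>i<j div c. band j i n) + tail c j n)"
    unfolding punctured_kernel_def by (rule ext) (rule divisor_kernel_decomposition[OF assms])
  then show ?thesis by (simp only: cell_op_add cell_op_sum)
qed

lemma geometric_sum_powr_le:
  assumes "0 < \<nu>"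
  shows "(\<Sum>i<n. (2 powr (- real i)) powr \<nu>) \<le> 1 / (1 - 2 powr (- \<nu>))"
proof -
  have x: "0 < 2 powr (- \<nu>)" "2 powr (- \<nu>) < 1"
    using assms powr_less_mono[of "- \<nu>" 0 2] by auto
  have "(\<Sum>i<n. (2 powr (- real i)) powr \<nu>) = (\<Sum>i<n. (2 powr (- \<nu>)) ^ i)"
    by (intro sum.cong refl) (simp add: powr_powr powr_realpow[symmetric] mult.commute)
  also have "\<dots> \<le> (\<Sum>i. (2 powr (- \<nu>)) ^ i)"
    using x by (intro sum_le_suminf summable_geometric) auto
  also have "\<dots> = 1 / (1 - 2 powr (- \<nu>))" using x by (intro suminf_geometric) auto
  finally show ?thesis .
qed

text \<open>The factor \<open>i + 1\<close> is absorbed by giving up half of the exponential gain.\<close>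

lemma band_gain_powr:
  "\<exists>C>0. \<forall>i. 400 * (real i + 1) / 2 ^ i \<le> (C * (2 powr (- real i)) powr (1/4))\<^sup>2"
proof -
  define K :: real where "K = 400 * (1 / (1/2 * ln 2) * 2 powr (1/2))"
  have K: "0 < K" by (simp add: K_def)
  have "400 * (real i + 1) / 2 ^ i \<le> (sqrt K * (2 powr (- real i)) powr (1/4))\<^sup>2" for i
  proof -
    have "400 * (real i + 1) \<le> 400 * (1 / (1/2 * ln 2) * 2 powr (1/2 * real (i + 1)))"
      using nat_le_powr[of "1/2" "i + 1"] by simp
    also have "\<dots> = K * 2 powr (real i / 2)" by (simp add: K_def powr_add[symmetric] add_divide_distrib add.commute)
    finally have "400 * (real i + 1) / 2 ^ i \<le> K * 2 powr (real i / 2) / 2 powr (real i)"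
      by (simp add: powr_realpow divide_right_mono)
    also have "\<dots> = K * (2 powr (real i / 2) / 2 powr (real i))" by simp
    also have "2 powr (real i / 2) / 2 powr (real i) = 2 powr (- (real i / 2))"
      unfolding powr_diff[symmetric] by simp
    also have "K * 2 powr (- (real i / 2)) = (sqrt K * (2 powr (- real i)) powr (1/4))\<^sup>2"
    proof -
      have "((2 powr (- real i)) powr (1/4))\<^sup>2 = (2 powr (- (real i / 2)) :: real)"
        by (simp add: powr_powr power2_eq_square powr_add[symmetric])
      then show ?thesis unfolding power_mult_distrib using K by simp
    qed
    finally show ?thesis .
  qed
  then show ?thesis using K by (intro exI[of _ "sqrt K"]) auto
qed

lemma tail_gain_powr:
  assumes c: "0 < c"
  shows "\<exists>C>0. \<forall>j. 2 * ((12 * (real j + 2) / 2 ^ (j div c))\<^sup>2 + 1 / 2 ^ j) \<le>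
    (C * (2 powr (- real j)) powr (1 / (2 * real c)))\<^sup>2"
proof -
  define \<delta> where "\<delta> = 1 / (2 * real c)"
  have \<delta>: "0 < \<delta>" "2 * \<delta> \<le> 1" "\<delta> * real c = 1/2" using c by (simp_all add: \<delta>_def)
  define D where "D = 24 * (1 / (\<delta> * ln 2) * 2 powr (2 * \<delta>))"
  define K where "K = 2 * (D\<^sup>2 + 1)"
  have K: "0 < K" by (simp add: K_def add_nonneg_pos)
  have D0: "0 \<le> D" using \<delta> by (simp add: D_def)
  have "2 * ((12 * (real j + 2) / 2 ^ (j div c))\<^sup>2 + 1 / 2 ^ j) \<le> (sqrt K * (2 powr (- real j)) powr \<delta>)\<^sup>2" for j
  proof -
    have "real j = real (j div c) * real c + real (j mod c)"
      by (metis div_mult_mod_eq of_nat_add of_nat_mult)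
    then have "2 * \<delta> * real j = real (j div c) * (2 * (\<delta> * real c)) + 2 * \<delta> * real (j mod c)"
      by (simp add: algebra_simps)
    also have "\<dots> \<le> real (j div c) + 2 * \<delta> * real c"
    proof (rule add_mono)
      show "real (j div c) * (2 * (\<delta> * real c)) \<le> real (j div c)" unfolding \<delta>(3) by simp
      show "2 * \<delta> * real (j mod c) \<le> 2 * \<delta> * real c"
        using \<delta> c by (intro mult_left_mono of_nat_mono) (auto simp: less_imp_le)
    qed
    finally have jc: "2 * \<delta> * real j - 1 \<le> real (j div c)" using \<delta>(3) by simp
    have "12 * (real j + 2) \<le> 12 * (1 / (\<delta> * ln 2) * 2 powr (\<delta> * real (j + 2)))"
      using nat_le_powr[OF \<delta>(1), of "j + 2"] by simp
    also have "\<dots> = D / 2 * 2 powr (\<delta> * real j)"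
      by (simp add: D_def powr_add distrib_left mult.commute)
    finally have 1: "12 * (real j + 2) \<le> D / 2 * 2 powr (\<delta> * real j)" .
    have "2 powr (2 * \<delta> * real j) / 2 = 2 powr (2 * \<delta> * real j - 1)" by (simp add: powr_diff)
    also have "\<dots> \<le> 2 powr (real (j div c))" using jc by (intro powr_mono) auto
    finally have 2: "2 powr (2 * \<delta> * real j) / 2 \<le> 2 ^ (j div c)" by (simp add: powr_realpow)
    have "12 * (real j + 2) / 2 ^ (j div c) \<le> (D / 2 * 2 powr (\<delta> * real j)) / (2 powr (2 * \<delta> * real j) / 2)"
      by (rule frac_le) (use 1 2 D0 in auto)
    also have "\<dots> = D * (2 powr (\<delta> * real j) / 2 powr (2 * \<delta> * real j))" by simp
    also have "2 powr (\<delta> * real j) / 2 powr (2 * \<delta> * real j) = 2 powr (- (\<delta> * real j))"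
      by (simp add: powr_diff[symmetric])
    finally have "(12 * (real j + 2) / 2 ^ (j div c))\<^sup>2 \<le> (D * 2 powr (- (\<delta> * real j)))\<^sup>2"
      by (intro power_mono) auto
    also have "\<dots> = D\<^sup>2 * 2 powr (- (2 * \<delta> * real j))"
      by (simp add: power_mult_distrib powr_power mult.assoc)
    finally have 3: "(12 * (real j + 2) / 2 ^ (j div c))\<^sup>2 \<le> D\<^sup>2 * 2 powr (- (2 * \<delta> * real j))" .
    have "2 * \<delta> * real j \<le> 1 * real j" using \<delta> by (intro mult_right_mono) auto
    then have "2 powr (- real j) \<le> 2 powr (- (2 * \<delta> * real j))" by (intro powr_mono) auto
    then have 4: "1 / 2 ^ j \<le> 2 powr (- (2 * \<delta> * real j))"
      by (simp add: powr_minus powr_realpow inverse_eq_divide)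
    have "2 * ((12 * (real j + 2) / 2 ^ (j div c))\<^sup>2 + 1 / 2 ^ j) \<le>
        2 * (D\<^sup>2 * 2 powr (- (2 * \<delta> * real j)) + 2 powr (- (2 * \<delta> * real j)))"
      using 3 4 by (intro mult_left_mono add_mono) auto
    also have "\<dots> = K * 2 powr (- (2 * \<delta> * real j))" by (simp add: K_def algebra_simps)
    also have "\<dots> = (sqrt K * (2 powr (- real j)) powr \<delta>)\<^sup>2"
    proof -
      have "((2 powr (- real j)) powr \<delta>)\<^sup>2 = (2 powr (- (2 * \<delta> * real j)) :: real)"
        by (simp add: powr_powr power2_eq_square powr_add[symmetric] mult.commute mult.left_commute)
      then show ?thesis unfolding power_mult_distrib using K by simp
    qed
    finally show ?thesis .
  qed
  then show ?thesis using K unfolding \<delta>_def by (intro exI[of _ "sqrt K"]) auto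
qed

text \<open>Each band, restricted to the points whose selected scale is large enough, and the tail at each single scale are
pieces in the sense of \<open>interpolates\<close>. Their bounds form two geometric series.\<close>

lemma local_bound_normalized:
  fixes r s :: real
  assumes r: "1 < r" and s: "1 < s"
  shows "\<exists>C>0. \<forall>t m w X jx f g. X \<subseteq> cell t m w \<longrightarrow> (\<forall>x\<in>X. jx x \<le> m) \<longrightarrow>
    (\<forall>y. 0 \<le> f y) \<longrightarrow> (\<forall>y. 0 \<le> g y) \<longrightarrow>
    (\<forall>x\<in>X. (\<Sum>y\<in>cell t (jx x) x. f y powr r) \<le> 4 * 2 ^ jx x) \<longrightarrow>
    (\<Sum>y\<in>cell t m w. g y powr s) \<le> 2 ^ m \<longrightarrow>
    (\<Sum>x\<in>X. g x * norm (cell_op t (jx x) (punctured_kernel (jx x)) (\<lambda>y. of_real (f y)) x)) \<le> C * 2 ^ m"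
proof -
  obtain p :: nat where p: "r / (r - 1) < real p" using reals_Archimedean2 by blast
  have "0 < r / (r - 1)" using r by simp
  then have p0: "0 < p" using p by (cases p) auto
  \<comment> \<open>\<open>c \<ge> p\<close> is needed for the moments and \<open>c \<ge> 4\<close> for almost orthogonality in the bands\<close>
  define c where "c = p + 4"
  have c: "2 \<le> c" "p \<le> c" "4 \<le> c" "0 < c" by (simp_all add: c_def)
  define \<gamma> where "\<gamma> = 1 / (2 * real c)"
  have \<gamma>: "0 < \<gamma>" "\<gamma> \<le> 1/4" using c by (simp_all add: \<gamma>_def field_simps)
  obtain \<epsilon> \<nu> where \<epsilon>: "0 < \<epsilon>" and \<nu>: "0 < \<nu>" and
TI: "\<And>C. 0 < C \<Longrightarrow> \<exists>C'>0. interpolates r s \<gamma> p \<epsilon> \<nu> C C'"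
    using truncation_interpolation[OF r s p \<gamma>(1)] by blast
  obtain C1 where C1: "0 < C1" and band_loss: "\<And>i j t x z. p * (i + 1) \<le> j \<Longrightarrow>
    (\<Sum>y\<in>cell t j z. norm (band j i (y - x)) ^ p) \<le> C1 * 2 powr (\<epsilon> * real i) * 2 ^ j"
    using band_loss[OF \<epsilon> p0] by metis
  obtain C2 where C2: "0 < C2" and tail_loss: "\<And>j t x.
    (\<Sum>y\<in>cell t j x. norm (tail c j (y - x)) ^ p) \<le> C2 * 2 powr (\<epsilon> * real j) * 2 ^ j"
    using tail_loss[OF \<epsilon> p0 c(1,2)] by metis
  obtain C3 where C3: "0 < C3" and g3: "\<And>i. 400 * (real i + 1) / 2 ^ i \<le> (C3 * (2 powr (- real i)) powr (1/4))\<^sup>2"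
    using band_gain_powr by metis
  obtain C4 where C4: "0 < C4" and g4: "\<And>j. 2 * ((12 * (real j + 2) / 2 ^ (j div c))\<^sup>2 + 1 / 2 ^ j) \<le>
    (C4 * (2 powr (- real j)) powr \<gamma>)\<^sup>2"
    using tail_gain_powr[OF c(4)] unfolding \<gamma>_def by metis
  define C5 where "C5 = C1 + C2 + C3 + C4"
  have C5: "0 < C5" "C1 \<le> C5" "C2 \<le> C5" "C3 \<le> C5" "C4 \<le> C5" using C1 C2 C3 C4 by (simp_all add: C5_def)
  obtain C6 where C6: "0 < C6" and intp: "interpolates r s \<gamma> p \<epsilon> \<nu> C5 C6"
    using TI[OF C5(1)] by blast
  have piece: "
      0 < z \<Longrightarrow> z \<le> 1 \<Longrightarrow> X \<subseteq> cell t m w \<Longrightarrow> (\<forall>y. 0 \<le> f y) \<Longrightarrow> (\<forall>y. 0 \<le> g y) \<Longrightarrow>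
      (\<forall>x\<in>X. (\<Sum>y\<in>cell t (jx x) x. f y powr r) \<le> 4 * 2 ^ jx x) \<Longrightarrow>
      (\<Sum>y\<in>cell t m w. g y powr s) \<le> 2 ^ m \<Longrightarrow>
      (\<forall>x\<in>X. (\<Sum>y\<in>cell t (jx x) x. norm (H (jx x) (y - x)) ^ p) \<le> C5 * z powr (- \<epsilon>) * 2 ^ jx x) \<Longrightarrow>
      (\<forall>f. (\<Sum>x\<in>X. (norm (cell_op t (jx x) (H (jx x)) f x))\<^sup>2) \<le> (C5 * z powr \<gamma>)\<^sup>2 * (\<Sum>y\<in>cell t m w. (norm (f y))\<^sup>2)) \<Longrightarrow>
      (\<Sum>x\<in>X. g x * norm (cell_op t (jx x) (H (jx x)) (\<lambda>y. of_real (f y)) x)) \<le> C6 * z powr \<nu> * 2 ^ m"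
    for z t m w X jx f g H
    by (rule intp[unfolded interpolates_def, THEN spec, THEN spec, THEN spec, THEN spec, THEN spec,
          THEN spec, THEN spec, THEN spec, THEN spec, THEN mp, THEN mp, THEN mp, THEN mp, THEN mp,
          THEN mp, THEN mp, THEN mp, THEN mp])
  define S where "S = 1 / (1 - 2 powr (- \<nu>))"
  have S: "(\<Sum>i<n. (2 powr (- real i)) powr \<nu>) \<le> S" for n
    unfolding S_def by (rule geometric_sum_powr_le[OF \<nu>])
  have S0: "0 < S" using \<nu> powr_less_mono[of "- \<nu>" 0 2] by (simp add: S_def)
  show ?thesis
  proof (intro exI[of _ "2 * C6 * S"] conjI allI impI)
    show "0 < 2 * C6 * S" using C6 S0 by simp
  next
    fix t m w and X :: "int set" and jx :: "int \<Rightarrow> nat" and f g :: "int \<Rightarrow> real"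
    assume X: "X \<subseteq> cell t m w" and jm: "\<forall>x\<in>X. jx x \<le> m" and f0: "\<forall>y. 0 \<le> f y" and g0: "\<forall>y. 0 \<le> g y"
      and fr: "\<forall>x\<in>X. (\<Sum>y\<in>cell t (jx x) x. f y powr r) \<le> 4 * 2 ^ jx x"
      and gs: "(\<Sum>y\<in>cell t m w. g y powr s) \<le> 2 ^ m"
    let ?f = "\<lambda>y. complex_of_real (f y)"
    have fX: "finite X" using X by (rule finite_subset) simp
    have z: "0 < 2 powr (- real i)" "2 powr (- real i) \<le> 1" for i
      using powr_mono[of "- real i" 0 2] by auto
    have z\<epsilon>: "(2 powr (- real i)) powr (- \<epsilon>) = 2 powr (\<epsilon> * real i)" for i
      by (simp add: powr_powr mult.commute)
    have sqmono: "(C * x)\<^sup>2 \<le> (C5 * y)\<^sup>2" if "0 < C" "C \<le> C5" "0 \<le> x" "x \<le> y" for C x y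
      using that C5 by (intro power_mono mult_mono) auto
    have bands: "(\<Sum>x | x \<in> X \<and> c * (i + 1) \<le> jx x. g x * norm (cell_op t (jx x) (band (jx x) i) ?f x))
        \<le> C6 * (2 powr (- real i)) powr \<nu> * 2 ^ m" for i
    proof (rule piece[where H = "\<lambda>j. band j i", OF z])
      let ?X = "{x. x \<in> X \<and> c * (i + 1) \<le> jx x}"
      show X': "?X \<subseteq> cell t m w" using X by auto
      show "\<forall>x\<in>?X. (\<Sum>y\<in>cell t (jx x) x. norm (band (jx x) i (y - x)) ^ p) \<le>
          C5 * (2 powr (- real i)) powr (- \<epsilon>) * 2 ^ jx x"
      proof
        fix x assume "x \<in> ?X"
        then have "c * (i + 1) \<le> jx x" by blast
        with mult_le_mono1[OF c(2)] have "p * (i + 1) \<le> jx x" by (rule le_trans)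
        then have "(\<Sum>y\<in>cell t (jx x) x. norm (band (jx x) i (y - x)) ^ p) \<le> C1 * 2 powr (\<epsilon> * real i) * 2 ^ jx x"
          by (rule band_loss)
        also have "\<dots> \<le> C5 * 2 powr (\<epsilon> * real i) * 2 ^ jx x" using C5 by (intro mult_right_mono) auto
        finally show "(\<Sum>y\<in>cell t (jx x) x. norm (band (jx x) i (y - x)) ^ p) \<le>
          C5 * (2 powr (- real i)) powr (- \<epsilon>) * 2 ^ jx x" by (simp only: z\<epsilon>)
      qed
      show "\<forall>f. (\<Sum>x\<in>?X. (norm (cell_op t (jx x) (band (jx x) i) f x))\<^sup>2) \<le>
          (C5 * (2 powr (- real i)) powr \<gamma>)\<^sup>2 * (\<Sum>y\<in>cell t m w. (norm (f y))\<^sup>2)"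
      proof
        fix f :: "int \<Rightarrow> complex"
        have "(\<Sum>x\<in>?X. (norm (cell_op t (jx x) (band (jx x) i) f x))\<^sup>2) \<le>
            400 * (real i + 1) / 2 ^ i * (\<Sum>y\<in>cell t m w. (norm (f y))\<^sup>2)"
        proof (rule band_gain[OF X'])
          fix x assume "x \<in> ?X"
          then have "c * (i + 1) \<le> jx x" "x \<in> X" by blast+
          moreover from mult_le_mono1[OF c(3)] this(1) have "4 * (i + 1) \<le> jx x" by (rule le_trans)
          ultimately show "4 * (i + 1) \<le> jx x \<and> jx x \<le> m" using jm by blast
        qed
        also have "\<dots> \<le> (C5 * (2 powr (- real i)) powr \<gamma>)\<^sup>2 * (\<Sum>y\<in>cell t m w. (norm (f y))\<^sup>2)"
        proof (rule mult_right_mono)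
          have "(2 powr (- real i)) powr (1/4) \<le> (2 powr (- real i)) powr \<gamma>"
            by (rule powr_mono'[OF \<gamma>(2) less_imp_le[OF z(1)] z(2)])
          then have "(C3 * (2 powr (- real i)) powr (1/4))\<^sup>2 \<le> (C5 * (2 powr (- real i)) powr \<gamma>)\<^sup>2"
            by (rule sqmono[OF C3 C5(4) powr_ge_zero])
          with g3[of i] show "400 * (real i + 1) / 2 ^ i \<le> (C5 * (2 powr (- real i)) powr \<gamma>)\<^sup>2"
            by (rule order_trans)
        qed (simp add: sum_nonneg)
        finally show "(\<Sum>x\<in>?X. (norm (cell_op t (jx x) (band (jx x) i) f x))\<^sup>2) \<le>
          (C5 * (2 powr (- real i)) powr \<gamma>)\<^sup>2 * (\<Sum>y\<in>cell t m w. (norm (f y))\<^sup>2)" .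
      qed
      show "\<forall>y. 0 \<le> f y" by (rule f0)
      show "\<forall>y. 0 \<le> g y" by (rule g0)
      show "(\<Sum>y\<in>cell t m w. g y powr s) \<le> 2 ^ m" by (rule gs)
      show "\<forall>x\<in>?X. (\<Sum>y\<in>cell t (jx x) x. f y powr r) \<le> 4 * 2 ^ jx x" using fr by blast
    qed
    have tails: "(\<Sum>x | x \<in> X \<and> jx x = j. g x * norm (cell_op t (jx x) (tail c (jx x)) ?f x))
        \<le> C6 * (2 powr (- real j)) powr \<nu> * 2 ^ m" if "j \<le> m" for j
    proof (rule piece[where H = "tail c", OF z])
      let ?X = "{x. x \<in> X \<and> jx x = j}"
      show X': "?X \<subseteq> cell t m w" using X by auto
      show "\<forall>x\<in>?X. (\<Sum>y\<in>cell t (jx x) x. norm (tail c (jx x) (y - x)) ^ p) \<le>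
          C5 * (2 powr (- real j)) powr (- \<epsilon>) * 2 ^ jx x"
      proof
        fix x assume x: "x \<in> ?X"
        have "(\<Sum>y\<in>cell t j x. norm (tail c j (y - x)) ^ p) \<le> C2 * 2 powr (\<epsilon> * real j) * 2 ^ j"
          by (rule tail_loss)
        also have "\<dots> \<le> C5 * 2 powr (\<epsilon> * real j) * 2 ^ j" using C5 by (intro mult_right_mono) auto
        finally show "(\<Sum>y\<in>cell t (jx x) x. norm (tail c (jx x) (y - x)) ^ p) \<le>
          C5 * (2 powr (- real j)) powr (- \<epsilon>) * 2 ^ jx x" using x by (simp add: z\<epsilon>)
      qed
      show "\<forall>f. (\<Sum>x\<in>?X. (norm (cell_op t (jx x) (tail c (jx x)) f x))\<^sup>2) \<le>
          (C5 * (2 powr (- real j)) powr \<gamma>)\<^sup>2 * (\<Sum>y\<in>cell t m w. (norm (f y))\<^sup>2)"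
      proof
        fix f :: "int \<Rightarrow> complex"
        have "(\<Sum>x\<in>?X. (norm (cell_op t (jx x) (tail c (jx x)) f x))\<^sup>2) = (\<Sum>x\<in>?X. (norm (cell_op t j (tail c j) f x))\<^sup>2)"
          by (intro sum.cong refl) auto
        also have "\<dots> \<le> 2 * ((12 * (real j + 2) / 2 ^ (j div c))\<^sup>2 + 1 / 2 ^ j) * (\<Sum>y\<in>cell t m w. (norm (f y))\<^sup>2)"
          by (rule tail_gain[OF X' that])
        also have "\<dots> \<le> (C5 * (2 powr (- real j)) powr \<gamma>)\<^sup>2 * (\<Sum>y\<in>cell t m w. (norm (f y))\<^sup>2)"
          by (rule mult_right_mono[OF order_trans[OF g4 sqmono[OF C4 C5(5) powr_ge_zero order_refl]]])
             (simp add: sum_nonneg)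
        finally show "(\<Sum>x\<in>?X. (norm (cell_op t (jx x) (tail c (jx x)) f x))\<^sup>2) \<le>
          (C5 * (2 powr (- real j)) powr \<gamma>)\<^sup>2 * (\<Sum>y\<in>cell t m w. (norm (f y))\<^sup>2)" .
      qed
      show "\<forall>y. 0 \<le> f y" by (rule f0)
      show "\<forall>y. 0 \<le> g y" by (rule g0)
      show "(\<Sum>y\<in>cell t m w. g y powr s) \<le> 2 ^ m" by (rule gs)
      show "\<forall>x\<in>?X. (\<Sum>y\<in>cell t (jx x) x. f y powr r) \<le> 4 * 2 ^ jx x" using fr by blast
    qed
    let ?T = "\<lambda>x. g x * norm (cell_op t (jx x) (tail c (jx x)) ?f x)"
    let ?B = "\<lambda>i x. g x * norm (cell_op t (jx x) (band (jx x) i) ?f x)"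
    have "(\<Sum>x\<in>X. g x * norm (cell_op t (jx x) (punctured_kernel (jx x)) ?f x)) \<le>
        (\<Sum>x\<in>X. (\<Sum>i<m. if c * (i + 1) \<le> jx x then ?B i x else 0) + (\<Sum>j\<le>m. if jx x = j then ?T x else 0))"
    proof (rule sum_mono)
      fix x assume x: "x \<in> X"
      have set: "{i \<in> {..<m}. c * (i + 1) \<le> jx x} = {..<jx x div c}"
      proof -
        have iff: "c * (i + 1) \<le> jx x \<longleftrightarrow> i < jx x div c" for i
        proof -
          have "c * (i + 1) \<le> jx x \<longleftrightarrow> i + 1 \<le> jx x div c"
            using less_eq_div_iff_mult_less_eq[OF c(4), of "i + 1" "jx x"] by (simp only: mult.commute)
          then show ?thesis by (simp only: Suc_eq_plus1[symmetric] Suc_le_eq)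
        qed
        have dm: "jx x div c \<le> m" using jm x by (meson div_le_dividend le_trans)
        show ?thesis
        proof (rule set_eqI)
          fix i
          show "i \<in> {i \<in> {..<m}. c * (i + 1) \<le> jx x} \<longleftrightarrow> i \<in> {..<jx x div c}"
            unfolding mem_Collect_eq lessThan_iff iff using dm by linarith
        qed
      qed
      have "norm (cell_op t (jx x) (punctured_kernel (jx x)) ?f x) \<le>
          (\<Sum>i<jx x div c. norm (cell_op t (jx x) (band (jx x) i) ?f x)) + norm (cell_op t (jx x) (tail c (jx x)) ?f x)"
        unfolding cell_op_kern_eq[OF c(1)]
        by (rule order_trans[OF norm_triangle_ineq add_right_mono[OF norm_sum]])
      then have "g x * norm (cell_op t (jx x) (punctured_kernel (jx x)) ?f x) \<le>
          g x * ((\<Sum>i<jx x div c. norm (cell_op t (jx x) (band (jx x) i) ?f x)) + norm (cell_op t (jx x) (tail c (jx x)) ?f x))"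
        by (rule mult_left_mono) (rule g0[rule_format])
      also have "\<dots> = (\<Sum>i<jx x div c. ?B i x) + ?T x" by (simp add: distrib_left sum_distrib_left)
      also have "(\<Sum>i<jx x div c. ?B i x) = (\<Sum>i<m. if c * (i + 1) \<le> jx x then ?B i x else 0)"
        unfolding set[symmetric] by (rule sum.inter_filter) simp
      also have "?T x = (\<Sum>j\<le>m. if jx x = j then ?T x else 0)"
        using jm x by simp
      finally show "g x * norm (cell_op t (jx x) (punctured_kernel (jx x)) ?f x) \<le>
          (\<Sum>i<m. if c * (i + 1) \<le> jx x then ?B i x else 0) + (\<Sum>j\<le>m. if jx x = j then ?T x else 0)" .
    qed
    also have "\<dots> = (\<Sum>i<m. \<Sum>x\<in>X. if c * (i + 1) \<le> jx x then ?B i x else 0) +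
        (\<Sum>j\<le>m. \<Sum>x\<in>X. if jx x = j then ?T x else 0)"
    proof -
      have "(\<Sum>x\<in>X. \<Sum>i<m. if c * (i + 1) \<le> jx x then ?B i x else 0) =
          (\<Sum>i<m. \<Sum>x\<in>X. if c * (i + 1) \<le> jx x then ?B i x else 0)" by (rule sum.swap)
      moreover have "(\<Sum>x\<in>X. \<Sum>j\<le>m. if jx x = j then ?T x else 0) =
          (\<Sum>j\<le>m. \<Sum>x\<in>X. if jx x = j then ?T x else 0)" by (rule sum.swap)
      ultimately show ?thesis by (simp only: sum.distrib)
    qed
    also have "\<dots> = (\<Sum>i<m. \<Sum>x | x \<in> X \<and> c * (i + 1) \<le> jx x. ?B i x) +
        (\<Sum>j\<le>m. \<Sum>x | x \<in> X \<and> jx x = j. ?T x)"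
      by (simp only: sum.inter_filter[OF fX])
    also have "\<dots> \<le> (\<Sum>i<m. C6 * (2 powr (- real i)) powr \<nu> * 2 ^ m) + (\<Sum>j\<le>m. C6 * (2 powr (- real j)) powr \<nu> * 2 ^ m)"
      by (intro add_mono sum_mono bands tails) auto
    also have "\<dots> = C6 * 2 ^ m * ((\<Sum>i<m. (2 powr (- real i)) powr \<nu>) + (\<Sum>j<Suc m. (2 powr (- real j)) powr \<nu>))"
      unfolding distrib_left sum_distrib_left lessThan_Suc_atMost by (simp only: mult_ac)
    also have "\<dots> \<le> C6 * 2 ^ m * (S + S)"
      using C6 by (intro mult_left_mono add_mono S) auto
    also have "\<dots> = 2 * C6 * S * 2 ^ m" by simp
    finally show "(\<Sum>x\<in>X. g x * norm (cell_op t (jx x) (punctured_kernel (jx x)) ?f x)) \<le> 2 * C6 * S * 2 ^ m" .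
  qed
qed

section \<open>Sparse domination on cells\<close>

definition mean :: "(int \<Rightarrow> real) \<Rightarrow> int set \<Rightarrow> real" where
  "mean \<phi> K = sum \<phi> K / real (card K)"

text \<open>Homogeneity removes the normalisation; if one of the two means vanishes, so does the left-hand side.\<close>

lemma local_bound:
  fixes r s :: real
  assumes r: "1 < r" and s: "1 < s"
  shows "\<exists>C>0. \<forall>t m w X jx f g. X \<subseteq> cell t m w \<longrightarrow> (\<forall>x\<in>X. jx x \<le> m) \<longrightarrow>
    (\<forall>y. 0 \<le> f y) \<longrightarrow> (\<forall>y. 0 \<le> g y) \<longrightarrow>
    (\<forall>x\<in>X. mean (\<lambda>y. f y powr r) (cell t (jx x) x) \<le> 4 * mean (\<lambda>y. f y powr r) (cell t m w)) \<longrightarrow>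
    (\<Sum>x\<in>X. g x * norm (cell_op t (jx x) (punctured_kernel (jx x)) (\<lambda>y. of_real (f y)) x)) \<le>
      C * (2 ^ m * mean (\<lambda>y. f y powr r) (cell t m w) powr (1 / r) * mean (\<lambda>y. g y powr s) (cell t m w) powr (1 / s))"
proof -
  obtain C where C: "0 < C" and bound: "\<forall>t m w X jx f g. X \<subseteq> cell t m w \<longrightarrow> (\<forall>x\<in>X. jx x \<le> m) \<longrightarrow>
    (\<forall>y. 0 \<le> f y) \<longrightarrow> (\<forall>y. 0 \<le> g y) \<longrightarrow>
    (\<forall>x\<in>X. (\<Sum>y\<in>cell t (jx x) x. f y powr r) \<le> 4 * 2 ^ jx x) \<longrightarrow>
    (\<Sum>y\<in>cell t m w. g y powr s) \<le> 2 ^ m \<longrightarrow>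
    (\<Sum>x\<in>X. g x * norm (cell_op t (jx x) (punctured_kernel (jx x)) (\<lambda>y. of_real (f y)) x)) \<le> C * 2 ^ m"
    using local_bound_normalized[OF r s] by (elim exE conjE)
  show ?thesis
  proof (intro exI[of _ C] conjI allI impI)
    fix t m w and X :: "int set" and jx :: "int \<Rightarrow> nat" and f g :: "int \<Rightarrow> real"
    assume X: "X \<subseteq> cell t m w" and jm: "\<forall>x\<in>X. jx x \<le> m" and f0: "\<forall>y. 0 \<le> f y" and g0: "\<forall>y. 0 \<le> g y"
      and fr: "\<forall>x\<in>X. mean (\<lambda>y. f y powr r) (cell t (jx x) x) \<le> 4 * mean (\<lambda>y. f y powr r) (cell t m w)"
    let ?L = "\<Sum>x\<in>X. g x * norm (cell_op t (jx x) (punctured_kernel (jx x)) (\<lambda>y. complex_of_real (f y)) x)"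
    define a where "a = mean (\<lambda>y. f y powr r) (cell t m w)"
    define b where "b = mean (\<lambda>y. g y powr s) (cell t m w)"
    have a0: "0 \<le> a" "0 \<le> b" by (simp_all add: a_def b_def mean_def sum_nonneg)
    have zero: "u y = 0" if "mean (\<lambda>y. u y powr p) (cell t m w) = 0" "y \<in> cell t m w" for u :: "int \<Rightarrow> real" and p y
    proof -
      have "(\<Sum>y\<in>cell t m w. u y powr p) = 0" using that(1) by (simp add: mean_def)
      then have "u y powr p = 0" using that(2) by (subst (asm) sum_nonneg_eq_0_iff) auto
      then show ?thesis by simp
    qed
    show "?L \<le> C * (2 ^ m * a powr (1 / r) * b powr (1 / s))"
    proof (cases "a = 0 \<or> b = 0")
      case True
      have "g x * norm (cell_op t (jx x) (punctured_kernel (jx x)) (\<lambda>y. complex_of_real (f y)) x) = 0" if x: "x \<in> X" for x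
      proof (cases "b = 0")
        case True
        then have "g x = 0" using zero[of g s x] x X by (auto simp: b_def)
        then show ?thesis by simp
      next
        case False
        then have a: "a = 0" using \<open>a = 0 \<or> b = 0\<close> by simp
        have "cell t (jx x) x \<subseteq> cell t m w"
          using cell_mono[of "jx x" m t x] cell_eq[of x t m w] x X jm by auto
        then have "f y = 0" if "y \<in> cell t (jx x) x" for y
          using zero[of f r y] a that by (auto simp: a_def)
        then show ?thesis by (simp add: cell_op_def)
      qed
      then have "?L = 0" by (intro sum.neutral) blast
      then show ?thesis using C by simp
    next
      case False
      then have ab: "0 < a" "0 < b" using a0 by auto
      define \<alpha> where "\<alpha> = a powr (1 / r)"
      define \<mu> where "\<mu> = b powr (1 / s)"
      have lm: "0 < \<alpha>" "0 < \<mu>" "\<alpha> powr r = a" "\<mu> powr s = b"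
        using ab r s by (simp_all add: \<alpha>_def \<mu>_def powr_powr)
      have sc: "cell_op t j H (\<lambda>y. complex_of_real (f y)) x = of_real \<alpha> * cell_op t j H (\<lambda>y. complex_of_real (f y / \<alpha>)) x" for j H x
        using lm by (simp add: cell_op_def sum_distrib_left sum_divide_distrib)
      have "(\<Sum>x\<in>X. g x / \<mu> * norm (cell_op t (jx x) (punctured_kernel (jx x)) (\<lambda>y. complex_of_real (f y / \<alpha>)) x)) \<le> C * 2 ^ m"
      proof (rule bound[THEN spec, THEN spec, THEN spec, THEN spec, THEN spec, THEN spec, THEN spec,
            THEN mp, THEN mp, THEN mp, THEN mp, THEN mp, THEN mp, OF X jm])
        show "\<forall>y. 0 \<le> f y / \<alpha>" "\<forall>y. 0 \<le> g y / \<mu>" using f0 g0 lm by auto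
        show "\<forall>x\<in>X. (\<Sum>y\<in>cell t (jx x) x. (f y / \<alpha>) powr r) \<le> 4 * 2 ^ jx x"
        proof
          fix x assume "x \<in> X"
          then have "mean (\<lambda>y. f y powr r) (cell t (jx x) x) \<le> 4 * a" using fr by (simp add: a_def)
          then have "(\<Sum>y\<in>cell t (jx x) x. f y powr r) / 2 ^ jx x \<le> 4 * a"
            by (simp add: mean_def)
          then have le: "(\<Sum>y\<in>cell t (jx x) x. f y powr r) \<le> 4 * a * 2 ^ jx x"
            by (simp only: pos_divide_le_eq zero_less_power zero_less_numeral)
          have "(\<Sum>y\<in>cell t (jx x) x. (f y / \<alpha>) powr r) = (\<Sum>y\<in>cell t (jx x) x. f y powr r) / a"
            using f0 lm by (simp add: powr_divide sum_divide_distrib)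
          moreover have "(\<Sum>y\<in>cell t (jx x) x. f y powr r) / a \<le> 4 * 2 ^ jx x"
            unfolding pos_divide_le_eq[OF ab(1)] using le by (simp only: mult_ac)
          ultimately show "(\<Sum>y\<in>cell t (jx x) x. (f y / \<alpha>) powr r) \<le> 4 * 2 ^ jx x" by simp
        qed
        have "(\<Sum>y\<in>cell t m w. (g y / \<mu>) powr s) = (\<Sum>y\<in>cell t m w. g y powr s) / b"
          using g0 lm by (simp add: powr_divide sum_divide_distrib)
        moreover have "(\<Sum>y\<in>cell t m w. g y powr s) = b * 2 ^ m" by (simp add: b_def mean_def)
        ultimately show "(\<Sum>y\<in>cell t m w. (g y / \<mu>) powr s) \<le> 2 ^ m" using ab by simp
      qed
      then have "\<alpha> * \<mu> * (\<Sum>x\<in>X. g x / \<mu> * norm (cell_op t (jx x) (punctured_kernel (jx x)) (\<lambda>y. complex_of_real (f y / \<alpha>)) x)) \<le> \<alpha> * \<mu> * (C * 2 ^ m)"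
        using lm by (intro mult_left_mono) auto
      moreover have "?L = \<alpha> * \<mu> * (\<Sum>x\<in>X. g x / \<mu> * norm (cell_op t (jx x) (punctured_kernel (jx x)) (\<lambda>y. complex_of_real (f y / \<alpha>)) x))"
        unfolding sc sum_distrib_left norm_mult using lm by (intro sum.cong refl) simp
      ultimately have "?L \<le> \<alpha> * \<mu> * (C * 2 ^ m)" by simp
      also have "\<dots> = C * (2 ^ m * a powr (1 / r) * b powr (1 / s))"
        unfolding \<alpha>_def \<mu>_def by (simp only: mult_ac)
      finally show ?thesis .
    qed
  qed (rule C)
qed

definition cells :: "int \<Rightarrow> int set set" where
  "cells t = {cell t j x | j x. True}"

lemma cells_finite_nonempty:
  assumes "K \<in> cells t" shows "finite K" "K \<noteq> {}" "0 < card K"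
proof -
  obtain j x where K: "K = cell t j x" using assms by (auto simp: cells_def)
  then show "finite K" "0 < card K" by simp_all
  then show "K \<noteq> {}" by auto
qed

lemma cells_nested:
  assumes "K \<in> cells t" "L \<in> cells t" "K \<inter> L \<noteq> {}"
  shows "K \<subseteq> L \<or> L \<subseteq> K"
proof -
  obtain j x k y where K: "K = cell t j x" "L = cell t k y" using assms by (auto simp: cells_def)
  obtain z where "z \<in> K" "z \<in> L" using assms(3) by auto
  then have "K = cell t j z" "L = cell t k z" using K by (auto simp: cell_eq)
  then show ?thesis using cell_mono[of j k t z] cell_mono[of k j t z] by (cases "j \<le> k") auto
qed

text \<open>Cells are nested or disjoint, so one may take for \<open>E\<close> of a cell the complement of the smaller members
contained in it. Disjointness is then automatic and only the measure condition remains.\<close>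

definition sparse_cells :: "int \<Rightarrow> int set set \<Rightarrow> bool" where
  "sparse_cells t S \<longleftrightarrow> finite S \<and> S \<subseteq> cells t \<and>
    (\<forall>K\<in>S. 2 * card (\<Union>{L \<in> S. L \<subset> K}) < card K)"

lemma sparse_cells_imp_sparse:
  assumes "sparse_cells t S" shows "sparse S"
proof -
  define E where "E K = K - \<Union>{L \<in> S. L \<subset> K}" for K
  have S: "S \<subseteq> cells t" "\<And>K. K \<in> S \<Longrightarrow> 2 * card (\<Union>{L \<in> S. L \<subset> K}) < card K"
    using assms by (auto simp: sparse_cells_def)
  have "int_interval K" if "K \<in> S" for K
  proof -
    from that S(1) have "K \<in> cells t" by blast
    then obtain j x where K: "K = cell t j x" by (auto simp: cells_def)
    define a where "a = t + 2 ^ j * ((x - t) div 2 ^ j)"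
    have "K = {a..a + 2 ^ j - 1}" unfolding K cell_interval a_def by auto
    moreover have "a \<le> a + 2 ^ j - 1" by simp
    ultimately show ?thesis unfolding int_interval_def by blast
  qed
  moreover have "E K \<subseteq> K \<and> real (card (E K)) > real (card K) / 2" if "K \<in> S" for K
  proof -
    have fin: "finite K" using that S(1) cells_finite_nonempty by blast
    have sub: "\<Union>{L \<in> S. L \<subset> K} \<subseteq> K" by auto
    have "card (E K) = card K - card (\<Union>{L \<in> S. L \<subset> K})"
      unfolding E_def by (rule card_Diff_subset[OF finite_subset[OF sub fin] sub])
    then have "card K < 2 * card (E K)" using S(2)[OF that] by linarith
    then have "real (card K) < real (2 * card (E K))" by (simp only: of_nat_less_iff)
    then show ?thesis by (auto simp: E_def)
  qed
  moreover have "disjoint_family_on E S"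
    unfolding disjoint_family_on_def
  proof (intro ballI impI)
    fix K L assume KL: "K \<in> S" "L \<in> S" "K \<noteq> L"
    show "E K \<inter> E L = {}"
    proof (cases "K \<inter> L = {}")
      case True
      then show ?thesis by (auto simp: E_def)
    next
      case False
      then have "K \<subset> L \<or> L \<subset> K" using cells_nested[of K t L] KL S(1) by blast
      then show ?thesis using KL by (auto simp: E_def)
    qed
  qed
  ultimately show ?thesis unfolding sparse_def by blast
qed

lemma sparse_cells_Union:
  assumes fin: "finite B" and dis: "\<And>J L. J \<in> B \<Longrightarrow> L \<in> B \<Longrightarrow> J \<noteq> L \<Longrightarrow> J \<inter> L = {}"
    and S: "\<And>J. J \<in> B \<Longrightarrow> sparse_cells t (S J) \<and> (\<forall>K\<in>S J. K \<subseteq> J)"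
  shows "sparse_cells t (\<Union>J\<in>B. S J)"
    and "sum \<Phi> (\<Union>J\<in>B. S J) = (\<Sum>J\<in>B. sum (\<Phi> :: int set \<Rightarrow> real) (S J))"
proof -
  have same: "J = J'" if "J \<in> B" "J' \<in> B" "K \<in> S J" "K' \<in> S J'" "K' \<subseteq> K" for J J' K K'
  proof -
    have "K' \<noteq> {}" using S[OF that(2)] that(4) cells_finite_nonempty by (auto simp: sparse_cells_def)
    moreover have "K' \<subseteq> J \<inter> J'" using S[OF that(1)] S[OF that(2)] that by blast
    ultimately show ?thesis using dis[OF that(1,2)] by blast
  qed
  show "sparse_cells t (\<Union>J\<in>B. S J)"
    unfolding sparse_cells_def
  proof (intro conjI ballI)
    show "finite (\<Union>J\<in>B. S J)" "(\<Union>J\<in>B. S J) \<subseteq> cells t"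
      using fin S unfolding sparse_cells_def by blast+
    fix K assume "K \<in> (\<Union>J\<in>B. S J)"
    then obtain J where J: "J \<in> B" "K \<in> S J" by auto
    have "{L \<in> (\<Union>J\<in>B. S J). L \<subset> K} = {L \<in> S J. L \<subset> K}"
      using same[OF J(1) _ J(2)] J by blast
    then show "2 * card (\<Union>{L \<in> (\<Union>J\<in>B. S J). L \<subset> K}) < card K"
      using S[OF J(1)] J(2) by (simp add: sparse_cells_def)
  qed
  show "sum \<Phi> (\<Union>J\<in>B. S J) = (\<Sum>J\<in>B. sum \<Phi> (S J))"
  proof (rule sum.UNION_disjoint[OF fin])
    show "\<forall>J\<in>B. finite (S J)" using S by (auto simp: sparse_cells_def)
    show "\<forall>J\<in>B. \<forall>J'\<in>B. J \<noteq> J' \<longrightarrow> S J \<inter> S J' = {}" using same by blast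
  qed
qed

text \<open>The recursion behind sparse domination, for an abstract nonnegative \<open>U\<close> in place of the maximal
operator and a local estimate \<open>loc\<close>. Let \<open>B\<close> consist of the maximal subcells on which the mean of
\<open>\<phi>\<close> exceeds four times its mean over \<open>K\<close>. Points of a member of \<open>B\<close> whose selected cell is no
longer than that member are left to the recursion; at all other points the selected cell is not bad, by
maximality, and \<open>loc\<close> applies. Comparing the sums of \<open>\<phi>\<close> shows that \<open>B\<close> fills at most a quarter of
\<open>K\<close>.\<close>

lemma sparse_domination_cell:
  fixes f g :: "int \<Rightarrow> real" and jx :: "int \<Rightarrow> nat" and \<phi> :: "int \<Rightarrow> real" and U :: "int \<Rightarrow> real"
  assumes \<phi>0: "\<And>y. 0 \<le> \<phi> y" and U0: "\<And>x. 0 \<le> U x" and \<Phi>0: "\<And>K. 0 \<le> \<Phi> K"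
    and loc: "\<And>m w X. X \<subseteq> cell t m w \<Longrightarrow> (\<forall>x\<in>X. jx x \<le> m) \<Longrightarrow>
      (\<forall>x\<in>X. mean \<phi> (cell t (jx x) x) \<le> 4 * mean \<phi> (cell t m w)) \<Longrightarrow> sum U X \<le> C * \<Phi> (cell t m w)"
    and K: "K \<in> cells t"
  shows "\<exists>S. sparse_cells t S \<and> (\<forall>L\<in>S. L \<subseteq> K) \<and> (\<Sum>x | x \<in> K \<and> 2 ^ jx x \<le> card K. U x) \<le> C * sum \<Phi> S"
  using K
proof (induction "card K" arbitrary: K rule: less_induct)
  case less
  note Kc = cells_finite_nonempty[OF less.prems]
  obtain m w where Kmw: "K = cell t m w" using less.prems by (auto simp: cells_def)
  define A where "A = mean \<phi> K"
  have A0: "0 \<le> A" using \<phi>0 by (simp add: A_def mean_def sum_nonneg)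
  define bad where "bad = {J \<in> cells t. J \<subset> K \<and> 4 * A < mean \<phi> J}"
  define B where "B = {J \<in> bad. \<forall>J'\<in>bad. J \<subseteq> J' \<longrightarrow> J' = J}"
  have finbad: "finite bad" by (rule finite_subset[of _ "Pow K"]) (use Kc in \<open>auto simp: bad_def\<close>)
  have finB: "finite B" using finbad by (simp add: B_def)
  have Bbad: "J \<in> cells t" "J \<subset> K" "4 * A < mean \<phi> J" if "J \<in> B" for J
    using that by (auto simp: B_def bad_def)
  have Bdis: "J \<inter> L = {}" if "J \<in> B" "L \<in> B" "J \<noteq> L" for J L
  proof (rule ccontr)
    assume "J \<inter> L \<noteq> {}"
    then have "J \<subseteq> L \<or> L \<subseteq> J" using cells_nested Bbad(1) that by blast
    then show False using that by (auto simp: B_def)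
  qed
  have Bmax: "\<exists>J'\<in>B. J \<subseteq> J'" if "J \<in> bad" for J
  proof -
    from finite_has_maximal2[OF finbad that]
    obtain J' where "J' \<in> bad" "J \<subseteq> J'" "\<forall>L\<in>bad. J' \<subseteq> L \<longrightarrow> L = J'" by auto
    then show ?thesis by (auto simp: B_def)
  qed
  have "\<forall>J\<in>B. \<exists>S. sparse_cells t S \<and> (\<forall>L\<in>S. L \<subseteq> J) \<and> (\<Sum>x | x \<in> J \<and> 2 ^ jx x \<le> card J. U x) \<le> C * sum \<Phi> S"
  proof
    fix J assume "J \<in> B"
    from psubset_card_mono[OF Kc(1) Bbad(2)[OF this]] Bbad(1)[OF this]
    show "\<exists>S. sparse_cells t S \<and> (\<forall>L\<in>S. L \<subseteq> J) \<and> (\<Sum>x | x \<in> J \<and> 2 ^ jx x \<le> card J. U x) \<le> C * sum \<Phi> S"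
      by (rule less.hyps)
  qed
  from bchoice[OF this] obtain SJ where SJ': "\<forall>J\<in>B. sparse_cells t (SJ J) \<and> (\<forall>L\<in>SJ J. L \<subseteq> J) \<and>
      (\<Sum>x | x \<in> J \<and> 2 ^ jx x \<le> card J. U x) \<le> C * sum \<Phi> (SJ J)"
    by (rule exE)
  have SJ1: "sparse_cells t (SJ J) \<and> (\<forall>L\<in>SJ J. L \<subseteq> J)" if "J \<in> B" for J
    using bspec[OF SJ' that] by blast
  have SJ2: "(\<Sum>x | x \<in> J \<and> 2 ^ jx x \<le> card J. U x) \<le> C * sum \<Phi> (SJ J)" if "J \<in> B" for J
    using bspec[OF SJ' that] by blast
  note SJ = SJ1 SJ2
  define S0 where "S0 = (\<Union>J\<in>B. SJ J)"
  have S0: "sparse_cells t S0" "sum \<Phi> S0 = (\<Sum>J\<in>B. sum \<Phi> (SJ J))"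
    unfolding S0_def by (rule sparse_cells_Union; use finB Bdis SJ(1) in blast)+
  have S0B: "L \<subseteq> \<Union>B" "L \<subset> K" if "L \<in> S0" for L
    using that SJ(1) Bbad(2) unfolding S0_def by blast+
  have cardB: "2 * card (\<Union>B) < card K"
  proof (cases "B = {}")
    case False
    then obtain J0 where "J0 \<in> B" by auto
    have sumK: "sum \<phi> K = A * real (card K)" using Kc by (simp add: A_def mean_def)
    have J: "4 * A * real (card J) \<le> sum \<phi> J" if "J \<in> B" for J
      using Bbad(3)[OF that] cells_finite_nonempty[OF Bbad(1)[OF that]]
      by (simp add: mean_def less_divide_eq)
    have cU: "card (\<Union>B) = (\<Sum>J\<in>B. card J)"
    proof (rule card_Union_disjoint)
      show "pairwise disjnt B" using Bdis by (auto simp: pairwise_def disjnt_def)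
      show "finite J" if "J \<in> B" for J using cells_finite_nonempty(1)[OF Bbad(1)[OF that]] .
    qed
    have "4 * A * real (card (\<Union>B)) = (\<Sum>J\<in>B. 4 * A * real (card J))"
      by (simp add: cU sum_distrib_left)
    also have "\<dots> \<le> (\<Sum>J\<in>B. sum \<phi> J)" by (rule sum_mono) (rule J)
    also have "\<dots> = sum \<phi> (\<Union>B)"
    proof -
      have "\<forall>J\<in>B. finite J" using cells_finite_nonempty(1)[OF Bbad(1)] by blast
      moreover have "\<forall>J\<in>B. \<forall>L\<in>B. J \<noteq> L \<longrightarrow> J \<inter> L = {}" using Bdis by blast
      ultimately show ?thesis by (simp add: sum.Union_disjoint)
    qed
    also have "\<dots> \<le> sum \<phi> K" using Kc(1) Bbad(2) \<phi>0 by (intro sum_mono2) auto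
    finally have le: "4 * A * real (card (\<Union>B)) \<le> A * real (card K)" by (simp only: sumK)
    have "A \<noteq> 0"
    proof
      assume "A = 0"
      then have "sum \<phi> K = 0" by (simp add: sumK)
      then have "\<phi> y = 0" if "y \<in> K" for y using that Kc(1) \<phi>0 by (simp add: sum_nonneg_eq_0_iff)
      then have "mean \<phi> J0 = 0" using Bbad(2)[OF \<open>J0 \<in> B\<close>] by (auto simp: mean_def intro!: sum.neutral)
      then show False using Bbad(3)[OF \<open>J0 \<in> B\<close>] \<open>A = 0\<close> by simp
    qed
    then have "0 < A" using A0 by simp
    moreover have "A * (4 * real (card (\<Union>B))) \<le> A * real (card K)"
      using le by (simp only: mult_ac)
    ultimately have "4 * real (card (\<Union>B)) \<le> real (card K)"
      by (simp only: mult_le_cancel_left_pos)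
    then have "4 * card (\<Union>B) \<le> card K" by linarith
    then show ?thesis using Kc(3) by linarith
  qed (use Kc in simp)
  define S where "S = insert K S0"
  have KS0: "K \<notin> S0" using S0B(2) by blast
  have "sparse_cells t S"
    unfolding sparse_cells_def
  proof (intro conjI ballI)
    show "finite S" "S \<subseteq> cells t" using S0(1) less.prems by (auto simp: S_def sparse_cells_def)
    fix L assume L: "L \<in> S"
    show "2 * card (\<Union>{L' \<in> S. L' \<subset> L}) < card L"
    proof (cases "L = K")
      case True
      have "\<Union>{L' \<in> S. L' \<subset> K} \<subseteq> \<Union>B" using S0B(1) by (auto simp: S_def)
      moreover have "finite (\<Union>B)" using finB Bbad(1) cells_finite_nonempty(1) by blast
      ultimately have "card (\<Union>{L' \<in> S. L' \<subset> K}) \<le> card (\<Union>B)" by (intro card_mono)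
      then show ?thesis using cardB True by simp
    next
      case False
      then have "L \<in> S0" using L by (simp add: S_def)
      moreover have "{L' \<in> S. L' \<subset> L} = {L' \<in> S0. L' \<subset> L}" using S0B(2)[OF \<open>L \<in> S0\<close>] by (auto simp: S_def)
      ultimately show ?thesis using S0(1) by (simp add: sparse_cells_def)
    qed
  qed
  moreover have "\<forall>L\<in>S. L \<subseteq> K" using S0B(2) by (auto simp: S_def)
  moreover have "(\<Sum>x | x \<in> K \<and> 2 ^ jx x \<le> card K. U x) \<le> C * sum \<Phi> S"
  proof -
    define G where "G = {x \<in> K. 2 ^ jx x \<le> card K \<and> \<not> (\<exists>J\<in>B. x \<in> J \<and> 2 ^ jx x \<le> card J)}"
    define R where "R J = {x. x \<in> J \<and> 2 ^ jx x \<le> card J}" for J :: "int set"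
    have finR: "finite (R J)" if "J \<in> B" for J
      using cells_finite_nonempty(1)[OF Bbad(1)[OF that]] by (simp add: R_def)
    have "(\<Sum>x | x \<in> K \<and> 2 ^ jx x \<le> card K. U x) \<le> sum U (G \<union> (\<Union>J\<in>B. R J))"
    proof (rule sum_mono2)
      have "finite G" unfolding G_def using Kc(1) by simp
      moreover have "finite (\<Union>J\<in>B. R J)" using finB finR by blast
      ultimately show "finite (G \<union> (\<Union>J\<in>B. R J))" by (rule finite_UnI)
      show "{x. x \<in> K \<and> 2 ^ jx x \<le> card K} \<subseteq> G \<union> (\<Union>J\<in>B. R J)"
        unfolding G_def R_def by blast
    qed (rule U0)
    also have "\<dots> \<le> sum U G + sum U (\<Union>J\<in>B. R J)"
    proof -
      have "finite G" "finite (\<Union>J\<in>B. R J)" using Kc(1) finB finR by (auto simp: G_def)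
      from sum.union_inter[OF this, of U] show ?thesis
        using sum_nonneg[of "G \<inter> (\<Union>J\<in>B. R J)" U] U0 by simp
    qed
    also have "sum U (\<Union>J\<in>B. R J) = (\<Sum>J\<in>B. sum U (R J))"
    proof (rule sum.UNION_disjoint[OF finB])
      show "\<forall>J\<in>B. finite (R J)" using finR by blast
      show "\<forall>J\<in>B. \<forall>L\<in>B. J \<noteq> L \<longrightarrow> R J \<inter> R L = {}"
        using Bdis unfolding R_def by blast
    qed
    also have "\<dots> \<le> (\<Sum>J\<in>B. C * sum \<Phi> (SJ J))"
      unfolding R_def by (intro sum_mono SJ(2))
    also have "sum U G \<le> C * \<Phi> K"
      unfolding Kmw
    proof (rule loc)
      show "G \<subseteq> cell t m w" by (auto simp: G_def Kmw)
      show jm: "\<forall>x\<in>G. jx x \<le> m"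
      proof
        fix x assume "x \<in> G"
        then have "2 ^ jx x \<le> (2 ^ m :: nat)" unfolding G_def Kmw card_cell by blast
        then show "jx x \<le> m" by simp
      qed
      show "\<forall>x\<in>G. mean \<phi> (cell t (jx x) x) \<le> 4 * mean \<phi> (cell t m w)"
      proof (rule ballI, rule ccontr)
        fix x assume x: "x \<in> G" "\<not> mean \<phi> (cell t (jx x) x) \<le> 4 * mean \<phi> (cell t m w)"
        let ?J = "cell t (jx x) x"
        have "x \<in> cell t m w" using x(1) unfolding G_def Kmw by blast
        then have sub: "?J \<subseteq> K"
          using cell_mono[of "jx x" m t x] cell_eq[of x t m w] x(1) jm unfolding Kmw by simp
        have lt: "4 * A < mean \<phi> ?J" using x(2) unfolding A_def Kmw by simp
        then have "?J \<noteq> K" using A0 A_def by force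
        moreover have "?J \<in> cells t" unfolding cells_def by blast
        ultimately have "?J \<in> bad" using sub lt unfolding bad_def by blast
        then obtain J' where J': "J' \<in> B" "?J \<subseteq> J'" using Bmax by blast
        have "card ?J \<le> card J'"
          using J' cells_finite_nonempty(1)[OF Bbad(1)] by (intro card_mono) auto
        moreover have "x \<in> J'" using J'(2) self_in_cell by blast
        ultimately show False using x(1) J'(1) unfolding G_def card_cell by blast
      qed
    qed
    finally have "(\<Sum>x | x \<in> K \<and> 2 ^ jx x \<le> card K. U x) \<le> C * \<Phi> K + (\<Sum>J\<in>B. C * sum \<Phi> (SJ J))"
      by simp
    also have "\<dots> = C * sum \<Phi> S"
    proof -
      have "finite S0" using S0(1) by (simp add: sparse_cells_def)
      then have "sum \<Phi> S = \<Phi> K + (\<Sum>J\<in>B. sum \<Phi> (SJ J))"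
        unfolding S_def by (simp only: sum.insert[OF _ KS0] S0(2))
      then show ?thesis by (simp only: distrib_left sum_distrib_left)
    qed
    finally show ?thesis .
  qed
  ultimately show ?case by blast
qed

section \<open>Divisor averages and dyadic averages\<close>

lemma card_multiples_ge:
  assumes "0 < k" shows "N div k \<le> card {n \<in> {1..N}. k dvd n}"
proof -
  have "card ((\<lambda>m. k * m) ` {1..N div k}) \<le> card {n \<in> {1..N}. k dvd n}"
  proof (rule card_mono)
    show "(\<lambda>m. k * m) ` {1..N div k} \<subseteq> {n \<in> {1..N}. k dvd n}"
    proof
      fix n assume "n \<in> (\<lambda>m. k * m) ` {1..N div k}"
      then obtain m where "n = k * m" "m \<in> {1..N div k}" by blast
      then have m: "n = k * m" "1 \<le> m" "m \<le> N div k" by simp_all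
      have "k * m \<le> k * (N div k)" using m(3) by (rule mult_le_mono2)
      also have "\<dots> \<le> N" by simp
      finally show "n \<in> {n \<in> {1..N}. k dvd n}" using m assms by simp
    qed
  qed simp
  moreover have "card ((\<lambda>m. k * m) ` {1..N div k}) = N div k"
    using assms by (subst card_image) (auto simp: inj_on_def)
  ultimately show ?thesis by simp
qed

lemma divisor_sum_mono: "M \<le> N \<Longrightarrow> divisor_sum M \<le> divisor_sum N"
  unfolding divisor_sum_def by (rule sum_mono2) auto

text \<open>Count pairs \<open>(k, n)\<close> with \<open>k dvd n\<close> and use that the integer quotient of \<open>N\<close> by \<open>k \<le> N\<close> is at least half
of the exact one.\<close>

lemma divisor_sum_ge: "real N / 2 * harm N \<le> real (divisor_sum N)"
proof -
  have "(\<Sum>k\<in>{1..N}. N div k) \<le> (\<Sum>k\<in>{1..N}. card {n \<in> {1..N}. k dvd n})"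
    by (rule sum_mono, rule card_multiples_ge) simp
  also have "\<dots> = (\<Sum>k\<in>{1..N}. \<Sum>n\<in>{1..N}. if k dvd n then 1 else 0)"
    by (rule sum.cong[OF refl], subst sum.inter_filter[symmetric]) simp_all
  also have "\<dots> = (\<Sum>n\<in>{1..N}. \<Sum>k\<in>{1..N}. if k dvd n then 1 else 0)" by (rule sum.swap)
  also have "\<dots> = divisor_sum N"
    unfolding divisor_sum_def
  proof (rule sum.cong[OF refl])
    fix n assume n: "n \<in> {1..N}"
    have "{k. k dvd n} = {k \<in> {1..N}. k dvd n}"
      using n by (auto dest: dvd_imp_le intro: Suc_leI dvd_pos_nat)
    then show "(\<Sum>k\<in>{1..N}. if k dvd n then 1 else 0) = divisor_count n"
      unfolding divisor_count_def by (subst sum.inter_filter[symmetric]) simp_all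
  qed
  finally have 1: "(\<Sum>k\<in>{1..N}. N div k) \<le> divisor_sum N" .
  have "real N / 2 * harm N = (\<Sum>k\<in>{1..N}. real N / 2 * inverse (real k))"
    by (simp add: harm_def sum_distrib_left)
  also have "\<dots> \<le> (\<Sum>k\<in>{1..N}. real (N div k))"
  proof (rule sum_mono)
    fix k assume k: "k \<in> {1..N}"
    have "N = k * (N div k) + N mod k" by simp
    moreover have "N mod k < k" using k by simp
    moreover have "1 \<le> N div k" using k by (simp add: Suc_le_eq div_greater_zero_iff)
    then have "k * 1 \<le> k * (N div k)" by (rule mult_le_mono2)
    ultimately have "N \<le> 2 * (k * (N div k))" by linarith
    then have "real N \<le> real (2 * (k * (N div k)))" by (rule of_nat_mono)
    then show "real N / 2 * inverse (real k) \<le> real (N div k)"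
      using k by (simp add: field_simps)
  qed
  also have "\<dots> \<le> real (divisor_sum N)" using of_nat_mono[OF 1, where 'a=real] by simp
  finally show ?thesis .
qed

lemma divisor_sum_ge_scale:
  assumes "2 ^ l \<le> N"
  shows "2 ^ (l + 3) * real (l + 3) / 64 \<le> real (divisor_sum N)"
proof -
  have "2 ^ (l + 3) * real (l + 3) / 64 = 2 ^ l * ((real l + 3) / 8)" by (simp add: power_add)
  also have "\<dots> \<le> 2 ^ l * ((real l / 2 + 1) / 2)" by (intro mult_left_mono) auto
  also have "\<dots> \<le> 2 ^ l * (harm (2 ^ l) / 2)"
    using harm_pow2_ge[of l] by (intro mult_left_mono) auto
  also have "\<dots> \<le> real (divisor_sum (2 ^ l))" using divisor_sum_ge[of "2 ^ l"] by simp
  also have "\<dots> \<le> real (divisor_sum N)" by (rule of_nat_mono[OF divisor_sum_mono[OF assms]])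
  finally show ?thesis .
qed

text \<open>The divisors above \<open>K\<close> are mapped injectively by \<open>k \<mapsto> n div k\<close> to divisors at most \<open>K\<close>.\<close>

lemma divisor_count_le_small_divisors:
  assumes "0 < n" "n \<le> K\<^sup>2"
  shows "divisor_count n \<le> 2 * card {k \<in> {1..K}. k dvd n}"
proof -
  let ?S = "{k \<in> {1..K}. k dvd n}" and ?B = "{k. k dvd n \<and> K < k}"
  have finB: "finite ?B" using finite_divisors_nat[OF assms(1)] by simp
  have "card ?B \<le> card ?S"
  proof (rule card_inj_on_le)
    show "inj_on (\<lambda>k. n div k) ?B"
    proof (rule inj_onI)
      fix k l assume kl: "k \<in> ?B" "l \<in> ?B" "n div k = n div l"
      have "n = k * (n div k)" "n = l * (n div l)" using kl by auto
      then have "k * (n div k) = l * (n div k)" using kl(3) by metis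
      moreover have "n div k \<noteq> 0" using \<open>n = k * (n div k)\<close> assms(1) by (metis mult_0_right less_irrefl)
      ultimately show "k = l" by simp
    qed
    show "(\<lambda>k. n div k) ` ?B \<subseteq> ?S"
    proof
      fix q assume "q \<in> (\<lambda>k. n div k) ` ?B"
      then obtain k where k: "k dvd n" "K < k" "q = n div k" by auto
      then have n: "n = k * q" by simp
      have "q \<le> K"
      proof (rule ccontr)
        assume "\<not> q \<le> K"
        then have "K * K < k * q" using k(2) by (intro mult_strict_mono) auto
        then show False using n assms(2) by (simp add: power2_eq_square)
      qed
      moreover have "0 < q" using n assms(1) by (cases q) auto
      ultimately show "q \<in> ?S" using n by simp
    qed
  qed simp
  moreover have "{k. k dvd n} = ?S \<union> ?B" using assms(1) by (auto intro: Suc_leI dvd_pos_nat)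
  then have "divisor_count n \<le> card ?S + card ?B"
    unfolding divisor_count_def by (metis card_Un_le)
  ultimately show ?thesis by linarith
qed

lemma divisor_count_le_kernel:
  assumes "0 < n" "n \<le> 2 ^ (j - 2)" "2 \<le> j"
  shows "real (divisor_count n) \<le> 2 * real j * divisor_kernel j (int n)"
proof -
  have "j - 2 \<le> 2 * (j div 2)" by linarith
  then have "(2::nat) ^ (j - 2) \<le> 2 ^ (2 * (j div 2))" by (rule power_increasing) simp
  also have "\<dots> = (divisor_cutoff j)\<^sup>2" unfolding divisor_cutoff_def by (metis power_mult mult.commute)
  finally have "n \<le> (divisor_cutoff j)\<^sup>2" using assms(2) by linarith
  from divisor_count_le_small_divisors[OF assms(1) this]
  have "real (divisor_count n) \<le> real (2 * card {k \<in> {1..divisor_cutoff j}. k dvd n})" by (rule of_nat_mono)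
  then show ?thesis using assms(3) by (simp add: divisor_kernel_def)
qed

text \<open>Otherwise a boundary point of each grid lies in \<open>(x, y]\<close>, at mutual distance less than \<open>2 ^ (j - 2)\<close>.
But three times the difference of such points is 1 plus a multiple \<open>2 ^ j * e\<close>, where \<open>e\<close> is not
divisible by 3 and hence not 0; in effect the second grid is
shifted by about one or two thirds of the cell length at every level.\<close>

lemma two_grids:
  fixes x y :: int
  assumes t: "3 * t + 1 = 2 ^ k" and jk: "j \<le> k" and j: "2 \<le> j" and xy: "x < y" "y \<le> x + 2 ^ (j - 2)"
  shows "y \<in> cell 0 j x \<or> y \<in> cell t j x"
proof (rule ccontr)
  assume neg: "\<not> ?thesis"
  have bd: "\<exists>b. u < 2 ^ j * b \<and> 2 ^ j * b \<le> v" if "u < v" "u div 2 ^ j \<noteq> v div 2 ^ j" for u v :: int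
  proof (intro exI conjI)
    have "u div 2 ^ j \<le> v div 2 ^ j" using that(1) by (intro zdiv_mono1) auto
    then have lt: "u div 2 ^ j + 1 \<le> v div 2 ^ j" using that(2) by simp
    have "u = 2 ^ j * (u div 2 ^ j) + u mod 2 ^ j" by simp
    moreover have "u mod 2 ^ j < 2 ^ j" by simp
    ultimately have "u < 2 ^ j * (u div 2 ^ j + 1)" unfolding distrib_left by linarith
    also have "\<dots> \<le> 2 ^ j * (v div 2 ^ j)" using lt by (intro mult_left_mono) auto
    finally show "u < 2 ^ j * (v div 2 ^ j)" .
    have "v = 2 ^ j * (v div 2 ^ j) + v mod 2 ^ j" "0 \<le> v mod 2 ^ j" by simp_all
    then show "2 ^ j * (v div 2 ^ j) \<le> v" by linarith
  qed
  from neg have "x div 2 ^ j \<noteq> y div 2 ^ j" "(x - t) div 2 ^ j \<noteq> (y - t) div 2 ^ j"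
    by (auto simp: mem_cell)
  with bd[of x y] bd[of "x - t" "y - t"] xy(1) obtain b b' where
    b: "x < 2 ^ j * b" "2 ^ j * b \<le> y" "x - t < 2 ^ j * b'" "2 ^ j * b' \<le> y - t" by auto
  define q :: int where "q = 2 ^ (j - 2)"
  have q: "2 ^ j = 4 * q" "1 \<le> q"
  proof -
    have "j = 2 + (j - 2)" using j by simp
    then have "(2::int) ^ j = 2 ^ 2 * 2 ^ (j - 2)" by (metis power_add)
    then show "2 ^ j = 4 * q" by (simp add: q_def)
    show "1 \<le> q" by (simp add: q_def)
  qed
  define p :: int where "p = 2 ^ (k - j)"
  have k: "(2::int) ^ k = 2 ^ j * p" using jk by (simp add: p_def power_add[symmetric])
  define e where "e = 3 * (b - b') - p"
  define d where "d = 2 ^ j * b - t - 2 ^ j * b'"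
  have "3 * d = 2 ^ j * e + 1"
    using t unfolding k d_def by (simp add: e_def algebra_simps)
  then have eq: "3 * d = 4 * (q * e) + 1" by (simp only: q(1) mult.assoc)
  have d: "d < q" "- q < d"
    using b xy(2) unfolding q_def[symmetric] d_def by linarith+
  have "e \<noteq> 0"
  proof
    assume "e = 0"
    then have "p = 3 * (b - b')" by (simp add: e_def)
    then have "(3::int) dvd 2 ^ (k - j)" unfolding p_def by simp
    moreover have "prime (3::int)" by simp
    ultimately have "(3::int) dvd 2" using prime_dvd_power by blast
    then show False by simp
  qed
  then consider "1 \<le> e" | "e \<le> - 1" by linarith
  then show False
  proof cases
    case 1
    then have "q * 1 \<le> q * e" using q(2) by (intro mult_left_mono) auto
    then show False using eq d(1) q(2) by linarith
  next
    case 2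
    then have "q * e \<le> q * (- 1)" using q(2) by (intro mult_left_mono) auto
    then show False using eq d(2) q(2) by linarith
  qed
qed

lemma cell_op_kern_real:
  "cell_op t j (punctured_kernel j) (\<lambda>y. of_real (f y)) x =
    of_real ((\<Sum>y\<in>cell t j x - {x}. divisor_kernel j (y - x) * f y) / 2 ^ j)"
proof -
  have "(\<Sum>y\<in>cell t j x. punctured_kernel j (y - x) * of_real (f y)) = (\<Sum>y\<in>cell t j x - {x}. punctured_kernel j (y - x) * of_real (f y))"
    by (rule sum.mono_neutral_right) (auto simp: punctured_kernel_def)
  also have "\<dots> = of_real (\<Sum>y\<in>cell t j x - {x}. divisor_kernel j (y - x) * f y)"
    unfolding of_real_sum by (rule sum.cong) (auto simp: punctured_kernel_def)
  finally show ?thesis by (simp add: cell_op_def)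
qed

lemma divisor_kernel_nonneg: "0 \<le> divisor_kernel j n"
  by (simp add: divisor_kernel_def)

definition dyadic_avg :: "int \<Rightarrow> nat \<Rightarrow> (int \<Rightarrow> real) \<Rightarrow> int \<Rightarrow> real" where
  "dyadic_avg t j f x = norm (cell_op t j (punctured_kernel j) (\<lambda>y. of_real (f y)) x)"

lemma dyadic_avg_eq:
  assumes "\<And>y. 0 \<le> f y"
  shows "dyadic_avg t j f x = (\<Sum>y\<in>cell t j x - {x}. divisor_kernel j (y - x) * f y) / 2 ^ j"
  unfolding dyadic_avg_def cell_op_kern_real norm_of_real
  using assms by (simp add: sum_nonneg divisor_kernel_nonneg)

definition divisor_mean :: "nat \<Rightarrow> (int \<Rightarrow> real) \<Rightarrow> int \<Rightarrow> real" where
  "divisor_mean N f x = (\<Sum>n=1..N. real (divisor_count n) * f (x + int n)) / real (divisor_sum N)"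

lemma norm_divisor_avg_le: "norm (divisor_avg N f x) \<le> divisor_mean N (\<lambda>y. norm (f y)) x"
proof -
  have "norm (divisor_avg N f x) = norm (\<Sum>n=1..N. of_nat (divisor_count n) * f (x + int n)) / real (divisor_sum N)"
    by (simp add: divisor_avg_def norm_mult norm_divide)
  also have "\<dots> \<le> divisor_mean N (\<lambda>y. norm (f y)) x"
    unfolding divisor_mean_def by (intro divide_right_mono sum_norm_le) (auto simp: norm_mult)
  finally show ?thesis .
qed

text \<open>The displacements up to \<open>2 ^ (l + 1)\<close> are resolved by cells of level \<open>l + 3\<close> in one of the two grids.
The logarithm in the normalising sum cancels the factor \<open>j\<close> in the comparison of \<open>d(n)\<close> with the
kernel.\<close>

lemma divisor_mean_le_dyadic:
  assumes t: "3 * t + 1 = 2 ^ k" and lk: "l + 3 \<le> k" and N: "2 ^ l \<le> N" "N \<le> 2 ^ (l + 1)"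
    and f: "\<And>y. 0 \<le> f y"
  shows "divisor_mean N f x \<le> 128 * (dyadic_avg 0 (l + 3) f x + dyadic_avg t (l + 3) f x)"
proof -
  define j where "j = l + 3"
  have j: "2 \<le> j" "j - 2 = l + 1" by (simp_all add: j_def)
  let ?h = "\<lambda>y. divisor_kernel j (y - x) * f y"
  let ?A = "cell 0 j x - {x}" and ?B = "cell t j x - {x}"
  have h: "0 \<le> ?h y" for y using f divisor_kernel_nonneg by simp
  have D: "2 ^ j * real j / 64 \<le> real (divisor_sum N)" unfolding j_def by (rule divisor_sum_ge_scale[OF N(1)])
  have j0: "0 < 2 ^ j * real j / 64" using j by simp
  have "(\<Sum>n=1..N. real (divisor_count n) * f (x + int n)) \<le> (\<Sum>n=1..N. 2 * real j * ?h (x + int n))"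
  proof (rule sum_mono)
    fix n assume "n \<in> {1..N}"
    then have "real (divisor_count n) \<le> 2 * real j * divisor_kernel j (int n)"
      using N(2) j by (intro divisor_count_le_kernel) auto
    then have "real (divisor_count n) * f (x + int n) \<le> 2 * real j * divisor_kernel j (int n) * f (x + int n)"
      using f by (rule mult_right_mono)
    then show "real (divisor_count n) * f (x + int n) \<le> 2 * real j * ?h (x + int n)" by (simp add: mult.assoc)
  qed
  also have "\<dots> = 2 * real j * (\<Sum>y\<in>(\<lambda>n. x + int n) ` {1..N}. ?h y)"
    by (subst sum.reindex) (auto simp: inj_on_def sum_distrib_left)
  also have "\<dots> \<le> 2 * real j * (sum ?h ?A + sum ?h ?B)"
  proof (rule mult_left_mono)
    have sub: "(\<lambda>n. x + int n) ` {1..N} \<subseteq> ?A \<union> ?B"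
    proof
      fix y assume "y \<in> (\<lambda>n. x + int n) ` {1..N}"
      then obtain n where n: "y = x + int n" "1 \<le> n" "n \<le> 2 ^ (j - 2)" using N(2) j(2) by auto
      have "int n \<le> int (2 ^ (j - 2))" using n(3) by (simp only: of_nat_le_iff)
      then have "y \<le> x + 2 ^ (j - 2)" "x < y" using n by simp_all
      from two_grids[OF t _ j(1) this(2,1)] show "y \<in> ?A \<union> ?B" using lk \<open>x < y\<close> j_def by auto
    qed
    have "sum ?h ((\<lambda>n. x + int n) ` {1..N}) \<le> sum ?h (?A \<union> ?B)"
      using sub h by (intro sum_mono2) auto
    also have "\<dots> \<le> sum ?h ?A + sum ?h ?B"
      using sum.union_inter[of ?A ?B ?h] sum_nonneg[of "?A \<inter> ?B" ?h] h by simp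
    finally show "sum ?h ((\<lambda>n. x + int n) ` {1..N}) \<le> sum ?h ?A + sum ?h ?B" .
  qed simp
  finally have num: "(\<Sum>n=1..N. real (divisor_count n) * f (x + int n)) \<le> 2 * real j * (sum ?h ?A + sum ?h ?B)" .
  have "divisor_mean N f x \<le> (2 * real j * (sum ?h ?A + sum ?h ?B)) / (2 ^ j * real j / 64)"
    unfolding divisor_mean_def using num D j0 f h
    by (intro frac_le) (auto intro!: mult_nonneg_nonneg add_nonneg_nonneg sum_nonneg divisor_kernel_nonneg)
  also have "\<dots> = 128 * (sum ?h ?A / 2 ^ j + sum ?h ?B / 2 ^ j)"
    using j by (simp add: field_simps)
  also have "\<dots> = 128 * (dyadic_avg 0 j f x + dyadic_avg t j f x)"
    by (simp only: dyadic_avg_eq[OF f])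
  finally show ?thesis by (simp only: j_def)
qed

text \<open>Once the average reaches beyond the support of \<open>f\<close> it decreases, as only the normalisation changes. So only
finitely many scales matter.\<close>

lemma divisor_mean_truncate:
  assumes supp: "\<And>n. M < n \<Longrightarrow> f (x + int n) = 0" and N: "M \<le> N" "1 \<le> M" and f: "\<And>y. 0 \<le> f y"
  shows "divisor_mean N f x \<le> divisor_mean M f x"
proof -
  have "(\<Sum>n=1..N. real (divisor_count n) * f (x + int n)) = (\<Sum>n=1..M. real (divisor_count n) * f (x + int n))"
    using N supp by (intro sum.mono_neutral_right) auto
  moreover have "0 < divisor_sum M"
  proof -
    have "(0::real) < real M / 2 * harm M" using N(2) by (intro mult_pos_pos) (auto simp: harm_pos)
    then show ?thesis using divisor_sum_ge[of M] by (metis less_le_trans of_nat_0_less_iff)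
  qed
  ultimately show ?thesis
    unfolding divisor_mean_def using divisor_sum_mono[OF N(1)] f
    by (simp add: frac_le sum_nonneg)
qed

section \<open>Sparse domination of the divisor maximal function\<close>

definition sparse_term :: "real \<Rightarrow> real \<Rightarrow> (int \<Rightarrow> real) \<Rightarrow> (int \<Rightarrow> real) \<Rightarrow> int set \<Rightarrow> real" where
  "sparse_term r s f g K = real (card K) * mean (\<lambda>y. f y powr r) K powr (1 / r) * mean (\<lambda>y. g y powr s) K powr (1 / s)"

lemma sparse_term_nonneg: "0 \<le> sparse_term r s f g K"
  by (simp add: sparse_term_def)

text \<open>The top cells of level \<open>m\<close> that meet \<open>G\<close> are disjoint; their families are united.\<close>

lemma sparse_domination_grid:
  fixes r s :: real
  assumes r: "1 < r" and s: "1 < s"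
  shows "\<exists>C>0. \<forall>t m G jx f g. finite G \<longrightarrow> (\<forall>x\<in>G. jx x \<le> m) \<longrightarrow> (\<forall>y. 0 \<le> f y) \<longrightarrow> (\<forall>y. 0 \<le> g y) \<longrightarrow>
    (\<exists>S. sparse_cells t S \<and> (\<Sum>x\<in>G. g x * dyadic_avg t (jx x) f x) \<le> C * sum (sparse_term r s f g) S)"
proof -
  obtain C where C: "0 < C" and bound: "\<forall>t m w X jx f g. X \<subseteq> cell t m w \<longrightarrow> (\<forall>x\<in>X. jx x \<le> m) \<longrightarrow>
    (\<forall>y. 0 \<le> f y) \<longrightarrow> (\<forall>y. 0 \<le> g y) \<longrightarrow>
    (\<forall>x\<in>X. mean (\<lambda>y. f y powr r) (cell t (jx x) x) \<le> 4 * mean (\<lambda>y. f y powr r) (cell t m w)) \<longrightarrow>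
    (\<Sum>x\<in>X. g x * norm (cell_op t (jx x) (punctured_kernel (jx x)) (\<lambda>y. of_real (f y)) x)) \<le>
      C * (2 ^ m * mean (\<lambda>y. f y powr r) (cell t m w) powr (1 / r) * mean (\<lambda>y. g y powr s) (cell t m w) powr (1 / s))"
    using local_bound[OF r s] by (elim exE conjE)
  show ?thesis
  proof (intro exI[of _ C] conjI allI impI)
    fix t m and G :: "int set" and jx :: "int \<Rightarrow> nat" and f g :: "int \<Rightarrow> real"
    assume G: "finite G" and jm: "\<forall>x\<in>G. jx x \<le> m" and f: "\<forall>y. 0 \<le> f y" and g: "\<forall>y. 0 \<le> g y"
    define U where "U x = g x * dyadic_avg t (jx x) f x" for x
    have U0: "0 \<le> U x" for x using g by (simp add: U_def dyadic_avg_def)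
    have loc: "sum U X \<le> C * sparse_term r s f g (cell t m w)"
      if "X \<subseteq> cell t m w" "\<forall>x\<in>X. jx x \<le> m"
        "\<forall>x\<in>X. mean (\<lambda>y. f y powr r) (cell t (jx x) x) \<le> 4 * mean (\<lambda>y. f y powr r) (cell t m w)" for m w X
    proof -
      have "sum U X \<le> C * (2 ^ m * mean (\<lambda>y. f y powr r) (cell t m w) powr (1 / r) * mean (\<lambda>y. g y powr s) (cell t m w) powr (1 / s))"
        unfolding U_def dyadic_avg_def
        by (rule bound[THEN spec, THEN spec, THEN spec, THEN spec, THEN spec, THEN spec, THEN spec,
            THEN mp, THEN mp, THEN mp, THEN mp, THEN mp, OF that(1,2) f g that(3)])
      then show ?thesis by (simp add: sparse_term_def)
    qed
    define B where "B = cell t m ` G"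
    have B: "finite B" "\<And>J. J \<in> B \<Longrightarrow> J \<in> cells t" "\<And>J. J \<in> B \<Longrightarrow> card J = 2 ^ m"
      using G by (auto simp: B_def cells_def)
    have dis: "J \<inter> L = {}" if "J \<in> B" "L \<in> B" "J \<noteq> L" for J L
    proof (rule ccontr)
      assume "J \<inter> L \<noteq> {}"
      then obtain z where "z \<in> J" "z \<in> L" by blast
      moreover obtain x y where "J = cell t m x" "L = cell t m y" using \<open>J \<in> B\<close> \<open>L \<in> B\<close> unfolding B_def by blast
      ultimately show False using that(3) cell_eq[of z t m x] cell_eq[of z t m y] by simp
    qed
    have "\<forall>J\<in>B. \<exists>S. sparse_cells t S \<and> (\<forall>L\<in>S. L \<subseteq> J) \<and>
        (\<Sum>x | x \<in> J \<and> 2 ^ jx x \<le> card J. U x) \<le> C * sum (sparse_term r s f g) S"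
    proof
      fix J assume "J \<in> B"
      show "\<exists>S. sparse_cells t S \<and> (\<forall>L\<in>S. L \<subseteq> J) \<and>
        (\<Sum>x | x \<in> J \<and> 2 ^ jx x \<le> card J. U x) \<le> C * sum (sparse_term r s f g) S"
        by (rule sparse_domination_cell[where \<phi> = "\<lambda>y. f y powr r" and U = U and \<Phi> = "sparse_term r s f g"
              and jx = jx and C = C, OF _ U0 sparse_term_nonneg loc B(2)[OF \<open>J \<in> B\<close>]])
          simp_all
    qed
    from bchoice[OF this] obtain SJ where SJ: "\<forall>J\<in>B. sparse_cells t (SJ J) \<and> (\<forall>L\<in>SJ J. L \<subseteq> J) \<and>
        (\<Sum>x | x \<in> J \<and> 2 ^ jx x \<le> card J. U x) \<le> C * sum (sparse_term r s f g) (SJ J)"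
      by (rule exE)
    have SJ1: "sparse_cells t (SJ J) \<and> (\<forall>K\<in>SJ J. K \<subseteq> J)" if "J \<in> B" for J
      using bspec[OF SJ that] by blast
    have SJ2: "(\<Sum>x | x \<in> J \<and> 2 ^ jx x \<le> card J. U x) \<le> C * sum (sparse_term r s f g) (SJ J)" if "J \<in> B" for J
      using bspec[OF SJ that] by blast
    let ?S = "\<Union>J\<in>B. SJ J"
    have "sum U G = (\<Sum>J\<in>B. \<Sum>x | x \<in> G \<and> cell t m x = J. U x)"
      using G by (intro sum.group[symmetric]) (auto simp: B_def)
    also have "\<dots> \<le> (\<Sum>J\<in>B. \<Sum>x | x \<in> J \<and> 2 ^ jx x \<le> card J. U x)"
    proof (rule sum_mono)
      fix J assume J: "J \<in> B"
      show "(\<Sum>x | x \<in> G \<and> cell t m x = J. U x) \<le> (\<Sum>x | x \<in> J \<and> 2 ^ jx x \<le> card J. U x)"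
      proof (rule sum_mono2)
        show "finite {x. x \<in> J \<and> 2 ^ jx x \<le> card J}"
          using cells_finite_nonempty(1)[OF B(2)[OF J]] by simp
        show "{x. x \<in> G \<and> cell t m x = J} \<subseteq> {x. x \<in> J \<and> 2 ^ jx x \<le> card J}"
          using jm B(3)[OF J] by auto
      qed (rule U0)
    qed
    also have "\<dots> \<le> (\<Sum>J\<in>B. C * sum (sparse_term r s f g) (SJ J))"
      by (rule sum_mono) (rule SJ2)
    also have "\<dots> = C * sum (sparse_term r s f g) ?S"
    proof -
      have "sum (sparse_term r s f g) ?S = (\<Sum>J\<in>B. sum (sparse_term r s f g) (SJ J))"
        by (rule sparse_cells_Union(2)[OF B(1) dis SJ1])
      then show ?thesis by (simp only: sum_distrib_left[symmetric])
    qed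
    finally have "sum U G \<le> C * sum (sparse_term r s f g) ?S" .
    moreover have "sparse_cells t ?S" by (rule sparse_cells_Union(1)[OF B(1) dis SJ1])
    ultimately show "\<exists>S. sparse_cells t S \<and> (\<Sum>x\<in>G. g x * dyadic_avg t (jx x) f x) \<le> C * sum (sparse_term r s f g) S"
      unfolding U_def by blast
  qed (rule C)
qed

lemma doubled_cell:
  assumes "K \<in> cells t"
  shows "K \<subseteq> doubled K" "finite (doubled K)" "card (doubled K) = 2 * card K"
proof -
  obtain j x where K: "K = cell t j x" using assms by (auto simp: cells_def)
  define a where "a = t + 2 ^ j * ((x - t) div 2 ^ j)"
  have Ka: "K = {a..a + 2 ^ j - 1}" unfolding K cell_interval a_def by auto
  have le: "a \<le> a + 2 ^ j - 1" by simp
  have "Min K = a" "Max K = a + 2 ^ j - 1"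
    unfolding Ka using le by (auto intro!: Min_eqI Max_eqI)
  then have d: "doubled K = {a - 2 ^ j..a + 2 ^ j - 1}" by (simp add: doubled_def)
  show "K \<subseteq> doubled K" "finite (doubled K)" unfolding d by (auto simp: Ka)
  have "card (doubled K) = nat (2 * 2 ^ j)" unfolding d by simp
  also have "\<dots> = 2 * 2 ^ j" by (simp add: nat_mult_distrib nat_power_eq)
  finally show "card (doubled K) = 2 * card K" by (simp add: K)
qed

text \<open>Passing from the mean over \<open>K\<close> to the mean over the doubled interval costs at most a factor
\<open>2 powr (1 / r) \<le> 2\<close>.\<close>

lemma sparse_term_le:
  assumes K: "K \<in> cells t" and r: "1 < r"
  shows "sparse_term r s (\<lambda>y. norm (f y)) (\<lambda>y. norm (g y)) K \<le>
    2 * (real (card K) * lp_avg f (doubled K) r * lp_avg g K s)"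
proof -
  note d = doubled_cell[OF K]
  have c0: "0 < real (card K)" using cells_finite_nonempty(3)[OF K] by simp
  let ?F = "\<lambda>I. \<Sum>y\<in>I. norm (f y) powr r"
  have "mean (\<lambda>y. norm (f y) powr r) K \<le> 2 * (1 / real (card (doubled K)) * ?F (doubled K))"
  proof -
    have "?F K \<le> ?F (doubled K)" using d by (intro sum_mono2) auto
    then have "?F K / real (card K) \<le> ?F (doubled K) / real (card K)" using c0 by (simp add: divide_right_mono)
    then show ?thesis using c0 by (simp add: mean_def d(3))
  qed
  then have "mean (\<lambda>y. norm (f y) powr r) K powr (1 / r) \<le> (2 * (1 / real (card (doubled K)) * ?F (doubled K))) powr (1 / r)"
    using r by (intro powr_mono2) (auto simp: mean_def sum_nonneg)
  also have "\<dots> = 2 powr (1 / r) * lp_avg f (doubled K) r"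
    unfolding lp_avg_def by (rule powr_mult)
  also have "\<dots> \<le> 2 * lp_avg f (doubled K) r"
  proof (rule mult_right_mono)
    have "2 powr (1 / r) \<le> 2 powr 1" using r by (intro powr_mono) auto
    then show "2 powr (1 / r) \<le> (2::real)" by simp
  qed (simp add: lp_avg_def)
  finally have 1: "mean (\<lambda>y. norm (f y) powr r) K powr (1 / r) \<le> 2 * lp_avg f (doubled K) r" .
  have 2: "mean (\<lambda>y. norm (g y) powr s) K powr (1 / s) = lp_avg g K s"
    by (simp add: mean_def lp_avg_def)
  have "sparse_term r s (\<lambda>y. norm (f y)) (\<lambda>y. norm (g y)) K \<le> real (card K) * (2 * lp_avg f (doubled K) r) * lp_avg g K s"
    unfolding sparse_term_def 2 using 1 by (intro mult_right_mono mult_left_mono) (auto simp: lp_avg_def)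
  then show ?thesis by (simp only: mult.assoc mult.left_commute)
qed

lemma divisor_maximal_le_dyadic:
  fixes f :: "int \<Rightarrow> complex"
  assumes f: "finitely_supported f" and G: "finite G"
  shows "\<exists>t m j0 j1. (\<forall>x\<in>G. j0 x \<le> m \<and> j1 x \<le> m \<and>
    \<bar>divisor_maximal f x\<bar> \<le> 128 * (dyadic_avg 0 (j0 x) (\<lambda>y. norm (f y)) x + dyadic_avg t (j1 x) (\<lambda>y. norm (f y)) x))"
proof -
  let ?f = "\<lambda>y. norm (f y)"
  define F where "F = {x. f x \<noteq> 0}"
  have F: "finite F" using f by (simp add: F_def finitely_supported_def)
  define L where "L = Max (insert 0 ((\<lambda>(x, y). nat (y - x)) ` (G \<times> F)))"
  have L: "nat (y - x) \<le> L" if "x \<in> G" "y \<in> F" for x y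
    unfolding L_def using that F G by (intro Max_ge) auto
  define m where "m = L + 3"
  \<comment> \<open>an even exponent, so that \<open>2 ^ k\<close> is 1 modulo 3\<close>
  define k where "k = 2 * m"
  define t :: int where "t = (2 ^ k - 1) div 3"
  have t: "3 * t + 1 = 2 ^ k"
  proof -
    have "(4::int) ^ m mod 3 = (4 mod 3) ^ m mod 3" by (rule power_mod[symmetric])
    then have "(2::int) ^ k mod 3 = 1" by (simp add: k_def power_mult)
    then have "(3::int) dvd 2 ^ k - 1" by (simp add: mod_eq_dvd_iff[symmetric])
    then show ?thesis by (simp add: t_def)
  qed
  define W where "W u x = Max ((\<lambda>j. dyadic_avg u j ?f x) ` {..m})" for u x
  have W_ge: "dyadic_avg u j ?f x \<le> W u x" if "j \<le> m" for u j x
    unfolding W_def using that by (intro Max_ge) auto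
  have W_at: "\<exists>j\<le>m. W u x = dyadic_avg u j ?f x" for u x
  proof -
    have "W u x \<in> (\<lambda>j. dyadic_avg u j ?f x) ` {..m}" unfolding W_def by (rule Max_in) auto
    then show ?thesis by auto
  qed
  from W_at obtain jj where jj: "\<And>u x. jj u x \<le> m" "\<And>u x. W u x = dyadic_avg u (jj u x) ?f x" by metis
  have small: "divisor_mean N ?f x \<le> 128 * (W 0 x + W t x)" if N: "1 \<le> N" "N \<le> 2 ^ L" for N x
  proof -
    obtain l where l: "2 ^ l \<le> N" "N < 2 ^ (l + 1)" using ex_power_ivl1[of 2 N] N(1) by auto
    have "(2::nat) ^ l \<le> 2 ^ L" using l(1) N(2) by linarith
    then have lL: "l \<le> L" by simp
    have "divisor_mean N ?f x \<le> 128 * (dyadic_avg 0 (l + 3) ?f x + dyadic_avg t (l + 3) ?f x)"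
      by (rule divisor_mean_le_dyadic[OF t _ l(1) less_imp_le[OF l(2)]]) (use lL in \<open>auto simp: k_def m_def\<close>)
    also have "\<dots> \<le> 128 * (W 0 x + W t x)"
      using lL by (intro mult_left_mono add_mono W_ge) (auto simp: m_def)
    finally show ?thesis .
  qed
  have all: "norm (divisor_avg N f x) \<le> 128 * (W 0 x + W t x)" if x: "x \<in> G" and N: "1 \<le> N" for N x
  proof (cases "N \<le> 2 ^ L")
    case True
    then show ?thesis using norm_divisor_avg_le[of N f x] small[OF N True, of x] by linarith
  next
    case False
    have supp: "?f (x + int n) = 0" if "2 ^ L < n" for n
    proof (rule ccontr)
      assume "?f (x + int n) \<noteq> 0"
      then have "x + int n \<in> F" by (simp add: F_def)
      then have "n \<le> L" using L[OF x, of "x + int n"] by simp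
      also have "L < 2 ^ L" by (rule less_exp)
      finally show False using that by simp
    qed
    have "divisor_mean N ?f x \<le> divisor_mean (2 ^ L) ?f x"
      by (rule divisor_mean_truncate[where f = ?f and M = "2 ^ L", OF supp]) (use False in auto)
    then show ?thesis using norm_divisor_avg_le[of N f x] small[of "2 ^ L" x] by simp
  qed
  have "\<bar>divisor_maximal f x\<bar> \<le> 128 * (W 0 x + W t x)" if x: "x \<in> G" for x
  proof -
    have "divisor_maximal f x \<le> 128 * (W 0 x + W t x)"
      unfolding divisor_maximal_def by (rule cSUP_least) (use all[OF x] in auto)
    moreover have "0 \<le> divisor_maximal f x"
      unfolding divisor_maximal_def
      by (rule cSUP_upper2[of _ _ 1]) (use all[OF x] in \<open>auto intro!: bdd_aboveI2\<close>)
    ultimately show ?thesis by simp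
  qed
  then show ?thesis
    by (intro exI[of _ t] exI[of _ m] exI[of _ "jj 0"] exI[of _ "jj t"]) (simp add: jj(2)[symmetric] jj(1))
qed

theorem theorem1p3:
  fixes r s :: real
  assumes "r \<in> {1<..<2}" and "s \<in> {1<..<2}"
  shows "sparse_type r s (\<lambda>f x. complex_of_real (divisor_maximal f x))"
proof -
  have r: "1 < r" and s: "1 < s" using assms by auto
  obtain C where C: "0 < C" and dom: "\<forall>t m G jx f g. finite G \<longrightarrow> (\<forall>x\<in>G. jx x \<le> m) \<longrightarrow>
      (\<forall>y. 0 \<le> f y) \<longrightarrow> (\<forall>y. 0 \<le> g y) \<longrightarrow>
      (\<exists>S. sparse_cells t S \<and> (\<Sum>x\<in>G. g x * dyadic_avg t (jx x) f x) \<le> C * sum (sparse_term r s f g) S)"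
    using sparse_domination_grid[OF r s] by (elim exE conjE)
  show ?thesis
    unfolding sparse_type_def
  proof (intro exI[of _ "512 * C"] conjI allI impI)
    show "0 < 512 * C" using C by simp
  next
    fix f g :: "int \<Rightarrow> complex"
    assume f: "finitely_supported f" and g: "finitely_supported g"
    let ?f = "\<lambda>y. norm (f y)" and ?g = "\<lambda>y. norm (g y)"
    define G where "G = {x. g x \<noteq> 0}"
    have G: "finite G" using g by (simp add: G_def finitely_supported_def)
    obtain t m j0 j1 where jm: "\<forall>x\<in>G. j0 x \<le> m" "\<forall>x\<in>G. j1 x \<le> m" and
      K: "\<And>x. x \<in> G \<Longrightarrow> \<bar>divisor_maximal f x\<bar> \<le> 128 * (dyadic_avg 0 (j0 x) ?f x + dyadic_avg t (j1 x) ?f x)"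
      using divisor_maximal_le_dyadic[OF f G] by blast
    note dom' = dom[THEN spec, THEN spec, THEN spec, THEN spec, THEN spec, THEN spec,
        THEN mp, THEN mp, THEN mp, THEN mp, OF G]
    obtain S0 where S0: "sparse_cells 0 S0"
      "(\<Sum>x\<in>G. ?g x * dyadic_avg 0 (j0 x) ?f x) \<le> C * sum (sparse_term r s ?f ?g) S0"
      using dom'[OF jm(1), of ?f ?g 0] by auto
    obtain S1 where S1: "sparse_cells t S1"
      "(\<Sum>x\<in>G. ?g x * dyadic_avg t (j1 x) ?f x) \<le> C * sum (sparse_term r s ?f ?g) S1"
      using dom'[OF jm(2), of ?f ?g t] by auto
    \<comment> \<open>the sparse family may depend on the functions, so the larger of the two forms serves\<close>
    obtain u S where S: "sparse_cells u S"
      "sum (sparse_term r s ?f ?g) S0 \<le> sum (sparse_term r s ?f ?g) S"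
      "sum (sparse_term r s ?f ?g) S1 \<le> sum (sparse_term r s ?f ?g) S"
      using S0(1) S1(1) by (cases "sum (sparse_term r s ?f ?g) S0 \<le> sum (sparse_term r s ?f ?g) S1") auto
    define \<Phi> where "\<Phi> I = real (card I) * lp_avg f (doubled I) r * lp_avg g I s" for I
    have \<Phi>0: "0 \<le> \<Phi> I" for I by (simp add: \<Phi>_def lp_avg_def)
    have fS: "finite S" "S \<subseteq> cells u" using S(1) by (simp_all add: sparse_cells_def)
    have inner: "l2_inner (\<lambda>x. complex_of_real (divisor_maximal f x)) g =
        (\<Sum>x\<in>G. complex_of_real (divisor_maximal f x) * cnj (g x))"
    proof -
      have "l2_inner (\<lambda>x. complex_of_real (divisor_maximal f x)) g =
          (\<Sum>\<^sub>\<infinity>x\<in>G. complex_of_real (divisor_maximal f x) * cnj (g x))"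
        unfolding l2_inner_def by (rule infsum_cong_neutral) (auto simp: G_def)
      then show ?thesis using G by simp
    qed
    have "norm (l2_inner (\<lambda>x. complex_of_real (divisor_maximal f x)) g) \<le> (\<Sum>x\<in>G. ?g x * \<bar>divisor_maximal f x\<bar>)"
      unfolding inner by (rule order_trans[OF norm_sum]) (simp add: norm_mult mult.commute)
    also have "\<dots> \<le> (\<Sum>x\<in>G. ?g x * (128 * (dyadic_avg 0 (j0 x) ?f x + dyadic_avg t (j1 x) ?f x)))"
      by (intro sum_mono mult_left_mono K) auto
    also have "\<dots> = 128 * ((\<Sum>x\<in>G. ?g x * dyadic_avg 0 (j0 x) ?f x) + (\<Sum>x\<in>G. ?g x * dyadic_avg t (j1 x) ?f x))"
      unfolding sum.distrib[symmetric] sum_distrib_left by (intro sum.cong refl) (simp add: distrib_left)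
    also have "\<dots> \<le> 128 * (C * sum (sparse_term r s ?f ?g) S + C * sum (sparse_term r s ?f ?g) S)"
    proof -
      have "(\<Sum>x\<in>G. ?g x * dyadic_avg 0 (j0 x) ?f x) \<le> C * sum (sparse_term r s ?f ?g) S"
        by (rule order_trans[OF S0(2) mult_left_mono[OF S(2) less_imp_le[OF C]]])
      moreover have "(\<Sum>x\<in>G. ?g x * dyadic_avg t (j1 x) ?f x) \<le> C * sum (sparse_term r s ?f ?g) S"
        by (rule order_trans[OF S1(2) mult_left_mono[OF S(3) less_imp_le[OF C]]])
      ultimately show ?thesis by (intro mult_left_mono add_mono) simp_all
    qed
    also have "\<dots> = 256 * C * sum (sparse_term r s ?f ?g) S" by simp
    also have "\<dots> \<le> 256 * C * (\<Sum>I\<in>S. 2 * \<Phi> I)"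
      unfolding \<Phi>_def using C fS(2) by (intro mult_left_mono sum_mono sparse_term_le[OF _ r, of _ u]) auto
    also have "\<dots> = 512 * C * sum \<Phi> S" by (simp add: sum_distrib_left[symmetric])
    finally have main: "norm (l2_inner (\<lambda>x. complex_of_real (divisor_maximal f x)) g) \<le> 512 * C * sum \<Phi> S" .
    have "ennreal (norm (l2_inner (\<lambda>x. complex_of_real (divisor_maximal f x)) g)) \<le> ennreal (512 * C * sum \<Phi> S)"
      using main by (rule ennreal_leI)
    also have "\<dots> = ennreal (512 * C) * ennreal (sum \<Phi> S)"
      using C \<Phi>0 by (intro ennreal_mult) (auto simp: sum_nonneg)
    also have "ennreal (sum \<Phi> S) = (\<Sum>I\<in>S. ennreal (\<Phi> I))"
      using \<Phi>0 by (intro sum_ennreal[symmetric]) auto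
    also have "\<dots> = (\<Sum>\<^sub>\<infinity>I\<in>S. ennreal (\<Phi> I))" using fS(1) by simp
    finally have "ennreal (norm (l2_inner (\<lambda>x. complex_of_real (divisor_maximal f x)) g)) \<le>
        ennreal (512 * C) * (\<Sum>\<^sub>\<infinity>I\<in>S. ennreal (\<Phi> I))" .
    then show "\<exists>S. sparse S \<and> ennreal (norm (l2_inner (\<lambda>x. complex_of_real (divisor_maximal f x)) g)) \<le>
        ennreal (512 * C) * (\<Sum>\<^sub>\<infinity>I\<in>S. ennreal (real (card I) * lp_avg f (doubled I) r * lp_avg g I s))"
      using sparse_cells_imp_sparse[OF S(1)] unfolding \<Phi>_def by blast
  qed
qed

end
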